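(* Let $T>0$, let $r\ge 6$ be an integer, and assume that for $0\le t\le T$ there exists a regular solution $(\theta,L)$ of the system $$L_t=0,\qquad \theta_t=\Big(\frac{2\pi}{L}\Big)^3\Big[\theta_{\alpha\alpha\alpha}+\frac{\theta_\alpha^3}{2}\Big]$$ with $\theta(\cdot,t)\in C^{r+3}[0,2\pi]$ (the space defined in the context) and whose third derivative with respect to time is continuous with respect to time. Let $k=\frac{2\pi}{L}\theta_\alpha$. Let $\widetilde{\theta}^{\,j}_m$ denote the numerical solution obtained with the CNADB scheme: $\widetilde\theta^{\,0}_m=\theta(\alpha_m,0)$ and, for every wave number $m=-N/2+1,\dots,N/2$, $$\widehat{\widetilde\theta^{\,1}_m}=\widehat{\widetilde\theta^{\,0}_m}\,\frac12\big[e^{-i\gamma_m}+(1-i\gamma_m)\big]+\widehat{\widetilde{NL}^{\,0}_m}\,\frac{\Delta t}{2}\big[1+e^{-i\gamma_m}\big],$$ $$\widehat{\widetilde\theta^{\,j+1}_m}=\zeta^1_m\,\widehat{\widetilde\theta^{\,j-1}_m}+2\Delta t\,\zeta^2_m\,\widehat{\widetilde{NL}^{\,j}_m}\quad(j\ge 1),$$ where $\gamma_m=\Delta t\big(\frac{2\pi m}{L}\big)^3$, $\zeta^1_m=\frac{1-i\gamma_m}{1+i\gamma_m}$ and $\zeta^2_m=\frac{1-i\gamma_m}{1+\gamma_m^2}$. Then there exist constants $h_0=h_0(T,k)>0$, $C_0=C_0(T,k)>0$ and a constant $C(T)$ independent of the discretization parameters $h,\Delta t$ and of $j$, such that whenever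 $h\le h_0$ and $\frac{\Delta t}{h}\le C_0$, $$\|\widetilde\theta^{\,j}-\theta(\cdot,t_j)\|_{l^2}\le C(T)(h^r+\Delta t^2)$$ for all $j\ge 0$ with $t_j=j\Delta t\le T$.
   Context: Setting: $\theta(\alpha,t)$ is the tangent angle and $L>0$ the (time-independent) length of a curve evolving under Airy flow, parametrized by $\alpha$ proportional to arclength $s$ ($s_\alpha=L/2\pi$); the curvature $k=\theta_s=\frac{2\pi}{L}\theta_\alpha$ solves the modified Korteweg-de Vries equation $k_t=k_{sss}+\frac32k^2k_s$. Functions of $\alpha$ are $2\pi$-periodic. Function space: $C^{q}[0,2\pi]$ is the set of $2\pi$-periodic functions $f$ whose first $q$ derivatives exist over $(0,2\pi)$ (existence understood in the almost everywhere Riemann-Stieltjes sense), are of bounded variation over $[0,2\pi]$, and whose first $q-1$ derivatives are $2\pi$-periodic. Discretization: $N=2^p$, $h=2\pi/N$, grid points $\alpha_k=kh$ for $k=-N/2+1,\dots,N/2$; $\Delta t>0$ is the time step and $t_j=j\Delta t$. For a grid function $f=(f_k)$ the discrete Fourier coefficients are $\widehat{f_m}=\frac1N\sum_{k=-N/2+1}^{N/2}f_ke^{-im\alpha_k}$, with inverse $f_k=\sum_{m=-N/2+1}^{N/2}\widehat{f_m}e^{im\alpha_k}$. The spectral derivative $S_h$ is defined by $\widehat{S_hf_m}=im\,\widehat{f_m}$. The discrete nonlinear term is the grid function $\widetilde{NL}^{\,j}_k=\frac12\big(\frac{2\pi}{L}\big)^3\big(S_h\widetilde\theta^{\,j}_k\big)^3$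 (computed pointwise in physical space), and $\widehat{\widetilde{NL}^{\,j}_m}$ are its discrete Fourier coefficients. Norm: $\|f\|_{l^2}^2=\sum_{m=-N/2+1}^{N/2}|f_m|^2h$; $\theta(\cdot,t_j)$ in this norm means its restriction to the grid. *)

theory Defs
  imports "HOL-Analysis.Analysis"
begin

subsection \<open>Periodic functions with derivatives of bounded variation\<close>

definition bounded_variation :: "real \<Rightarrow> real \<Rightarrow> (real \<Rightarrow> real) \<Rightarrow> bool" where
  "bounded_variation a b f \<longleftrightarrow>
     (\<exists>V. \<forall>(n::nat) x. a \<le> x 0 \<and> (\<forall>i<n. x i \<le> x (Suc i)) \<and> x n \<le> b \<longrightarrow>
        (\<Sum>i<n. \<bar>f (x (Suc i)) - f (x i)\<bar>) \<le> V)"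

text \<open>
  \<open>g\<close> is the derivative of \<open>f\<close> over \<open>(0, 2\<pi>)\<close> in the almost everywhere
  Riemann-Stieltjes sense: \<open>f\<close> is differentiable with derivative \<open>g\<close> almost everywhere, and
  \<open>df = g dx\<close> as Stieltjes differentials, i.e. \<open>f\<close> is recovered from \<open>g\<close> by integration.
  The second clause rules out step functions and the Cantor function, whose almost everywhere
  derivative is 0. Below, \<open>g\<close> has bounded variation, so the integral is an ordinary Riemann
  integral.
\<close>

definition rs_derivative :: "(real \<Rightarrow> real) \<Rightarrow> (real \<Rightarrow> real) \<Rightarrow> bool" where
  "rs_derivative f g \<longleftrightarrow>
     (\<exists>S. negligible S \<and> (\<forall>x\<in>{0<..<2 * pi} - S. (f has_real_derivative g x) (at x))) \<and>
     (\<forall>x\<in>{0..2 * pi}. (g has_integral (f x - f 0)) {0..x})"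

text \<open>
  \<open>D i\<close> is the \<open>i\<close>-th derivative of \<open>f\<close>. The integral condition makes \<open>D i\<close> continuous for
  \<open>i < q\<close>, so only the last derivative \<open>D q\<close> is a choice of representative, and \<open>f\<close>
  is classically \<open>q - 1\<close> times continuously differentiable.
\<close>

definition Cq_derivatives :: "nat \<Rightarrow> (real \<Rightarrow> real) \<Rightarrow> (nat \<Rightarrow> real \<Rightarrow> real) \<Rightarrow> bool" where
  "Cq_derivatives q f D \<longleftrightarrow>
     D 0 = f \<and>
     (\<forall>x. f (x + 2 * pi) = f x) \<and>
     (\<forall>i<q. rs_derivative (D i) (D (Suc i))) \<and>
     (\<forall>i\<in>{1..q}. bounded_variation 0 (2 * pi) (D i)) \<and>
     (\<forall>i<q. \<forall>x. D i (x + 2 * pi) = D i x)"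

definition Cq_periodic :: "nat \<Rightarrow> (real \<Rightarrow> real) set" where
  "Cq_periodic q = {f. \<exists>D. Cq_derivatives q f D}"

subsection \<open>Regular solutions\<close>

definition three_times_C_on :: "real \<Rightarrow> (real \<Rightarrow> real) \<Rightarrow> bool" where
  "three_times_C_on T f \<longleftrightarrow>
     (\<exists>f1 f2 f3.
        (\<forall>t\<in>{0..T}. (f has_real_derivative f1 t) (at t within {0..T})
                  \<and> (f1 has_real_derivative f2 t) (at t within {0..T})
                  \<and> (f2 has_real_derivative f3 t) (at t within {0..T})) \<and>
        continuous_on {0..T} f3)"

text \<open>
  The equation \<open>L\<^sub>t = 0\<close> is built in by taking \<open>L\<close> to be a real number. The arguments of
  \<open>\<theta>\<close> are \<open>\<alpha>\<close> and \<open>t\<close>, in this order. Regularity on \<open>[0, T]\<close> means that membership in the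
  function space of order \<open>q\<close> holds uniformly in time, in the weak sense that the \<open>L\<^sup>2\<close> norms of
  the \<open>\<alpha>\<close>-derivatives of order at most \<open>q\<close> stay bounded.
\<close>

definition regular_solution :: "real \<Rightarrow> real \<Rightarrow> nat \<Rightarrow> (real \<Rightarrow> real \<Rightarrow> real) \<Rightarrow> bool" where
  "regular_solution T L q \<theta> \<longleftrightarrow>
     (\<forall>t\<in>{0..T}. (\<lambda>\<alpha>. \<theta> \<alpha> t) \<in> Cq_periodic q) \<and>
     (\<exists>M. \<forall>t\<in>{0..T}. \<exists>D. Cq_derivatives q (\<lambda>\<alpha>. \<theta> \<alpha> t) D \<and>
        (\<forall>i\<le>q. integral {0..2 * pi} (\<lambda>\<alpha>. (D i \<alpha>)\<^sup>2) \<le> M)) \<and>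
     (\<forall>\<alpha>. three_times_C_on T (\<lambda>t. \<theta> \<alpha> t)) \<and>
     (\<forall>\<alpha>. \<forall>t\<in>{0..T}.
        ((\<lambda>\<tau>. \<theta> \<alpha> \<tau>) has_real_derivative
           (2 * pi / L) ^ 3 * ((deriv ^^ 3) (\<lambda>x. \<theta> x t) \<alpha> + (deriv (\<lambda>x. \<theta> x t) \<alpha>) ^ 3 / 2))
          (at t within {0..T}))"

definition curvature :: "real \<Rightarrow> (real \<Rightarrow> real \<Rightarrow> real) \<Rightarrow> real \<Rightarrow> real \<Rightarrow> real" where
  "curvature L \<theta> \<alpha> t = 2 * pi / L * deriv (\<lambda>x. \<theta> x t) \<alpha>"

subsection \<open>Grid functions and the discrete Fourier transform\<close>

text \<open>
  Grid functions and discrete spectra are functions on the integers of which only the values on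
  \<open>grid N\<close> matter. They are complex valued: since the Nyquist mode \<open>m = N/2\<close> has no partner
  \<open>-N/2\<close>, the spectral derivative of a real grid function need not be real.
\<close>

definition grid :: "nat \<Rightarrow> int set" where
  "grid N = {- int (N div 2) + 1 .. int (N div 2)}"

definition mesh :: "nat \<Rightarrow> real" where
  "mesh N = 2 * pi / real N"

definition gridpt :: "nat \<Rightarrow> int \<Rightarrow> real" where
  "gridpt N k = of_int k * mesh N"

definition dft :: "nat \<Rightarrow> (int \<Rightarrow> complex) \<Rightarrow> int \<Rightarrow> complex" where
  "dft N f m = (1 / of_nat N) *
     (\<Sum>k\<in>grid N. f k * exp (- \<i> * of_int m * of_real (gridpt N k)))"

definition idft :: "nat \<Rightarrow> (int \<Rightarrow> complex) \<Rightarrow> int \<Rightarrow> complex" where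
  "idft N c k = (\<Sum>m\<in>grid N. c m * exp (\<i> * of_int m * of_real (gridpt N k)))"

definition spectral_deriv :: "nat \<Rightarrow> (int \<Rightarrow> complex) \<Rightarrow> int \<Rightarrow> complex" where
  "spectral_deriv N f = idft N (\<lambda>m. \<i> * of_int m * dft N f m)"

definition l2_norm :: "nat \<Rightarrow> (int \<Rightarrow> complex) \<Rightarrow> real" where
  "l2_norm N f = sqrt (\<Sum>m\<in>grid N. (cmod (f m))\<^sup>2 * mesh N)"

subsection \<open>The CNADB scheme\<close>

definition nonlinear_term :: "real \<Rightarrow> nat \<Rightarrow> (int \<Rightarrow> complex) \<Rightarrow> int \<Rightarrow> complex" where
  "nonlinear_term L N f k = 1 / 2 * of_real ((2 * pi / L) ^ 3) * (spectral_deriv N f k) ^ 3"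

definition gam :: "real \<Rightarrow> real \<Rightarrow> int \<Rightarrow> real" where
  "gam L dt m = dt * (2 * pi * of_int m / L) ^ 3"

definition zeta1 :: "real \<Rightarrow> real \<Rightarrow> int \<Rightarrow> complex" where
  "zeta1 L dt m = (1 - \<i> * of_real (gam L dt m)) / (1 + \<i> * of_real (gam L dt m))"

definition zeta2 :: "real \<Rightarrow> real \<Rightarrow> int \<Rightarrow> complex" where
  "zeta2 L dt m = (1 - \<i> * of_real (gam L dt m)) / (1 + of_real ((gam L dt m)\<^sup>2))"

text \<open>\<open>u j k\<close> is the numerical solution at time \<open>j \<Delta>t\<close> and grid point \<open>k\<close>.\<close>

definition cnadb_solution ::
  "real \<Rightarrow> nat \<Rightarrow> real \<Rightarrow> (real \<Rightarrow> real) \<Rightarrow> (nat \<Rightarrow> int \<Rightarrow> complex) \<Rightarrow> bool" where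
  "cnadb_solution L N dt \<theta>0 u \<longleftrightarrow>
     (\<forall>m\<in>grid N. u 0 m = of_real (\<theta>0 (gridpt N m))) \<and>
     (\<forall>m\<in>grid N. dft N (u 1) m =
        dft N (u 0) m * (1 / 2)
          * (exp (- \<i> * of_real (gam L dt m)) + (1 - \<i> * of_real (gam L dt m)))
        + dft N (nonlinear_term L N (u 0)) m * (of_real dt / 2)
          * (1 + exp (- \<i> * of_real (gam L dt m)))) \<and>
     (\<forall>j\<ge>1. \<forall>m\<in>grid N. dft N (u (j + 1)) m =
        zeta1 L dt m * dft N (u (j - 1)) m
        + 2 * of_real dt * zeta2 L dt m * dft N (nonlinear_term L N (u j)) m)"

end

theory Submission
  imports Defs
begin

text \<open>
  The scheme treats the dispersive term of \<open>\<theta>\<^sub>t = c\<^sup>3 (\<theta>\<^sub>\<alpha>\<^sub>\<alpha>\<^sub>\<alpha> + \<theta>\<^sub>\<alpha>\<^sup>3 / 2)\<close>, \<open>c = 2\<pi> / L\<close>, by a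
  trapezoidal rule over two steps and the nonlinear term explicitly at the middle level (leapfrog). The
  discrete Fourier coefficients of its error therefore satisfy a linear leapfrog recursion, in which
  the linearization of the cubic acts as an advection \<open>b \<partial>\<^sub>\<alpha>\<close> with the real coefficient
  \<open>b = 3 c\<^sup>3 \<theta>\<^sub>\<alpha>\<^sup>2 / 2\<close>, up to truncation errors and a nonlinear remainder.

  Stability of that recursion is an energy argument (\<open>energy_step\<close>, \<open>stability\<close>). Tested with the sum of
  the oldest and the newest level, the dispersive term disappears, and the advection leaves only bounded
  terms because \<open>b\<close> is real, so that \<open>b \<partial>\<^sub>\<alpha>\<close> is skew-adjoint up to a bounded operator. On the grid this
  fails for one group of entries: aliasing lets wave numbers near \<open>N / 2\<close> interact strongly with wave
  numbers near \<open>- N / 2\<close>, and the skew-symmetry is lost there. But such a pair has opposite dispersive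
  phases of size \<open>\<tau> N\<^sup>3\<close>, against an interaction of size \<open>\<tau> N\<close>. The oscillation is integrated by a normal
  form (\<open>corr_normal_form\<close>), which adds a small correction to the energy. What is asked of the time step
  \<open>\<tau>\<close> is that \<open>\<tau> / h\<close> be small, as for the leapfrog treatment of advection.

  The nonlinear remainder is quadratic in the derivative of the error, and that derivative has to be
  paid for. The error is measured in Fourier space with the weight \<open>w\<^sub>m = 1 + \<bar>m\<bar> \<surd>\<tau>\<close>. This weight is
  absorbed by the smoothing factor \<open>1 / (1 + i \<gamma>\<^sub>m)\<close> of the implicit part (\<open>norm_w_z2\<close>), it commutes
  with the advection up to bounded operators (\<open>commutator_bound\<close>), and it makes a derivative of the
  error cost \<open>\<kappa> = min N (1 / \<surd>\<tau>)\<close>. As long as \<open>\<kappa>\<^sup>2 \<surd>N\<close> times the error is at most 1, the remainder is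
  a bounded operator applied to the error, up to the truncation error (\<open>rem_bound\<close>). An error of size
  \<open>h\<^sup>6 + \<tau>\<^sup>2\<close> with \<open>\<tau> \<le> h\<close> satisfies this with a factor \<open>\<surd>h\<close> to spare, which closes an induction over
  the steps (\<open>bootstrap\<close>).

  Consistency uses the equation in place of time derivatives. Time differences of the solution and of
  its derivatives are integrals of \<open>\<alpha>\<close>-derivatives, and \<open>\<theta> \<in> C\<^sup>9\<close> is what second order in time needs
  (\<open>truncation\<close>). The spatial error of order \<open>h\<^sup>r\<close> comes from comparing the grid with arbitrarily fine
  refinements of it, which differ by aliasing only (\<open>spectral_accuracy\<close>). All the decay of discrete
  Fourier coefficients is obtained from finite differences on the grid.

  The restrictions on \<open>h\<close> and \<open>\<Delta>t\<close> may depend on the curvature, but neither on \<open>r\<close> nor on the solution.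
  They are found from the case \<open>r = 6\<close>, in which every constant comes from \<open>\<theta>\<^sub>\<alpha>\<close> and its derivatives. This
  keeps the numerical solution in the regime of the linear theory, where the estimate with the exponent
  \<open>r\<close> then holds.
\<close>

section \<open>The discrete Fourier transform\<close>

text \<open>
  The values \<open>e\<^sup>i\<^sup>m\<^sup>\<alpha>\<close> at grid points depend only on the product \<open>m k\<close> of the wave number and the grid
  index, so that one integer argument serves for both.
\<close>

definition wave :: "nat \<Rightarrow> int \<Rightarrow> complex" where
  "wave N a = cis (of_int a * mesh N)"

lemma wave_add: "wave N (a + b) = wave N a * wave N b"
  by (simp add: wave_def cis_mult distrib_right)

lemma wave_0 [simp]: "wave N 0 = 1"
  by (simp add: wave_def)

lemma cnj_wave: "cnj (wave N a) = wave N (- a)"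
  by (simp add: wave_def cis_cnj)

lemma norm_wave [simp]: "cmod (wave N a) = 1"
  by (simp add: wave_def)

lemma mesh_pos: "N > 0 \<Longrightarrow> mesh N > 0"
  by (simp add: mesh_def)

lemma mesh_mult: "N > 0 \<Longrightarrow> real N * mesh N = 2 * pi"
  by (simp add: mesh_def)

lemma wave_eq_1_iff:
  assumes "N > 0"
  shows "wave N a = 1 \<longleftrightarrow> int N dvd a"
proof -
  have "wave N a = exp (\<i> * of_real (of_int a * mesh N))"
    by (simp add: wave_def cis_conv_exp)
  then have "wave N a = 1 \<longleftrightarrow> (\<exists>n::int. of_int a * mesh N = of_int (2 * n) * pi)"
    by (simp add: exp_eq_1)
  also have "\<dots> \<longleftrightarrow> (\<exists>n::int. of_int a = of_int n * real N)"
  proof -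
    have "of_int a * mesh N = of_int (2 * n) * pi \<longleftrightarrow> of_int a = of_int n * real N" for n :: int
      using assms by (simp add: mesh_def field_simps)
    then show ?thesis by simp
  qed
  also have "\<dots> \<longleftrightarrow> (\<exists>n::int. a = n * int N)"
  proof -
    have "of_int a = of_int n * real N \<longleftrightarrow> a = n * int N" for n :: int
    proof -
      have "of_int n * real N = of_int (n * int N)" by simp
      then show ?thesis by (simp only: of_int_eq_iff)
    qed
    then show ?thesis by simp
  qed
  finally show ?thesis by (simp add: dvd_def mult.commute)
qed

lemma wave_periodic: "N > 0 \<Longrightarrow> wave N (a + int N * b) = wave N a"
  using wave_eq_1_iff[of N "int N * b"] by (simp add: wave_add)

lemma grid_exp:
  "exp (\<i> * of_int m * of_real (gridpt N k)) = wave N (m * k)"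
  "exp (- \<i> * of_int m * of_real (gridpt N k)) = wave N (- (m * k))"
  by (simp_all add: wave_def gridpt_def cis_conv_exp mult_ac)

lemma finite_grid [simp]: "finite (grid N)"
  by (simp add: grid_def)

lemma mem_grid: "even N \<Longrightarrow> m \<in> grid N \<longleftrightarrow> - int N < 2 * m \<and> 2 * m \<le> int N"
  by (auto simp: grid_def elim!: evenE)

lemma card_grid: "even N \<Longrightarrow> card (grid N) = N"
  by (auto simp: grid_def elim!: evenE)

lemma grid_bound:
  assumes "even N" "m \<in> grid N"
  shows "\<bar>real_of_int m\<bar> \<le> real N / 2"
proof -
  have "- int N < 2 * m" "2 * m \<le> int N" using assms by (simp_all add: mem_grid)
  then have "2 * \<bar>m\<bar> \<le> int N" by linarith
  then have "real_of_int (2 * \<bar>m\<bar>) \<le> real_of_int (int N)" by (simp only: of_int_le_iff)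
  then show ?thesis by simp
qed

text \<open>
  The grid is a complete residue system modulo \<open>N\<close>: translation and reflection permute it, up to
  multiples of \<open>N\<close>.
\<close>

lemma sum_grid_shift:
  fixes \<phi> :: "int \<Rightarrow> 'a :: comm_monoid_add"
  assumes "even N" "N > 0" and per: "\<And>k. \<phi> (k + int N) = \<phi> k"
  shows "(\<Sum>k\<in>grid N. \<phi> (k + a)) = (\<Sum>k\<in>grid N. \<phi> k)"
proof -
  obtain M where N: "N = 2 * M" "M > 0" using assms by (auto elim!: evenE)
  have step: "(\<Sum>k\<in>grid N. \<psi> (k + 1)) = (\<Sum>k\<in>grid N. \<psi> k)"
    if per': "\<And>k. \<psi> (k + int N) = \<psi> k" for \<psi> :: "int \<Rightarrow> 'a"
  proof -
    let ?lo = "- int M + 1" and ?hi = "int M"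
    have "(\<Sum>k\<in>grid N. \<psi> (k + 1)) = (\<Sum>k\<in>{?lo + 1..?hi + 1}. \<psi> k)"
      by (rule sum.reindex_bij_witness[where i = "\<lambda>k. k - 1" and j = "\<lambda>k. k + 1"])
         (auto simp: grid_def N)
    also have "{?lo + 1..?hi + 1} = insert (?hi + 1) {?lo + 1..?hi}"
      using N by auto
    also have "(\<Sum>k\<in>\<dots>. \<psi> k) = \<psi> (?hi + 1) + (\<Sum>k\<in>{?lo + 1..?hi}. \<psi> k)"
      by simp
    also have "\<psi> (?hi + 1) = \<psi> ?lo"
      using per'[of ?lo] by (simp add: N algebra_simps)
    also have "\<psi> ?lo + (\<Sum>k\<in>{?lo + 1..?hi}. \<psi> k) = (\<Sum>k\<in>insert ?lo {?lo + 1..?hi}. \<psi> k)"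
      by simp
    also have "insert ?lo {?lo + 1..?hi} = grid N"
      using N by (auto simp: grid_def)
    finally show ?thesis .
  qed
  have per_a: "\<phi> (k + int N + b) = \<phi> (k + b)" for k b
    using per[of "k + b"] by (simp add: add_ac)
  have up: "(\<Sum>k\<in>grid N. \<phi> (k + (b + 1))) = (\<Sum>k\<in>grid N. \<phi> (k + b))" for b
    using step[of "\<lambda>k. \<phi> (k + b)"] per_a by (simp add: add_ac)
  show ?thesis
  proof (induction a rule: int_induct[where k = 0])
    case (step1 i)
    then show ?case using up[of i] by simp
  next
    case (step2 i)
    then show ?case using up[of "i - 1"] by simp
  qed simp
qed

lemma sum_grid_reflect:
  fixes \<phi> :: "int \<Rightarrow> 'a :: comm_monoid_add"
  assumes "even N" "N > 0" and per: "\<And>k. \<phi> (k + int N) = \<phi> k"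
  shows "(\<Sum>k\<in>grid N. \<phi> (a - k)) = (\<Sum>k\<in>grid N. \<phi> k)"
proof -
  have "(\<Sum>k\<in>grid N. \<phi> (a - k)) = (\<Sum>k\<in>grid N. \<phi> (k + (a - 1)))"
    by (rule sum.reindex_bij_witness[where i = "\<lambda>k. 1 - k" and j = "\<lambda>k. 1 - k"])
       (auto simp: grid_def algebra_simps)
  also have "\<dots> = (\<Sum>k\<in>grid N. \<phi> k)"
    by (rule sum_grid_shift) (use assms in auto)
  finally show ?thesis .
qed

lemma sum_wave:
  assumes "even N" "N > 0"
  shows "(\<Sum>k\<in>grid N. wave N (l * k)) = (if int N dvd l then of_nat N else 0)"
proof (cases "int N dvd l")
  case True
  then have "wave N (l * k) = 1" for k
    using assms by (simp add: wave_eq_1_iff)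
  then show ?thesis using True assms by (simp add: card_grid)
next
  case False
  let ?S = "\<Sum>k\<in>grid N. wave N (l * k)"
  have "(\<Sum>k\<in>grid N. wave N (l * (k + 1))) = ?S"
    by (rule sum_grid_shift[where \<phi> = "\<lambda>k. wave N (l * k)"])
       (use assms wave_periodic[of N _ l] in \<open>auto simp: algebra_simps\<close>)
  moreover have "(\<Sum>k\<in>grid N. wave N (l * (k + 1))) = wave N l * ?S"
    by (simp add: sum_distrib_left distrib_left wave_add mult_ac)
  ultimately have "(wave N l - 1) * ?S = 0" by (simp add: algebra_simps)
  moreover have "wave N l \<noteq> 1" using False assms by (simp add: wave_eq_1_iff)
  ultimately show ?thesis using False by simp
qed

lemma dft_wave: "dft N f m = (\<Sum>k\<in>grid N. f k * wave N (- (m * k))) / of_nat N"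
  by (subst dft_def) (simp only: grid_exp times_divide_eq_left mult_1_left)

lemma idft_wave: "idft N c k = (\<Sum>m\<in>grid N. c m * wave N (m * k))"
  unfolding idft_def grid_exp by simp

lemma dft_cong: "(\<And>k. k \<in> grid N \<Longrightarrow> f k = g k) \<Longrightarrow> dft N f m = dft N g m"
  unfolding dft_wave by (rule arg_cong2[where f = "(/)"] sum.cong refl | simp)+

lemma dft_periodic: "N > 0 \<Longrightarrow> dft N f (m + int N) = dft N f m"
proof -
  assume N: "N > 0"
  have "wave N (- ((m + int N) * k)) = wave N (- (m * k))" for k
    using wave_periodic[OF N, of "- (m * k)" "- k"] by (simp add: algebra_simps)
  then show ?thesis by (simp add: dft_wave)
qed

lemma dft_add: "dft N (\<lambda>k. f k + g k) m = dft N f m + dft N g m"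
  by (simp add: dft_wave sum.distrib distrib_right add_divide_distrib)

lemma dft_diff: "dft N (\<lambda>k. f k - g k) m = dft N f m - dft N g m"
  by (simp add: dft_wave sum_subtractf left_diff_distrib diff_divide_distrib)

lemma dft_cmult: "dft N (\<lambda>k. c * f k) m = c * dft N f m"
  by (simp add: dft_wave sum_distrib_left mult_ac)

lemma grid_dvd_eq:
  assumes "even N" "a \<in> grid N" "b \<in> grid N" "int N dvd a - b"
  shows "a = b"
proof (rule ccontr)
  assume "a \<noteq> b"
  then have "int N \<le> \<bar>a - b\<bar>" using assms(4) by (intro zdvd_imp_le) (auto simp: dvd_abs_iff)
  then show False using assms mem_grid[of N a] mem_grid[of N b] by auto
qed

lemma idft_dft:
  assumes "even N" "N > 0" "k \<in> grid N"
  shows "idft N (dft N f) k = f k"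
proof -
  have "idft N (dft N f) k = (\<Sum>m\<in>grid N. \<Sum>j\<in>grid N. f j * wave N ((k - j) * m)) / of_nat N"
    unfolding idft_wave dft_wave sum_divide_distrib sum_distrib_right
    by (intro sum.cong refl) (simp add: algebra_simps flip: wave_add)
  also have "(\<Sum>m\<in>grid N. \<Sum>j\<in>grid N. f j * wave N ((k - j) * m))
      = (\<Sum>j\<in>grid N. f j * (\<Sum>m\<in>grid N. wave N ((k - j) * m)))"
    by (subst sum.swap) (simp add: sum_distrib_left)
  also have "\<dots> = (\<Sum>j\<in>grid N. if j = k then f j * of_nat N else 0)"
    using grid_dvd_eq[OF assms(1,3)] assms by (intro sum.cong refl) (auto simp: sum_wave)
  also have "\<dots> = f k * of_nat N" using assms(3) by simp
  finally show ?thesis using assms(2) by simp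
qed

lemma dft_idft:
  assumes "even N" "N > 0" "m \<in> grid N"
  shows "dft N (idft N c) m = c m"
proof -
  have "dft N (idft N c) m = (\<Sum>k\<in>grid N. \<Sum>j\<in>grid N. c j * wave N ((j - m) * k)) / of_nat N"
    unfolding idft_wave dft_wave sum_divide_distrib sum_distrib_right
    by (intro sum.cong refl) (simp add: algebra_simps flip: wave_add)
  also have "(\<Sum>k\<in>grid N. \<Sum>j\<in>grid N. c j * wave N ((j - m) * k))
      = (\<Sum>j\<in>grid N. c j * (\<Sum>k\<in>grid N. wave N ((j - m) * k)))"
    by (subst sum.swap) (simp add: sum_distrib_left)
  also have "\<dots> = (\<Sum>j\<in>grid N. if j = m then c j * of_nat N else 0)"
    using grid_dvd_eq[OF assms(1) _ assms(3)] assms by (intro sum.cong refl) (auto simp: sum_wave)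
  also have "\<dots> = c m * of_nat N" using assms(3) by simp
  finally show ?thesis using assms(2) by simp
qed

text \<open>
  The norm without the factor \<open>h\<close> fits Fourier coefficients: by Parseval's identity the discrete
  \<open>l\<^sup>2\<close> norm of a grid function is \<open>\<surd>(2\<pi>)\<close> times this norm of its coefficients.
\<close>

definition nrm :: "nat \<Rightarrow> (int \<Rightarrow> complex) \<Rightarrow> real" where
  "nrm N f = L2_set (\<lambda>m. cmod (f m)) (grid N)"

lemma nrm_nonneg [simp]: "0 \<le> nrm N f"
  by (simp add: nrm_def)

lemma nrm_sq: "(nrm N f)\<^sup>2 = (\<Sum>m\<in>grid N. (cmod (f m))\<^sup>2)"
  by (simp add: nrm_def L2_set_def sum_nonneg)

lemma nrm_cong: "(\<And>m. m \<in> grid N \<Longrightarrow> f m = g m) \<Longrightarrow> nrm N f = nrm N g"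
  by (simp add: nrm_def cong: L2_set_cong)

lemma nrm_triangle: "nrm N (\<lambda>m. f m + g m) \<le> nrm N f + nrm N g"
proof -
  have "nrm N (\<lambda>m. f m + g m) \<le> L2_set (\<lambda>m. cmod (f m) + cmod (g m)) (grid N)"
    unfolding nrm_def by (intro L2_set_mono norm_triangle_ineq) auto
  then show ?thesis using L2_set_triangle_ineq[of "\<lambda>m. cmod (f m)" "\<lambda>m. cmod (g m)" "grid N"]
    by (simp add: nrm_def)
qed

lemma nrm_mono:
  assumes "\<And>m. m \<in> grid N \<Longrightarrow> cmod (f m) \<le> C * cmod (g m)" "C \<ge> 0"
  shows "nrm N f \<le> C * nrm N g"
  unfolding nrm_def L2_set_right_distrib[OF assms(2)]
  by (intro L2_set_mono assms) auto

lemma nrm_cmult: "nrm N (\<lambda>m. c * f m) = cmod c * nrm N f"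
  by (simp add: nrm_def norm_mult L2_set_right_distrib)

lemma nrm_uminus [simp]: "nrm N (\<lambda>m. - f m) = nrm N f"
  by (simp add: nrm_def)

lemma nrm_triangle_minus: "nrm N (\<lambda>m. f m - g m) \<le> nrm N f + nrm N g"
  using nrm_triangle[of N f "\<lambda>m. - g m"] by simp

lemma nrm_le_sum2:
  assumes "\<And>m. m \<in> grid N \<Longrightarrow> cmod (f m) \<le> cmod (g m) + cmod (h m)"
  shows "nrm N f \<le> nrm N g + nrm N h"
proof -
  have "nrm N f \<le> L2_set (\<lambda>m. cmod (g m) + cmod (h m)) (grid N)"
    unfolding nrm_def by (intro L2_set_mono assms) auto
  then show ?thesis using L2_set_triangle_ineq[of "\<lambda>m. cmod (g m)" "\<lambda>m. cmod (h m)" "grid N"]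
    by (simp add: nrm_def)
qed

lemma nrm_sup:
  assumes "even N" "\<And>m. m \<in> grid N \<Longrightarrow> cmod (f m) \<le> B" "B \<ge> 0"
  shows "nrm N f \<le> sqrt (real N) * B"
proof -
  have "nrm N f \<le> L2_set (\<lambda>m. B) (grid N)"
    unfolding nrm_def by (intro L2_set_mono assms) auto
  then show ?thesis using assms by (simp add: L2_set_constant card_grid)
qed

lemma sum_norm_le_nrm:
  assumes "even N"
  shows "(\<Sum>m\<in>grid N. cmod (f m)) \<le> sqrt (real N) * nrm N f"
  using L2_set_mult_ineq[of "\<lambda>_. 1" "\<lambda>m. cmod (f m)" "grid N"] assms
  by (simp add: L2_set_constant card_grid nrm_def)

text \<open>
  Parseval's identity: multiplying out the square leaves the diagonal, by the orthogonality of the waves.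
\<close>

lemma nrm_idft:
  assumes "even N" "N > 0"
  shows "nrm N (idft N c) = sqrt (real N) * nrm N c"
proof -
  have "complex_of_real ((nrm N (idft N c))\<^sup>2)
      = (\<Sum>k\<in>grid N. (\<Sum>m\<in>grid N. c m * wave N (m * k)) * (\<Sum>n\<in>grid N. cnj (c n) * wave N (- (n * k))))"
    by (simp add: nrm_sq idft_wave complex_norm_square cnj_wave del: of_real_power)
  also have "\<dots> = (\<Sum>k\<in>grid N. \<Sum>m\<in>grid N. \<Sum>n\<in>grid N. c m * cnj (c n) * wave N ((m - n) * k))"
    unfolding sum_product
    by (intro sum.cong refl) (simp add: algebra_simps flip: wave_add)
  also have "\<dots> = (\<Sum>m\<in>grid N. \<Sum>n\<in>grid N. c m * cnj (c n) * (\<Sum>k\<in>grid N. wave N ((m - n) * k)))"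
    by (subst sum.swap, rule sum.cong[OF refl], subst sum.swap) (simp add: sum_distrib_left)
  also have "\<dots> = (\<Sum>m\<in>grid N. \<Sum>n\<in>grid N. if n = m then c m * cnj (c n) * of_nat N else 0)"
    using grid_dvd_eq[OF assms(1)] assms by (intro sum.cong refl) (auto simp: sum_wave)
  also have "\<dots> = complex_of_real (real N * (nrm N c)\<^sup>2)"
    by (simp add: nrm_sq sum_distrib_left complex_norm_square mult_ac del: of_real_power)
  finally have "(nrm N (idft N c))\<^sup>2 = real N * (nrm N c)\<^sup>2"
    by (simp only: of_real_eq_iff)
  then have "sqrt ((nrm N (idft N c))\<^sup>2) = sqrt (real N * (nrm N c)\<^sup>2)" by simp
  then show ?thesis by (simp add: real_sqrt_mult)
qed

lemma nrm_dft:
  assumes "even N" "N > 0"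
  shows "sqrt (real N) * nrm N (dft N f) = nrm N f"
  using nrm_idft[OF assms, of "dft N f"] idft_dft[OF assms]
  by (metis nrm_cong)

lemma l2_norm_nrm:
  assumes "even N" "N > 0"
  shows "l2_norm N f = sqrt (2 * pi) * nrm N (dft N f)"
proof -
  have "l2_norm N f = sqrt ((nrm N f)\<^sup>2 * mesh N)"
    by (simp add: l2_norm_def nrm_sq sum_distrib_right)
  also have "(nrm N f)\<^sup>2 = real N * (nrm N (dft N f))\<^sup>2"
    using nrm_dft[OF assms, of f, symmetric] by (simp add: power_mult_distrib)
  also have "\<dots> * mesh N = 2 * pi * (nrm N (dft N f))\<^sup>2"
    using mesh_mult[OF assms(2)] by (metis mult.assoc mult.commute)
  finally show ?thesis by (simp add: real_sqrt_mult)
qed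

lemma nrm_dft_sup:
  assumes "even N" "N > 0" "\<And>m. m \<in> grid N \<Longrightarrow> cmod (f m) \<le> B" "B \<ge> 0"
  shows "nrm N (dft N f) \<le> B"
proof -
  have "sqrt (real N) * nrm N (dft N f) \<le> sqrt (real N) * B"
    using nrm_sup[OF assms(1,3,4)] nrm_dft[OF assms(1,2)] by simp
  then show ?thesis using assms(2) by simp
qed

lemma norm_dft_sup:
  assumes "even N" "N > 0" "\<And>k. k \<in> grid N \<Longrightarrow> cmod (f k) \<le> B"
  shows "cmod (dft N f m) \<le> B"
proof -
  have "cmod (\<Sum>k\<in>grid N. f k * wave N (- (m * k))) \<le> (\<Sum>k\<in>grid N. B)"
    by (rule order_trans[OF norm_sum]) (intro sum_mono, simp add: norm_mult assms(3))
  then show ?thesis using assms(1,2) by (simp add: dft_wave norm_divide card_grid field_simps)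
qed

text \<open>
  Products become convolutions. The coefficients have period \<open>N\<close>, so the differences \<open>m - n\<close> that leave
  the grid are aliased without further notice.
\<close>

lemma dft_mult:
  assumes "even N" "N > 0"
  shows "dft N (\<lambda>k. f k * g k) m = (\<Sum>n\<in>grid N. dft N f (m - n) * dft N g n)"
proof -
  have "dft N (\<lambda>k. f k * g k) m = dft N (\<lambda>k. f k * idft N (dft N g) k) m"
    by (rule dft_cong) (simp add: idft_dft assms)
  also have "\<dots> = (\<Sum>k\<in>grid N. \<Sum>n\<in>grid N. dft N g n * (f k * wave N (- ((m - n) * k)))) / of_nat N"
    unfolding dft_wave[of N _ m] idft_wave sum_distrib_left sum_distrib_right
    by (intro arg_cong2[where f = "(/)"] sum.cong refl)
       (simp add: algebra_simps flip: wave_add)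
  also have "\<dots> = (\<Sum>n\<in>grid N. dft N f (m - n) * dft N g n)"
    by (subst sum.swap) (simp add: dft_wave[of N f] sum_divide_distrib sum_distrib_left mult_ac)
  finally show ?thesis .
qed

lemma dft_cnj_real:
  assumes "\<And>k. k \<in> grid N \<Longrightarrow> f k \<in> \<real>"
  shows "dft N f (- m) = cnj (dft N f m)"
  unfolding dft_wave cnj_sum complex_cnj_divide complex_cnj_mult cnj_wave
  by (intro arg_cong2[where f = "(/)"] sum.cong) (use assms in \<open>auto simp: Reals_cnj_iff\<close>)

text \<open>
  Of the wave numbers \<open>l + N q\<close>, which the grid cannot tell apart, \<open>rep N l\<close> is the one in the grid.
\<close>

definition rep :: "nat \<Rightarrow> int \<Rightarrow> int" where
  "rep N l = (l + int (N div 2) - 1) mod int N - int (N div 2) + 1"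

lemma rep_grid: "even N \<Longrightarrow> N > 0 \<Longrightarrow> rep N l \<in> grid N"
proof -
  assume N: "even N" "N > 0"
  then have *: "0 \<le> (l + int (N div 2) - 1) mod int N" "(l + int (N div 2) - 1) mod int N < int N"
    by simp_all
  have "2 * int (N div 2) = int N" using N by (auto elim!: evenE)
  then show ?thesis using * unfolding rep_def grid_def atLeastAtMost_iff by linarith
qed

lemma rep_dvd: "int N dvd l - rep N l"
proof -
  have "l - rep N l = (l + int (N div 2) - 1) - (l + int (N div 2) - 1) mod int N"
    by (simp add: rep_def)
  then show ?thesis by (metis dvd_minus_mod)
qed

lemma rep_obtain: obtains q where "l = rep N l + int N * q"
  using rep_dvd[of N l] by (metis add.commute diff_add_cancel dvdE)

lemma rep_eq:
  assumes "even N" "N > 0" "m \<in> grid N" "int N dvd l - m"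
  shows "rep N l = m"
proof (rule grid_dvd_eq[OF assms(1) rep_grid[OF assms(1,2)] assms(3)])
  have "int N dvd (l - m) - (l - rep N l)" using assms(4) rep_dvd by (rule dvd_diff)
  then show "int N dvd rep N l - m" by simp
qed

lemma rep_periodic: "even N \<Longrightarrow> N > 0 \<Longrightarrow> rep N (l + int N) = rep N l"
proof (rule rep_eq)
  have "l + int N - rep N l = (l - rep N l) + int N" by simp
  then show "int N dvd l + int N - rep N l" using rep_dvd by (metis dvd_add dvd_refl)
qed (auto intro: rep_grid)

lemma rep_id: "even N \<Longrightarrow> N > 0 \<Longrightarrow> m \<in> grid N \<Longrightarrow> rep N m = m"
  by (rule rep_eq) auto

lemma rep_diff_cases:
  assumes "even N" "N > 0" "m \<in> grid N" "n \<in> grid N"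
  shows "rep N (m - n) = m - n \<or> rep N (m - n) = m - n + int N \<or> rep N (m - n) = m - n - int N"
proof -
  obtain q where q: "m - n = rep N (m - n) + int N * q" by (rule rep_obtain)
  have b: "- int N < 2 * m" "2 * m \<le> int N" "- int N < 2 * n" "2 * n \<le> int N"
     "- int N < 2 * rep N (m - n)" "2 * rep N (m - n) \<le> int N"
    using assms rep_grid[OF assms(1,2), of "m - n"] by (simp_all add: mem_grid)
  have l: "int N * q < 2 * int N" "- (2 * int N) < int N * q" using q b by linarith+
  have "q < 2" using l(1) assms(2) by (simp add: mult.commute)
  moreover have "- 2 < q"
  proof -
    have "int N * (- 2) < int N * q" using l(2) by simp
    then show ?thesis using assms(2) by (simp only: mult_less_cancel_left_pos of_nat_0_less_iff)
  qed
  ultimately have "q = - 1 \<or> q = 0 \<or> q = 1" by auto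
  then show ?thesis using q by auto
qed

text \<open>
  Aliasing identifies the wave numbers \<open>m - n\<close> and \<open>m - n \<plusminus> N\<close>, yet the moduli \<open>\<bar>m\<bar>\<close> and \<open>\<bar>n\<bar>\<close>
  never differ by more than the aliased difference.
\<close>

lemma abs_diff_le_rep:
  assumes "even N" "N > 0" "m \<in> grid N" "n \<in> grid N"
  shows "\<bar>\<bar>m\<bar> - \<bar>n\<bar>\<bar> \<le> \<bar>rep N (m - n)\<bar>"
proof -
  have b: "- int N < 2 * m" "2 * m \<le> int N" "- int N < 2 * n" "2 * n \<le> int N"
    using assms by (simp_all add: mem_grid)
  from rep_diff_cases[OF assms] b show ?thesis by (smt (verit))
qed

text \<open>
  Aliasing shortens a difference considerably only when the two wave numbers lie near opposite ends of
  the grid.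
\<close>

lemma near_le_rep:
  assumes "even N" "N > 0" "m \<in> grid N" "n \<in> grid N" "4 * \<bar>m - n\<bar> \<le> 3 * int N"
  shows "\<bar>m - n\<bar> \<le> 3 * \<bar>rep N (m - n)\<bar>"
proof -
  have b: "- int N < 2 * m" "2 * m \<le> int N" "- int N < 2 * n" "2 * n \<le> int N"
    "- int N < 2 * rep N (m - n)" "2 * rep N (m - n) \<le> int N"
    using assms rep_grid[OF assms(1,2), of "m - n"] by (simp_all add: mem_grid)
  from rep_diff_cases[OF assms(1-4)] show ?thesis
    using b assms(5) by (smt (verit))
qed

section \<open>Kernels and bilinear forms\<close>

definition app :: "nat \<Rightarrow> (int \<Rightarrow> int \<Rightarrow> complex) \<Rightarrow> (int \<Rightarrow> complex) \<Rightarrow> int \<Rightarrow> complex" where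
  "app N K x m = (\<Sum>n\<in>grid N. K m n * x n)"

definition ip :: "nat \<Rightarrow> (int \<Rightarrow> complex) \<Rightarrow> (int \<Rightarrow> complex) \<Rightarrow> complex" where
  "ip N x y = (\<Sum>m\<in>grid N. x m * cnj (y m))"

definition bil :: "nat \<Rightarrow> (int \<Rightarrow> int \<Rightarrow> complex) \<Rightarrow> (int \<Rightarrow> complex) \<Rightarrow> (int \<Rightarrow> complex) \<Rightarrow> real" where
  "bil N K x y = Re (ip N (app N K x) y)"

text \<open>
  A convolution with \<open>d\<close> and a differentiation commute up to an operator with entries of size
  \<open>\<bar>m - n\<bar> \<bar>d (m - n)\<bar>\<close>. The weight is chosen such that the sum bounds both the convolution and this
  commutator.
\<close>

definition wsum :: "nat \<Rightarrow> (int \<Rightarrow> complex) \<Rightarrow> real" where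
  "wsum N d = (\<Sum>l\<in>grid N. (1 + \<bar>real_of_int l\<bar>) * cmod (d l))"

lemma norm_ip_le: "cmod (ip N x y) \<le> nrm N x * nrm N y"
proof -
  have "cmod (ip N x y) \<le> (\<Sum>m\<in>grid N. \<bar>cmod (x m)\<bar> * \<bar>cmod (y m)\<bar>)"
    unfolding ip_def by (rule order_trans[OF norm_sum]) (simp add: norm_mult)
  also have "\<dots> \<le> nrm N x * nrm N y" unfolding nrm_def by (rule L2_set_mult_ineq)
  finally show ?thesis .
qed

lemma Re_ip_le: "\<bar>Re (ip N x y)\<bar> \<le> nrm N x * nrm N y"
  by (rule order_trans[OF abs_Re_le_cmod norm_ip_le])

lemma Re_ip_self: "Re (ip N x x) = (nrm N x)\<^sup>2"
  unfolding nrm_sq cmod_power2 ip_def by (simp add: power2_eq_square)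

text \<open>
  Schur's test: by the Cauchy-Schwarz inequality with weights \<open>\<kappa>\<close>, an operator whose entries are
  dominated by a periodic convolution kernel is bounded by the sum of that kernel.
\<close>

lemma schur:
  assumes N: "even N" "N > 0"
    and per: "\<And>l. \<kappa> (l + int N) = \<kappa> l" and nn: "\<And>l. 0 \<le> \<kappa> l"
    and K: "\<And>m n. m \<in> grid N \<Longrightarrow> n \<in> grid N \<Longrightarrow> cmod (K m n) \<le> \<kappa> (m - n)"
  shows "nrm N (app N K x) \<le> (\<Sum>l\<in>grid N. \<kappa> l) * nrm N x"
proof (rule power2_le_imp_le)
  define S where "S = (\<Sum>l\<in>grid N. \<kappa> l)"
  have S: "S \<ge> 0" unfolding S_def by (intro sum_nonneg nn)
  have row: "(\<Sum>n\<in>grid N. \<kappa> (m - n)) = S" for m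
    unfolding S_def by (rule sum_grid_reflect) (use N per in auto)
  have col: "(\<Sum>m\<in>grid N. \<kappa> (m - n)) = S" for n
    using sum_grid_shift[of N \<kappa> "- n"] N per by (simp add: S_def)
  have pt: "(cmod (app N K x m))\<^sup>2 \<le> S * (\<Sum>n\<in>grid N. \<kappa> (m - n) * (cmod (x n))\<^sup>2)"
    if m: "m \<in> grid N" for m
  proof -
    let ?u = "\<lambda>n. sqrt (\<kappa> (m - n))"
    have "cmod (app N K x m) \<le> (\<Sum>n\<in>grid N. \<kappa> (m - n) * cmod (x n))"
      unfolding app_def
      by (rule order_trans[OF norm_sum]) (intro sum_mono, simp add: norm_mult mult_right_mono K m)
    also have "\<dots> = (\<Sum>n\<in>grid N. \<bar>?u n\<bar> * \<bar>?u n * cmod (x n)\<bar>)"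
      by (intro sum.cong refl) (simp add: abs_mult nn flip: mult.assoc)
    also have "\<dots> \<le> L2_set ?u (grid N) * L2_set (\<lambda>n. ?u n * cmod (x n)) (grid N)"
      by (rule L2_set_mult_ineq)
    also have "\<dots> = sqrt S * sqrt (\<Sum>n\<in>grid N. \<kappa> (m - n) * (cmod (x n))\<^sup>2)"
      by (simp add: L2_set_def power_mult_distrib nn row)
    finally have "(cmod (app N K x m))\<^sup>2 \<le> (sqrt S * sqrt (\<Sum>n\<in>grid N. \<kappa> (m - n) * (cmod (x n))\<^sup>2))\<^sup>2"
      by (intro power_mono) auto
    also have "\<dots> = S * (\<Sum>n\<in>grid N. \<kappa> (m - n) * (cmod (x n))\<^sup>2)"
      using S by (simp add: power_mult_distrib sum_nonneg nn)
    finally show ?thesis .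
  qed
  have "(nrm N (app N K x))\<^sup>2 \<le> (\<Sum>m\<in>grid N. S * (\<Sum>n\<in>grid N. \<kappa> (m - n) * (cmod (x n))\<^sup>2))"
    unfolding nrm_sq by (intro sum_mono pt)
  also have "\<dots> = S * (\<Sum>n\<in>grid N. \<Sum>m\<in>grid N. \<kappa> (m - n) * (cmod (x n))\<^sup>2)"
    by (subst sum.swap) (simp add: sum_distrib_left)
  also have "\<dots> = (S * nrm N x)\<^sup>2"
    by (simp add: col power_mult_distrib nrm_sq power2_eq_square[of S] sum_distrib_left mult_ac
        flip: sum_distrib_right)
  finally show "(nrm N (app N K x))\<^sup>2 \<le> ((\<Sum>l\<in>grid N. \<kappa> l) * nrm N x)\<^sup>2" by (simp add: S_def)
  show "0 \<le> (\<Sum>l\<in>grid N. \<kappa> l) * nrm N x" using S by (simp add: S_def)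
qed

text \<open>
  The coefficients \<open>d\<close> have period \<open>N\<close>, but the weight \<open>1 + \<bar>l\<bar>\<close> has not; it has to be taken at the
  representative in the grid.
\<close>

lemma schur_wsum:
  assumes N: "even N" "N > 0" and per: "\<And>l. d (l + int N) = d l" and C: "0 \<le> C"
    and K: "\<And>m n. m \<in> grid N \<Longrightarrow> n \<in> grid N \<Longrightarrow>
      cmod (K m n) \<le> C * ((1 + \<bar>real_of_int (rep N (m - n))\<bar>) * cmod (d (m - n)))"
  shows "nrm N (app N K x) \<le> C * wsum N d * nrm N x"
proof -
  have "nrm N (app N K x)
      \<le> (\<Sum>l\<in>grid N. C * ((1 + \<bar>real_of_int (rep N l)\<bar>) * cmod (d l))) * nrm N x"
    by (rule schur) (use N per C K in \<open>auto simp: rep_periodic\<close>)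
  also have "(\<Sum>l\<in>grid N. C * ((1 + \<bar>real_of_int (rep N l)\<bar>) * cmod (d l))) = C * wsum N d"
    unfolding wsum_def sum_distrib_left using N by (intro sum.cong refl) (simp add: rep_id)
  finally show ?thesis .
qed

lemma bil_le:
  assumes N: "even N" "N > 0" and per: "\<And>l. d (l + int N) = d l" and C: "0 \<le> C"
    and K: "\<And>m n. m \<in> grid N \<Longrightarrow> n \<in> grid N \<Longrightarrow>
      cmod (K m n) \<le> C * ((1 + \<bar>real_of_int (rep N (m - n))\<bar>) * cmod (d (m - n)))"
    and w: "wsum N d \<le> W"
  shows "\<bar>bil N K x y\<bar> \<le> C * W * (nrm N x * nrm N y)"
proof -
  have "\<bar>bil N K x y\<bar> \<le> nrm N (app N K x) * nrm N y"
    unfolding bil_def by (rule Re_ip_le)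
  also have "\<dots> \<le> (C * wsum N d * nrm N x) * nrm N y"
    by (intro mult_right_mono schur_wsum) (use assms in auto)
  also have "\<dots> \<le> (C * W * nrm N x) * nrm N y"
    by (intro mult_right_mono mult_left_mono w C) auto
  finally show ?thesis by (simp add: mult_ac)
qed

lemma bil_cong:
  "(\<And>m n. m \<in> grid N \<Longrightarrow> n \<in> grid N \<Longrightarrow> K m n = K' m n) \<Longrightarrow> bil N K x y = bil N K' x y"
  by (simp add: bil_def ip_def app_def)

lemma bil_sum: "bil N K x y = (\<Sum>m\<in>grid N. \<Sum>n\<in>grid N. Re (K m n * x n * cnj (y m)))"
  by (simp add: bil_def ip_def app_def sum_distrib_right)

lemma bil_add_kernel: "bil N (\<lambda>m n. K m n + K' m n) x y = bil N K x y + bil N K' x y"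
  by (simp add: bil_sum distrib_right flip: sum.distrib)

lemma bil_diff_kernel: "bil N (\<lambda>m n. K m n - K' m n) x y = bil N K x y - bil N K' x y"
  by (simp add: bil_sum left_diff_distrib flip: sum_subtractf)

lemma Re_of_real_mult: "Re (of_real r * z) = r * Re z"
  by simp

lemma bil_cmult_kernel: "bil N (\<lambda>m n. of_real r * K m n) x y = r * bil N K x y"
  unfolding bil_sum sum_distrib_left
  by (intro sum.cong refl) (simp only: mult.assoc Re_of_real_mult)

lemma bil_adjoint: "bil N K x y = bil N (\<lambda>m n. cnj (K n m)) y x"
proof -
  have "bil N (\<lambda>m n. cnj (K n m)) y x
      = (\<Sum>m\<in>grid N. \<Sum>n\<in>grid N. Re (cnj (K n m * x m * cnj (y n))))"
    unfolding bil_sum by (intro sum.cong refl arg_cong[where f = Re]) (simp add: mult_ac)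
  also have "\<dots> = bil N K x y" unfolding bil_sum cnj.sel(1) by (rule sum.swap)
  finally show ?thesis by simp
qed

text \<open>Expanding either argument of a bilinear form along a linear combination.\<close>

lemma bil_left:
  assumes "\<And>n. n \<in> grid N \<Longrightarrow> z n = a n * x n + of_real s * (b n * y n) + of_real s * g n"
  shows "bil N K z u = bil N (\<lambda>m n. K m n * a n) x u + s * bil N (\<lambda>m n. K m n * b n) y u
    + s * bil N K g u"
proof -
  have "Re (K m n * z n * cnj (u m)) = Re (K m n * a n * x n * cnj (u m))
      + s * Re (K m n * b n * y n * cnj (u m)) + s * Re (K m n * g n * cnj (u m))"
    if "n \<in> grid N" for m n
  proof -
    have "K m n * z n * cnj (u m) = K m n * a n * x n * cnj (u m)
      + of_real s * (K m n * b n * y n * cnj (u m)) + of_real s * (K m n * g n * cnj (u m))"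
      unfolding assms[OF that] by (simp add: algebra_simps)
    then show ?thesis by (simp only: plus_complex.sel Re_of_real_mult)
  qed
  then show ?thesis by (simp add: bil_sum sum_distrib_left flip: sum.distrib)
qed

lemma bil_right:
  assumes "\<And>m. m \<in> grid N \<Longrightarrow> z m = a m * x m + of_real s * (b m * y m) + of_real s * g m"
  shows "bil N K u z = bil N (\<lambda>m n. K m n * cnj (a m)) u x + s * bil N (\<lambda>m n. K m n * cnj (b m)) u y
    + s * bil N K u g"
  unfolding bil_adjoint[of N _ u]
  using bil_left[of N z a x s b y g "\<lambda>m n. cnj (K n m)" u] assms by simp

section \<open>Linear stability of the leapfrog step\<close>

text \<open>
  \<open>Cb\<close> bounds the coefficients of the advecting function. The first summand of the restriction is the
  condition on \<open>\<tau> / h\<close>; the second one only asks that \<open>N\<close> is large, and makes the normal form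
  correction of the energy small.
\<close>

locale leapfrog =
  fixes L \<tau> Cb :: real and N :: nat
  assumes L: "L > 0" and \<tau>: "\<tau> > 0" and N: "even N" "N > 0"
    and Cb: "Cb \<ge> 0"
    and cfl: "3 * (\<tau> * real N * Cb) + 64 * Cb / ((2 * pi / L) ^ 3 * (real N)\<^sup>2) \<le> 1"
begin

definition c where "c = 2 * pi / L"

lemma c: "c > 0" using L by (simp add: c_def)

abbreviation gm :: "int \<Rightarrow> real" where "gm m \<equiv> gam L \<tau> m"
abbreviation z1 :: "int \<Rightarrow> complex" where "z1 m \<equiv> zeta1 L \<tau> m"
abbreviation z2 :: "int \<Rightarrow> complex" where "z2 m \<equiv> zeta2 L \<tau> m"

lemma gm: "gm m = \<tau> * (c * of_int m) ^ 3"
  by (simp add: gam_def c_def)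

lemma gm_abs: "\<bar>gm m\<bar> = \<tau> * c ^ 3 * \<bar>of_int m\<bar> ^ 3"
  using \<tau> c by (simp add: gm abs_mult power_abs power_mult_distrib)

lemma one_gm_nz: "1 + \<i> * of_real g \<noteq> 0" "1 - \<i> * of_real g \<noteq> 0"
  by (auto simp: complex_eq_iff)

lemma z2_eq: "z2 m = 1 / (1 + \<i> * of_real (gm m))"
proof -
  have "(1 + \<i> * of_real (gm m)) * (1 - \<i> * of_real (gm m)) = 1 + of_real ((gm m)\<^sup>2)"
    by (simp add: algebra_simps power2_eq_square)
  then show ?thesis unfolding zeta2_def
    by (smt (verit) divide_divide_eq_right divide_self_if mult_1 one_gm_nz(2) nonzero_divide_mult_cancel_right)
qed

lemma z1_eq: "z1 m = 2 * z2 m - 1"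
  unfolding zeta1_def z2_eq using one_gm_nz(1)[of "gm m"] by (simp add: field_simps)

lemma norm_1_gm: "cmod (1 + \<i> * of_real g) = sqrt (1 + g\<^sup>2)" "cmod (1 - \<i> * of_real g) = sqrt (1 + g\<^sup>2)"
  by (simp_all add: cmod_def)

lemma norm_z1: "cmod (z1 m) = 1"
proof -
  have "sqrt (1 + (gm m)\<^sup>2) > 0" by (simp add: add_pos_nonneg)
  then show ?thesis by (simp add: zeta1_def norm_divide norm_1_gm)
qed

lemma norm_z2: "cmod (z2 m) = 1 / sqrt (1 + (gm m)\<^sup>2)"
  by (simp add: z2_eq norm_divide norm_1_gm)

lemma norm_z2_le: "cmod (z2 m) \<le> 1"
  by (simp add: norm_z2 add_pos_nonneg)

lemma norm_z2_gm: "\<bar>gm m\<bar> * cmod (z2 m) \<le> 1"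
proof -
  have "\<bar>gm m\<bar> \<le> sqrt (1 + (gm m)\<^sup>2)" by (rule real_le_rsqrt) simp
  then show ?thesis by (simp add: norm_z2 add_pos_nonneg)
qed

text \<open>
  The operator \<open>b \<partial>\<^sub>\<alpha>\<close> for a function \<open>b\<close> with the discrete Fourier coefficients \<open>d\<close>. For real \<open>b\<close>, adding
  the adjoint leaves the entries \<open>i (n - m) d (m - n)\<close>. They are harmless as long as \<open>m - n\<close> is
  comparable to its representative in the grid. For the \<open>far\<close> entries the representative may be as small
  as \<open>1\<close> while \<open>\<bar>m - n\<bar>\<close> is about \<open>N\<close>.
\<close>

definition adv :: "(int \<Rightarrow> complex) \<Rightarrow> int \<Rightarrow> int \<Rightarrow> complex" where
  "adv d m n = \<i> * of_int n * d (m - n)"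

definition far :: "int \<Rightarrow> int \<Rightarrow> bool" where
  "far m n \<longleftrightarrow> 3 * int N < 4 * \<bar>m - n\<bar>"

definition advN where "advN d m n = (if far m n then 0 else adv d m n)"
definition advF where "advF d m n = (if far m n then adv d m n else 0)"

text \<open>
  The solution of the linear equation in \<open>corr_normal_form\<close>. Its denominator, the difference of the
  two dispersive phases, is of size \<open>\<tau> N\<^sup>3\<close> for far entries.
\<close>

definition corr :: "(int \<Rightarrow> complex) \<Rightarrow> int \<Rightarrow> int \<Rightarrow> complex" where
  "corr d m n = (if far m n then of_real (2 * \<tau> * of_int n / (gm n - gm m))
      * (1 + \<i> * of_real (gm n)) * d (m - n) else 0)"

text \<open>
  Far wave numbers have opposite signs, so that their phases add up in modulus, and both are large.
\<close>

lemma far_facts: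
  assumes "m \<in> grid N" "n \<in> grid N" "far m n"
  shows "real N < 4 * \<bar>real_of_int m\<bar>" "real N < 4 * \<bar>real_of_int n\<bar>"
    "\<bar>real_of_int n\<bar> \<le> 2 * \<bar>real_of_int m\<bar>" "\<bar>gm n - gm m\<bar> = \<bar>gm n\<bar> + \<bar>gm m\<bar>"
proof -
  have b: "- int N < 2 * m" "2 * m \<le> int N" "- int N < 2 * n" "2 * n \<le> int N"
    using assms N by (simp_all add: mem_grid)
  have f: "3 * int N < 4 * \<bar>m - n\<bar>" using assms(3) by (simp add: far_def)
  have i: "int N < 4 * \<bar>m\<bar>" "int N < 4 * \<bar>n\<bar>" "\<bar>n\<bar> \<le> 2 * \<bar>m\<bar>"
    using b f by (smt (verit))+
  have "real_of_int (int N) < real_of_int (4 * \<bar>m\<bar>)" "real_of_int (int N) < real_of_int (4 * \<bar>n\<bar>)"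
    "real_of_int \<bar>n\<bar> \<le> real_of_int (2 * \<bar>m\<bar>)"
    using i by (simp_all only: of_int_less_iff of_int_le_iff)
  then show "real N < 4 * \<bar>real_of_int m\<bar>" "real N < 4 * \<bar>real_of_int n\<bar>"
    "\<bar>real_of_int n\<bar> \<le> 2 * \<bar>real_of_int m\<bar>" by simp_all
  have opp: "m > 0 \<and> n < 0 \<or> m < 0 \<and> n > 0" using b f N(2) by (smt (verit))
  have pos: "gm k > 0" if "k > 0" for k using that \<tau> c by (simp add: gm)
  have neg: "gm k < 0" if "k < 0" for k
  proof -
    have "(c * of_int k) ^ 3 < 0" using that c by (simp add: power_less_zero_eq mult_pos_neg)
    then show ?thesis using \<tau> by (simp add: gm mult_pos_neg)
  qed
  show "\<bar>gm n - gm m\<bar> = \<bar>gm n\<bar> + \<bar>gm m\<bar>"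
    using opp pos[of m] pos[of n] neg[of m] neg[of n] by auto
qed

lemma far_gm:
  assumes "m \<in> grid N" "n \<in> grid N" "far m n"
  shows "\<bar>gm m\<bar> \<ge> \<tau> * c ^ 3 * real N ^ 3 / 64" "\<bar>gm n\<bar> \<ge> \<tau> * c ^ 3 * real N ^ 3 / 64"
    "\<bar>gm n\<bar> \<le> 8 * \<bar>gm m\<bar>" "\<bar>gm n\<bar> > 0" "gm n - gm m \<noteq> 0"
proof -
  note f = far_facts[OF assms]
  have t: "\<tau> * c ^ 3 > 0" using \<tau> c by simp
  have "(real N / 4) ^ 3 \<le> \<bar>real_of_int m\<bar> ^ 3" "(real N / 4) ^ 3 \<le> \<bar>real_of_int n\<bar> ^ 3"
    "\<bar>real_of_int n\<bar> ^ 3 \<le> (2 * \<bar>real_of_int m\<bar>) ^ 3"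
    by (intro power_mono; use f in linarith)+
  then have *: "\<tau> * c ^ 3 * (real N / 4) ^ 3 \<le> \<bar>gm m\<bar>" "\<tau> * c ^ 3 * (real N / 4) ^ 3 \<le> \<bar>gm n\<bar>"
    "\<bar>gm n\<bar> \<le> \<tau> * c ^ 3 * (2 * \<bar>real_of_int m\<bar>) ^ 3"
    unfolding gm_abs using t by (simp_all only: mult_left_mono less_imp_le)
  then show "\<bar>gm m\<bar> \<ge> \<tau> * c ^ 3 * real N ^ 3 / 64" "\<bar>gm n\<bar> \<ge> \<tau> * c ^ 3 * real N ^ 3 / 64"
    "\<bar>gm n\<bar> \<le> 8 * \<bar>gm m\<bar>" by (simp_all add: power_divide power_mult_distrib gm_abs mult_ac)
  moreover have "\<tau> * c ^ 3 * real N ^ 3 / 64 > 0" using t N by simp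
  ultimately show "\<bar>gm n\<bar> > 0" by linarith
  then show "gm n - gm m \<noteq> 0" using f(4) by linarith
qed

text \<open>
  Dispersion is of third order and advection of first order, which gains a factor \<open>N\<^sup>-\<^sup>2\<close>.
\<close>

lemma n_over_gm:
  assumes "m \<in> grid N" "n \<in> grid N" "far m n"
  shows "2 * \<tau> * \<bar>of_int n\<bar> / \<bar>gm n - gm m\<bar> \<le> 32 / (c ^ 3 * (real N)\<^sup>2)"
proof -
  note f = far_facts[OF assms] and g = far_gm[OF assms]
  have n: "\<bar>real_of_int n\<bar> > 0" using f(2) by linarith
  have "2 * \<tau> * \<bar>of_int n\<bar> / \<bar>gm n - gm m\<bar> \<le> 2 * \<tau> * \<bar>of_int n\<bar> / \<bar>gm n\<bar>"
    unfolding f(4) using g \<tau> by (intro divide_left_mono) auto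
  also have "\<dots> = 2 / (c ^ 3 * \<bar>of_int n\<bar>\<^sup>2)"
    unfolding gm_abs using n \<tau> c by (simp add: field_simps power2_eq_square power3_eq_cube)
  also have "\<dots> \<le> 2 / (c ^ 3 * (real N / 4)\<^sup>2)"
    using f(2) c N by (intro divide_left_mono mult_left_mono power_mono mult_pos_pos) auto
  finally show ?thesis by (simp add: power_divide)
qed

lemma rep_weight: "cmod (d (m - n)) \<le> (1 + \<bar>real_of_int (rep N (m - n))\<bar>) * cmod (d (m - n))"
  by (simp add: mult_le_cancel_right1)

lemma norm_adv: "n \<in> grid N \<Longrightarrow> cmod (adv d m n)
    \<le> real N / 2 * ((1 + \<bar>real_of_int (rep N (m - n))\<bar>) * cmod (d (m - n)))"
  using mult_mono[OF grid_bound[OF N(1), of n] rep_weight[of d m n]]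
  by (simp add: adv_def norm_mult)

lemma norm_advN: "n \<in> grid N \<Longrightarrow> cmod (advN d m n)
    \<le> real N / 2 * ((1 + \<bar>real_of_int (rep N (m - n))\<bar>) * cmod (d (m - n)))"
  using norm_adv[of n d m] by (simp add: advN_def)

lemma norm_advF: "n \<in> grid N \<Longrightarrow> cmod (advF d m n)
    \<le> real N / 2 * ((1 + \<bar>real_of_int (rep N (m - n))\<bar>) * cmod (d (m - n)))"
  using norm_adv[of n d m] by (simp add: advF_def)

lemma norm_advF_z2:
  assumes "m \<in> grid N" "n \<in> grid N"
  shows "cmod (advF d m n * cnj (z2 m))
    \<le> 32 / (c ^ 3 * \<tau> * (real N)\<^sup>2) * ((1 + \<bar>real_of_int (rep N (m - n))\<bar>) * cmod (d (m - n)))"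
proof (cases "far m n")
  case True
  note g = far_gm[OF assms True]
  have "\<tau> * c ^ 3 * real N ^ 3 / 64 * cmod (z2 m) \<le> \<bar>gm m\<bar> * cmod (z2 m)"
    using g(1) by (intro mult_right_mono) auto
  then have "\<tau> * c ^ 3 * real N ^ 3 / 64 * cmod (z2 m) \<le> 1" using norm_z2_gm[of m] by linarith
  then have z: "cmod (z2 m) \<le> 64 / (\<tau> * c ^ 3 * real N ^ 3)"
    using \<tau> c N by (simp add: field_simps)
  have "cmod (advF d m n * cnj (z2 m)) = cmod (advF d m n) * cmod (z2 m)" by (simp add: norm_mult)
  also have "\<dots> \<le> (real N / 2 * ((1 + \<bar>real_of_int (rep N (m - n))\<bar>) * cmod (d (m - n))))
      * (64 / (\<tau> * c ^ 3 * real N ^ 3))"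
    by (intro mult_mono norm_advF z assms) auto
  also have "\<dots> = 32 / (c ^ 3 * \<tau> * (real N)\<^sup>2) * ((1 + \<bar>real_of_int (rep N (m - n))\<bar>) * cmod (d (m - n)))"
    using N c \<tau> by (simp add: field_simps power2_eq_square power3_eq_cube)
  finally show ?thesis .
next
  case False
  then show ?thesis using c \<tau> by (simp add: advF_def)
qed

lemma norm_corr_aux:
  assumes "m \<in> grid N" "n \<in> grid N" and q: "far m n \<Longrightarrow> cmod ((1 + \<i> * of_real (gm n)) * q) \<le> Q" and "Q \<ge> 0"
  shows "cmod (corr d m n * q) \<le> Q * (32 / (c ^ 3 * (real N)\<^sup>2))
    * ((1 + \<bar>real_of_int (rep N (m - n))\<bar>) * cmod (d (m - n)))"
proof (cases "far m n")
  case True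
  have "cmod (corr d m n * q) = 2 * \<tau> * \<bar>of_int n\<bar> / \<bar>gm n - gm m\<bar>
      * cmod ((1 + \<i> * of_real (gm n)) * q) * cmod (d (m - n))"
    using True \<tau> by (simp add: corr_def norm_mult norm_divide flip: of_real_diff)
  also have "\<dots> \<le> 32 / (c ^ 3 * (real N)\<^sup>2) * Q
      * ((1 + \<bar>real_of_int (rep N (m - n))\<bar>) * cmod (d (m - n)))"
    using c \<tau> by (intro mult_mono n_over_gm assms True q rep_weight mult_nonneg_nonneg) auto
  finally show ?thesis by (simp add: mult_ac)
next
  case False
  then show ?thesis using c \<open>Q \<ge> 0\<close> by (simp add: corr_def)
qed

lemma norm_corr_z2n:
  assumes "m \<in> grid N" "n \<in> grid N"
  shows "cmod (corr d m n * z2 n) \<le> 32 / (c ^ 3 * (real N)\<^sup>2)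
    * ((1 + \<bar>real_of_int (rep N (m - n))\<bar>) * cmod (d (m - n)))"
  using norm_corr_aux[OF assms, of "z2 n" 1 d] one_gm_nz(1)[of "gm n"] by (simp add: z2_eq)

lemma norm_corr_z2m:
  assumes "m \<in> grid N" "n \<in> grid N"
  shows "cmod (corr d m n * z1 n * cnj (z2 m)) \<le> 8 * (32 / (c ^ 3 * (real N)\<^sup>2))
    * ((1 + \<bar>real_of_int (rep N (m - n))\<bar>) * cmod (d (m - n)))"
proof -
  have "cmod ((1 + \<i> * of_real (gm n)) * (z1 n * cnj (z2 m))) \<le> 8" if f: "far m n"
  proof -
    have "(gm n)\<^sup>2 \<le> (8 * gm m)\<^sup>2" using far_gm(3)[OF assms f] by (intro abs_le_square_iff[THEN iffD1]) (simp add: abs_mult)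
    then have "1 + (gm n)\<^sup>2 \<le> 8\<^sup>2 * (1 + (gm m)\<^sup>2)" by (simp add: power_mult_distrib)
    then have "sqrt (1 + (gm n)\<^sup>2) \<le> sqrt (8\<^sup>2 * (1 + (gm m)\<^sup>2))" by (rule real_sqrt_le_mono)
    also have "\<dots> = 8 * sqrt (1 + (gm m)\<^sup>2)" by (simp only: real_sqrt_mult real_sqrt_abs)
    finally have "sqrt (1 + (gm n)\<^sup>2) \<le> 8 * sqrt (1 + (gm m)\<^sup>2)" .
    moreover have "sqrt (1 + (gm m)\<^sup>2) > 0" by (simp add: add_pos_nonneg)
    ultimately show ?thesis
      unfolding norm_mult norm_z1 complex_mod_cnj norm_z2 norm_1_gm by (simp add: field_simps)
  qed
  then show ?thesis using norm_corr_aux[OF assms, of "z1 n * cnj (z2 m)" 8 d] by (simp add: mult.assoc)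
qed

lemma norm_corr:
  assumes "m \<in> grid N" "n \<in> grid N"
  shows "cmod (corr d m n) \<le> (32 / (c ^ 3 * (real N)\<^sup>2) + \<tau> * real N)
    * ((1 + \<bar>real_of_int (rep N (m - n))\<bar>) * cmod (d (m - n)))"
proof (cases "far m n")
  case True
  note f = far_facts[OF assms True] and g = far_gm[OF assms True]
  have q: "cmod (1 + \<i> * of_real (gm n)) \<le> 1 + \<bar>gm n\<bar>"
    by (rule order_trans[OF norm_triangle_ineq]) (simp add: norm_mult)
  have "2 * \<tau> * \<bar>of_int n\<bar> / \<bar>gm n - gm m\<bar> * \<bar>gm n\<bar> = 2 * \<tau> * \<bar>of_int n\<bar> * (\<bar>gm n\<bar> / \<bar>gm n - gm m\<bar>)"
    by simp
  also have "\<dots> \<le> 2 * \<tau> * \<bar>of_int n\<bar> * 1"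
    using g f \<tau> by (intro mult_left_mono) (auto simp: divide_le_eq)
  also have "\<dots> \<le> \<tau> * real N"
    using grid_bound[OF N(1) assms(2)] \<tau> by simp
  finally have 1: "2 * \<tau> * \<bar>of_int n\<bar> / \<bar>gm n - gm m\<bar> * \<bar>gm n\<bar> \<le> \<tau> * real N" .
  have "cmod (corr d m n) = 2 * \<tau> * \<bar>of_int n\<bar> / \<bar>gm n - gm m\<bar>
      * cmod (1 + \<i> * of_real (gm n)) * cmod (d (m - n))"
    using True \<tau> by (simp add: corr_def norm_mult norm_divide flip: of_real_diff)
  also have "\<dots> \<le> 2 * \<tau> * \<bar>of_int n\<bar> / \<bar>gm n - gm m\<bar> * (1 + \<bar>gm n\<bar>)
      * ((1 + \<bar>real_of_int (rep N (m - n))\<bar>) * cmod (d (m - n)))"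
    using \<tau> by (intro mult_mono q rep_weight) auto
  also have "\<dots> \<le> (32 / (c ^ 3 * (real N)\<^sup>2) + \<tau> * real N)
      * ((1 + \<bar>real_of_int (rep N (m - n))\<bar>) * cmod (d (m - n)))"
    using 1 n_over_gm[OF assms True] by (intro mult_right_mono) (auto simp: distrib_left)
  finally show ?thesis .
next
  case False
  then show ?thesis using c \<tau> by (simp add: corr_def)
qed

text \<open>
  The far entries couple wave numbers near \<open>N / 2\<close> with wave numbers near \<open>- N / 2\<close>, and these
  oscillate with different phases. The kernel \<open>corr\<close> integrates that oscillation in time: propagating
  both of its arguments by one double step changes it by the far part of the advection,
  damped by \<open>z2\<close>.
\<close>

lemma corr_normal_form:
  assumes "m \<in> grid N" "n \<in> grid N"
  shows "corr d m n * z1 n * cnj (z1 m) = corr d m n - of_real (4 * \<tau>) * (advF d m n * cnj (z2 m))"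
proof (cases "far m n")
  case True
  define u v where "u = 1 + \<i> * of_real (gm n)" and "v = 1 - \<i> * of_real (gm m)"
  have nz: "u \<noteq> 0" "v \<noteq> 0" unfolding u_def v_def by (rule one_gm_nz)+
  define D where "D = complex_of_real (gm n - gm m)"
  have D: "D \<noteq> 0" using far_gm(5)[OF assms True] unfolding D_def by (simp only: of_real_eq_0_iff not_False_eq_True)
  have z: "z1 n = 2 / u - 1" "cnj (z1 m) = 2 / v - 1" "cnj (z2 m) = 1 / v"
    by (simp_all add: z1_eq z2_eq u_def v_def)
  have uv: "u + v - 2 = \<i> * D" by (simp add: u_def v_def D_def algebra_simps)
  have "u * ((2 / u - 1) * (2 / v - 1)) - u = 2 * (2 - u - v) / v"
    using nz by (simp add: field_simps)
  also have "2 - u - v = - (\<i> * D)" using uv by (simp add: algebra_simps)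
  finally have key: "u * ((2 / u - 1) * (2 / v - 1)) - u = - 2 * \<i> * D / v" by simp
  have c: "corr d m n = of_real (2 * \<tau> * of_int n) * d (m - n) / D * u"
    using True by (simp add: corr_def u_def D_def)
  have gen: "w * x * A * B - w * x = w * (x * (A * B) - x)" for w x A B :: complex
    by (simp add: algebra_simps)
  have "corr d m n * z1 n * cnj (z1 m) - corr d m n
     = of_real (2 * \<tau> * of_int n) * d (m - n) / D * (u * ((2 / u - 1) * (2 / v - 1)) - u)"
    unfolding c z by (rule gen)
  also have "\<dots> = - (of_real (4 * \<tau>) * (advF d m n * cnj (z2 m)))"
    unfolding key z advF_def adv_def using True D nz by (simp add: field_simps)
  finally show ?thesis by (simp add: algebra_simps)
next
  case False
  then show ?thesis by (simp add: corr_def advF_def)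
qed

text \<open>
  \<open>y\<close> is the older and \<open>z\<close> the newer of two consecutive levels. The term with \<open>advN\<close> is the usual one for
  leapfrog: skew-adjointness turns the advection in the energy identity into an increment of it. The two
  terms with \<open>corr\<close> do the same for the far entries; both orders of the levels occur because a step pairs
  the middle level with the levels on its two sides.
\<close>

definition energy :: "(int \<Rightarrow> complex) \<Rightarrow> (int \<Rightarrow> complex) \<Rightarrow> (int \<Rightarrow> complex) \<Rightarrow> real" where
  "energy d y z = (nrm N z)\<^sup>2 + (nrm N y)\<^sup>2 - 2 * \<tau> * bil N (advN d) y z
     + bil N (corr d) z y + bil N (\<lambda>m n. corr d m n * z1 n) y z"

lemma cfl_parts:
  shows "\<tau> * real N * Cb \<le> 1" "(32 / (c ^ 3 * (real N)\<^sup>2) + \<tau> * real N) * Cb \<le> 1 / 2"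
    "32 / (c ^ 3 * (real N)\<^sup>2) * Cb \<le> 1 / 2"
    "\<tau> * real N * Cb + 2 * ((32 / (c ^ 3 * (real N)\<^sup>2) + \<tau> * real N) * Cb) \<le> 1"
proof -
  define X Y where "X = \<tau> * real N * Cb" and "Y = Cb / (c ^ 3 * (real N)\<^sup>2)"
  have nn: "0 \<le> X" "0 \<le> Y"
    using \<tau> Cb c by (simp_all add: X_def Y_def)
  have e: "64 * Cb / (c ^ 3 * (real N)\<^sup>2) = 64 * Y" "32 / (c ^ 3 * (real N)\<^sup>2) * Cb = 32 * Y"
    by (simp_all add: Y_def)
  have "3 * X + 64 * Y \<le> 1"
    using cfl unfolding c_def[symmetric] e X_def .
  then have *: "X \<le> 1" "32 * Y + X \<le> 1 / 2" "32 * Y \<le> 1 / 2" "X + 2 * (32 * Y + X) \<le> 1"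
    using nn by auto
  then show "\<tau> * real N * Cb \<le> 1" "(32 / (c ^ 3 * (real N)\<^sup>2) + \<tau> * real N) * Cb \<le> 1 / 2"
    "32 / (c ^ 3 * (real N)\<^sup>2) * Cb \<le> 1 / 2"
    "\<tau> * real N * Cb + 2 * ((32 / (c ^ 3 * (real N)\<^sup>2) + \<tau> * real N) * Cb) \<le> 1"
    unfolding distrib_right[of "32 / (c ^ 3 * (real N)\<^sup>2)"] e using * unfolding X_def by auto
qed

text \<open>
  Under the restriction on the step, all corrections together amount to at most \<open>\<parallel>y\<parallel> \<parallel>z\<parallel>\<close>.
\<close>

lemma energy_equiv:
  assumes per: "\<And>l. d (l + int N) = d l" and w: "wsum N d \<le> Cb"
  shows "((nrm N z)\<^sup>2 + (nrm N y)\<^sup>2) / 2 \<le> energy d y z"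
    "energy d y z \<le> 3 / 2 * ((nrm N z)\<^sup>2 + (nrm N y)\<^sup>2)"
proof -
  define q where "q = (32 / (c ^ 3 * (real N)\<^sup>2) + \<tau> * real N) * Cb"
  define s where "s = nrm N y * nrm N z"
  have b1: "\<bar>bil N (advN d) y z\<bar> \<le> real N / 2 * Cb * s"
    unfolding s_def by (rule bil_le[where d = d, OF N per _ norm_advN[where d = d] w]) auto
  have q0: "0 \<le> 32 / (c ^ 3 * (real N)\<^sup>2) + \<tau> * real N" using c \<tau> by simp
  have b2: "\<bar>bil N (corr d) z y\<bar> \<le> q * s"
    unfolding q_def s_def mult.commute[of "nrm N y"]
    by (rule bil_le[where d = d, OF N per q0 norm_corr[where d = d] w])
  have b3: "\<bar>bil N (\<lambda>m n. corr d m n * z1 n) y z\<bar> \<le> q * s"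
    unfolding q_def s_def
    by (rule bil_le[where d = d, OF N per q0 _ w]) (simp add: norm_mult norm_z1 norm_corr)
  have "\<bar>2 * \<tau> * bil N (advN d) y z\<bar> = 2 * \<tau> * \<bar>bil N (advN d) y z\<bar>" using \<tau> by (simp add: abs_mult)
  also have "\<dots> \<le> 2 * \<tau> * (real N / 2 * Cb * s)" using b1 \<tau> by (intro mult_left_mono) auto
  also have "\<dots> = \<tau> * real N * Cb * s" by simp
  finally have b1': "\<bar>2 * \<tau> * bil N (advN d) y z\<bar> \<le> \<tau> * real N * Cb * s" .
  have s: "0 \<le> s" "2 * s \<le> (nrm N z)\<^sup>2 + (nrm N y)\<^sup>2"
    using sum_squares_bound[of "nrm N y" "nrm N z"] by (simp_all add: s_def add.commute mult_ac)
  have "(\<tau> * real N * Cb + 2 * q) * s \<le> 1 * s"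
    by (rule mult_right_mono) (use cfl_parts(4) s in \<open>auto simp: q_def\<close>)
  then have "\<tau> * real N * Cb * s + 2 * (q * s) \<le> s" by (simp add: algebra_simps)
  then have "\<bar>energy d y z - ((nrm N z)\<^sup>2 + (nrm N y)\<^sup>2)\<bar> \<le> s"
    unfolding energy_def using b1' b2 b3 by linarith
  then show "((nrm N z)\<^sup>2 + (nrm N y)\<^sup>2) / 2 \<le> energy d y z"
    "energy d y z \<le> 3 / 2 * ((nrm N z)\<^sup>2 + (nrm N y)\<^sup>2)"
    using s unfolding abs_le_iff by (simp_all add: field_simps)
qed

text \<open>
  Testing the scheme with \<open>z + x\<close>, the sum of the new and the old level, removes the stiff
  dispersive term exactly.
\<close>

lemma step_identity:
  assumes z: "\<And>m. m \<in> grid N \<Longrightarrow> z m = z1 m * x m + of_real (2 * \<tau>) * (z2 m * F m) + of_real (2 * \<tau>) * g m"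
  shows "(nrm N z)\<^sup>2 - (nrm N x)\<^sup>2 = 2 * \<tau> * Re (ip N F (\<lambda>m. z m + x m))
     - 4 * \<tau>\<^sup>2 * Re (ip N F g) + 4 * \<tau> * Re (ip N g z) - 4 * \<tau>\<^sup>2 * (nrm N g)\<^sup>2"
proof -
  have "(cmod (z m))\<^sup>2 - (cmod (x m))\<^sup>2 = 2 * \<tau> * Re (F m * cnj (z m + x m))
     - 4 * \<tau>\<^sup>2 * Re (F m * cnj (g m)) + 4 * \<tau> * Re (g m * cnj (z m)) - 4 * \<tau>\<^sup>2 * (cmod (g m))\<^sup>2"
    if m: "m \<in> grid N" for m
  proof -
    define w where "w = z m - of_real (2 * \<tau>) * g m"
    define u where "u = 1 + \<i> * of_real (gm m)"
    have nz: "u \<noteq> 0" unfolding u_def by (rule one_gm_nz)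
    have "u * w = u * (z1 m * x m + of_real (2 * \<tau>) * (z2 m * F m))"
      unfolding w_def z[OF m] by simp
    also have "\<dots> = (2 - u) * x m + of_real (2 * \<tau>) * F m"
      unfolding z1_eq z2_eq u_def[symmetric] using nz by (simp add: field_simps)
    finally have "(w - x m) + \<i> * of_real (gm m) * (w + x m) = of_real (2 * \<tau>) * F m"
      by (simp add: u_def algebra_simps)
    then have e: "Re (((w - x m) + \<i> * of_real (gm m) * (w + x m)) * cnj (w + x m))
        = Re (of_real (2 * \<tau>) * F m * cnj (w + x m))" by simp
    have l: "Re (((w - x m) + \<i> * of_real (gm m) * (w + x m)) * cnj (w + x m)) = (cmod w)\<^sup>2 - (cmod (x m))\<^sup>2"
      unfolding cmod_power2 by (simp add: algebra_simps power2_eq_square)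
    have "(cmod w)\<^sup>2 - (cmod (x m))\<^sup>2 = 2 * \<tau> * Re (F m * cnj (w + x m))"
      using e unfolding l by (simp add: algebra_simps)
    then show ?thesis unfolding w_def cmod_power2
      by (simp add: algebra_simps power2_eq_square)
  qed
  then have "(\<Sum>m\<in>grid N. (cmod (z m))\<^sup>2 - (cmod (x m))\<^sup>2) = (\<Sum>m\<in>grid N. 2 * \<tau> * Re (F m * cnj (z m + x m))
     - 4 * \<tau>\<^sup>2 * Re (F m * cnj (g m)) + 4 * \<tau> * Re (g m * cnj (z m)) - 4 * \<tau>\<^sup>2 * (cmod (g m))\<^sup>2)"
    by (intro sum.cong refl) auto
  then show ?thesis
    by (simp only: ip_def nrm_sq sum_subtractf sum.distrib Re_sum sum_distrib_left)
qed

definition Ke where "Ke = 10 + 6 * Cb + 352 * Cb\<^sup>2 / c ^ 3"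

text \<open>
  The terms of order \<open>N\<close> cancel. What remains is the symmetric part of the near advection, bounded since
  \<open>d\<close> is Hermitian, the change of the coefficients during one step, which has a factor \<open>\<tau>\<close> that
  compensates for \<open>N\<close>, the forcing \<open>g\<close>, and products of a far operator with the advection, where the far operator gains
  \<open>N\<^sup>-\<^sup>2\<close> against a loss of \<open>N\<close>.
\<close>

lemma energy_step:
  assumes per: "\<And>l. d (l + int N) = d l" "\<And>l. d' (l + int N) = d' l"
    and herm: "\<And>l. d (- l) = cnj (d l)"
    and w: "wsum N d \<le> Cb" and w': "wsum N (\<lambda>l. d l - d' l) \<le> Cb * \<tau>"
    and z: "\<And>m. m \<in> grid N \<Longrightarrow> z m = z1 m * x m + of_real (2 * \<tau>) * (z2 m * app N (adv d) y m)
      + of_real (2 * \<tau>) * g m"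
  shows "energy d y z - energy d' x y
    \<le> \<tau> * Ke * ((nrm N x)\<^sup>2 + (nrm N y)\<^sup>2 + (nrm N z)\<^sup>2 + (nrm N g)\<^sup>2)"
proof -
  define F where "F = app N (adv d) y"
  define K3 where "K3 m n = advF d m n * cnj (z2 m)" for m n
  define nx ny nz ng where "nx = nrm N x" "ny = nrm N y" "nz = nrm N z" "ng = nrm N g"
  define \<delta> where "\<delta> l = d l - d' l" for l
  have perd: "\<delta> (l + int N) = \<delta> l" for l by (simp add: \<delta>_def per)
  have w\<delta>: "wsum N \<delta> \<le> Cb * \<tau>" using w' by (simp add: \<delta>_def[abs_def])
  define q where "q = 32 / (c ^ 3 * (real N)\<^sup>2)"
  have q0: "0 \<le> q" "0 \<le> q + \<tau> * real N" using c \<tau> by (simp_all add: q_def)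
  have N1: "real N \<ge> 1" using N by simp
  have qc: "q * Cb \<le> 1 / 2" "(q + \<tau> * real N) * Cb \<le> 1 / 2" "\<tau> * real N * Cb \<le> 1"
    using cfl_parts by (simp_all add: q_def)
  have nn: "0 \<le> nx" "0 \<le> ny" "0 \<le> nz" "0 \<le> ng" by (simp_all add: nx_ny_nz_ng_def)
  note z' = z[folded F_def]
  have F: "nrm N F \<le> real N / 2 * Cb * ny"
  proof -
    have "nrm N F \<le> real N / 2 * wsum N d * nrm N y"
      unfolding F_def by (rule schur_wsum[where d = d, OF N per(1)]) (use norm_adv in auto)
    also have "\<dots> \<le> real N / 2 * Cb * nrm N y"
      by (intro mult_right_mono mult_left_mono w) auto
    finally show ?thesis by (simp add: nx_ny_nz_ng_def)
  qed
  have \<tau>F: "\<tau> * nrm N F \<le> ny / 2"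
  proof -
    have "\<tau> * nrm N F \<le> \<tau> * (real N / 2 * Cb * ny)" using F \<tau> by (intro mult_left_mono) auto
    also have "\<dots> = (\<tau> * real N * Cb) * (ny / 2)" by simp
    also have "\<dots> \<le> 1 * (ny / 2)" using qc nn by (intro mult_right_mono) auto
    finally show ?thesis by simp
  qed
  \<comment> \<open>\<open>E1\<close> to \<open>E3\<close> expand the energy identity, \<open>E4\<close> to \<open>E6\<close> the change of the normal form terms. Both contain
    \<open>bil N K3 y x\<close>, the far advection at full strength, and it cancels.\<close>
  have E1: "nz\<^sup>2 - nx\<^sup>2 = 2 * \<tau> * Re (ip N F (\<lambda>m. z m + x m))
     - 4 * \<tau>\<^sup>2 * Re (ip N F g) + 4 * \<tau> * Re (ip N g z) - 4 * \<tau>\<^sup>2 * ng\<^sup>2"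
    unfolding nx_ny_nz_ng_def by (rule step_identity[OF z'])
  have E2: "Re (ip N F (\<lambda>m. z m + x m)) = bil N (advN d) y z + bil N (advN d) y x
      + bil N (advF d) y (\<lambda>m. z m + x m)"
  proof -
    have add: "bil N K y (\<lambda>m. z m + x m) = bil N K y z + bil N K y x" for K
      by (simp add: bil_def ip_def distrib_left sum.distrib)
    have "Re (ip N F (\<lambda>m. z m + x m)) = bil N (adv d) y (\<lambda>m. z m + x m)"
      by (simp add: F_def bil_def)
    also have "\<dots> = bil N (\<lambda>m n. advN d m n + advF d m n) y (\<lambda>m. z m + x m)"
      by (rule bil_cong) (simp add: advN_def advF_def)
    finally show ?thesis by (simp add: bil_add_kernel add)
  qed
  have E3: "bil N (advF d) y (\<lambda>m. z m + x m) = 2 * bil N K3 y x + 2 * \<tau> * bil N K3 y F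
      + 2 * \<tau> * bil N (advF d) y g"
  proof -
    have "bil N (advF d) y (\<lambda>m. z m + x m) = bil N (\<lambda>m n. advF d m n * cnj (2 * z2 m)) y x
        + 2 * \<tau> * bil N (\<lambda>m n. advF d m n * cnj (z2 m)) y F + 2 * \<tau> * bil N (advF d) y g"
      by (rule bil_right) (simp add: z' z1_eq algebra_simps)
    also have "bil N (\<lambda>m n. advF d m n * cnj (2 * z2 m)) y x = bil N (\<lambda>m n. of_real 2 * K3 m n) y x"
      by (rule bil_cong) (simp add: K3_def)
    finally show ?thesis by (simp only: bil_cmult_kernel K3_def[abs_def])
  qed
  have E4: "bil N (corr d) z y = bil N (\<lambda>m n. corr d m n * z1 n) x y
      + 2 * \<tau> * bil N (\<lambda>m n. corr d m n * z2 n) F y + 2 * \<tau> * bil N (corr d) g y"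
    by (rule bil_left) (use z' in auto)
  have E5: "bil N (\<lambda>m n. corr d m n * z1 n) y z = bil N (\<lambda>m n. corr d m n * z1 n * cnj (z1 m)) y x
      + 2 * \<tau> * bil N (\<lambda>m n. corr d m n * z1 n * cnj (z2 m)) y F
      + 2 * \<tau> * bil N (\<lambda>m n. corr d m n * z1 n) y g"
    by (rule bil_right) (use z' in auto)
  have E6: "bil N (\<lambda>m n. corr d m n * z1 n * cnj (z1 m)) y x = bil N (corr d) y x - 4 * \<tau> * bil N K3 y x"
  proof -
    have "bil N (\<lambda>m n. corr d m n * z1 n * cnj (z1 m)) y x
        = bil N (\<lambda>m n. corr d m n - of_real (4 * \<tau>) * K3 m n) y x"
      by (rule bil_cong) (simp only: corr_normal_form K3_def)
    then show ?thesis by (simp only: bil_diff_kernel bil_cmult_kernel)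
  qed
  define A where "A = (\<lambda>m n. advN d m n + cnj (advN d n m))"
  have E7: "bil N (advN d) y x + bil N (advN d') x y = bil N A y x - bil N (advN \<delta>) x y"
  proof -
    have "bil N (advN \<delta>) x y = bil N (\<lambda>m n. advN d m n - advN d' m n) x y"
      by (rule bil_cong) (simp add: advN_def adv_def \<delta>_def algebra_simps)
    moreover have "bil N (advN d) x y = bil N (\<lambda>m n. cnj (advN d n m)) y x" by (rule bil_adjoint)
    ultimately show ?thesis by (simp add: A_def bil_diff_kernel bil_add_kernel)
  qed
  have E8: "bil N (\<lambda>m n. corr d m n * z1 n) x y - bil N (\<lambda>m n. corr d' m n * z1 n) x y
      = bil N (\<lambda>m n. corr \<delta> m n * z1 n) x y"
    "bil N (corr d) y x - bil N (corr d') y x = bil N (corr \<delta>) y x"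
  proof -
    have "corr d m n - corr d' m n = corr \<delta> m n" for m n
      by (simp only: corr_def \<delta>_def right_diff_distrib split: if_split) simp
    then show "bil N (\<lambda>m n. corr d m n * z1 n) x y - bil N (\<lambda>m n. corr d' m n * z1 n) x y
      = bil N (\<lambda>m n. corr \<delta> m n * z1 n) x y"
    "bil N (corr d) y x - bil N (corr d') y x = bil N (corr \<delta>) y x"
      by (simp_all flip: bil_diff_kernel left_diff_distrib)
  qed
  have B1: "\<bar>Re (ip N F g)\<bar> \<le> nrm N F * ng" "\<bar>Re (ip N g z)\<bar> \<le> ng * nz"
    unfolding nx_ny_nz_ng_def by (rule Re_ip_le)+
  have B2: "\<bar>bil N A y x\<bar> \<le> 3 * Cb * (ny * nx)"
    unfolding nx_ny_nz_ng_def
  proof (rule bil_le[where d = d, OF N per(1) _ _ w])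
    fix m n assume mn: "m \<in> grid N" "n \<in> grid N"
    show "cmod (A m n) \<le> 3 * ((1 + \<bar>real_of_int (rep N (m - n))\<bar>) * cmod (d (m - n)))"
    proof (cases "far m n")
      case True
      then have "A m n = 0" by (simp add: A_def advN_def far_def abs_minus_commute)
      then show ?thesis by simp
    next
      case False
      have "d (n - m) = cnj (d (m - n))" using herm[of "m - n"] by simp
      then have "A m n = \<i> * of_int (n - m) * d (m - n)"
        using False by (simp add: A_def advN_def adv_def far_def abs_minus_commute algebra_simps)
      then have "cmod (A m n) = \<bar>real_of_int (n - m)\<bar> * cmod (d (m - n))"
        by (simp only: norm_mult norm_of_int) simp
      moreover have "real_of_int \<bar>n - m\<bar> \<le> real_of_int (3 * \<bar>rep N (m - n)\<bar>)"
        unfolding of_int_le_iff using near_le_rep[OF N mn] False by (simp add: far_def abs_minus_commute)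
      ultimately show ?thesis by (simp add: mult_right_mono flip: mult.assoc)
    qed
  qed simp
  have B3: "\<bar>bil N (advN \<delta>) x y\<bar> \<le> real N / 2 * (Cb * \<tau>) * (nx * ny)"
    unfolding nx_ny_nz_ng_def by (rule bil_le[where d = \<delta>, OF N perd _ norm_advN[where d = \<delta>] w\<delta>]) auto
  have B4: "\<bar>bil N K3 y F\<bar> \<le> 32 / (c ^ 3 * \<tau> * (real N)\<^sup>2) * Cb * (ny * nrm N F)"
    unfolding nx_ny_nz_ng_def
    by (rule bil_le[where d = d, OF N per(1) _ _ w]) (use norm_advF_z2 c \<tau> in \<open>auto simp: K3_def\<close>)
  have B5: "\<bar>bil N (advF d) y g\<bar> \<le> real N / 2 * Cb * (ny * ng)"
    unfolding nx_ny_nz_ng_def by (rule bil_le[where d = d, OF N per(1) _ norm_advF[where d = d] w]) auto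
  have B6: "\<bar>bil N (\<lambda>m n. corr d m n * z2 n) F y\<bar> \<le> q * Cb * (nrm N F * ny)"
    unfolding nx_ny_nz_ng_def q_def
    by (rule bil_le[where d = d, OF N per(1) _ norm_corr_z2n[where d = d] w]) (use c in auto)
  have B7: "\<bar>bil N (\<lambda>m n. corr d m n * z1 n * cnj (z2 m)) y F\<bar> \<le> 8 * q * Cb * (ny * nrm N F)"
    unfolding nx_ny_nz_ng_def q_def
    by (rule bil_le[where d = d, OF N per(1) _ norm_corr_z2m[where d = d] w]) (use c in auto)
  have B8: "\<bar>bil N (corr d) g y\<bar> \<le> (q + \<tau> * real N) * Cb * (ng * ny)"
    unfolding nx_ny_nz_ng_def q_def
    by (rule bil_le[where d = d, OF N per(1) _ norm_corr[where d = d] w]) (use q0 q_def in auto)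
  have nc1: "cmod (corr f m n * z1 n) = cmod (corr f m n)" for f m n
    by (simp add: norm_mult norm_z1)
  have B9: "\<bar>bil N (\<lambda>m n. corr d m n * z1 n) y g\<bar> \<le> (q + \<tau> * real N) * Cb * (ny * ng)"
    unfolding nx_ny_nz_ng_def q_def
    by (rule bil_le[where d = d, OF N per(1) _ _ w]) (use q0 q_def norm_corr nc1 in auto)
  have B10: "\<bar>bil N (\<lambda>m n. corr \<delta> m n * z1 n) x y\<bar> \<le> (q + \<tau> * real N) * (Cb * \<tau>) * (nx * ny)"
    unfolding nx_ny_nz_ng_def q_def
    by (rule bil_le[where d = \<delta>, OF N perd _ _ w\<delta>]) (use q0 q_def norm_corr nc1 in auto)
  have B11: "\<bar>bil N (corr \<delta>) y x\<bar> \<le> (q + \<tau> * real N) * (Cb * \<tau>) * (ny * nx)"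
    unfolding nx_ny_nz_ng_def q_def
    by (rule bil_le[where d = \<delta>, OF N perd _ norm_corr[where d = \<delta>] w\<delta>]) (use q0 q_def in auto)
  \<comment> \<open>all bounds are \<open>\<tau>\<close> times a quadratic form with constants independent of \<open>N\<close> and \<open>\<tau>\<close>\<close>
  have C1: "\<bar>4 * \<tau>\<^sup>2 * Re (ip N F g)\<bar> \<le> \<tau> * (2 * (ny * ng))"
  proof -
    have "\<bar>4 * \<tau>\<^sup>2 * Re (ip N F g)\<bar> \<le> 4 * \<tau>\<^sup>2 * (nrm N F * ng)"
      using mult_left_mono[OF B1(1), of "4 * \<tau>\<^sup>2"] by (simp add: abs_mult)
    also have "\<dots> = 4 * \<tau> * (\<tau> * nrm N F) * ng" by (simp add: power2_eq_square)
    also have "\<dots> \<le> 4 * \<tau> * (ny / 2) * ng"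
      using \<tau>F \<tau> nn by (intro mult_right_mono mult_left_mono) auto
    finally show ?thesis by simp
  qed
  have C2: "\<bar>4 * \<tau> * Re (ip N g z)\<bar> \<le> \<tau> * (4 * (ng * nz))"
    using mult_left_mono[OF B1(2), of "4 * \<tau>"] \<tau> by (simp add: abs_mult mult_ac)
  have C3: "\<bar>2 * \<tau> * bil N A y x\<bar> \<le> \<tau> * (6 * Cb * (nx * ny))"
    using mult_left_mono[OF B2, of "2 * \<tau>"] \<tau> by (simp add: abs_mult mult_ac)
  have C4: "\<bar>2 * \<tau> * bil N (advN \<delta>) x y\<bar> \<le> \<tau> * (nx * ny)"
  proof -
    have "\<bar>2 * \<tau> * bil N (advN \<delta>) x y\<bar> \<le> 2 * \<tau> * (real N / 2 * (Cb * \<tau>) * (nx * ny))"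
      using mult_left_mono[OF B3, of "2 * \<tau>"] \<tau> by (simp add: abs_mult)
    also have "\<dots> = (\<tau> * real N * Cb) * (\<tau> * (nx * ny))" by simp
    also have "\<dots> \<le> 1 * (\<tau> * (nx * ny))" using qc \<tau> nn by (intro mult_right_mono) auto
    finally show ?thesis by simp
  qed
  have yF: "ny * nrm N F \<le> real N / 2 * Cb * ny\<^sup>2"
    using mult_left_mono[OF F nn(2)] by (simp add: power2_eq_square mult_ac)
  define k where "k = Cb\<^sup>2 / c ^ 3"
  have qF: "q * Cb * (ny * nrm N F) \<le> 16 * k * ny\<^sup>2"
  proof -
    have "q * Cb * (ny * nrm N F) \<le> q * Cb * (real N / 2 * Cb * ny\<^sup>2)"
      using yF q0 Cb by (intro mult_left_mono) auto
    also have "\<dots> = 16 * k * ny\<^sup>2 / real N"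
      using c N by (simp add: q_def k_def field_simps power2_eq_square)
    also have "\<dots> \<le> 16 * k * ny\<^sup>2"
    proof -
      have "X / real N \<le> X" if "0 \<le> X" for X
        using mult_left_mono[OF N1 that] N by (simp add: divide_le_eq)
      moreover have "0 \<le> 16 * k * ny\<^sup>2" using c by (simp add: k_def)
      ultimately show ?thesis .
    qed
    finally show ?thesis .
  qed
  have C5: "\<bar>4 * \<tau>\<^sup>2 * bil N K3 y F\<bar> \<le> \<tau> * (64 * k * ny\<^sup>2)"
  proof -
    have "\<bar>4 * \<tau>\<^sup>2 * bil N K3 y F\<bar> \<le> 4 * \<tau>\<^sup>2 * (32 / (c ^ 3 * \<tau> * (real N)\<^sup>2) * Cb * (ny * nrm N F))"
      using mult_left_mono[OF B4, of "4 * \<tau>\<^sup>2"] by (simp add: abs_mult)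
    also have "\<dots> = 4 * \<tau> * (q * Cb * (ny * nrm N F))"
      using \<tau> by (simp add: q_def power2_eq_square)
    also have "\<dots> \<le> 4 * \<tau> * (16 * k * ny\<^sup>2)" using qF \<tau> by (intro mult_left_mono) auto
    finally show ?thesis by simp
  qed
  have C6: "\<bar>4 * \<tau>\<^sup>2 * bil N (advF d) y g\<bar> \<le> \<tau> * (2 * (ny * ng))"
  proof -
    have "\<bar>4 * \<tau>\<^sup>2 * bil N (advF d) y g\<bar> \<le> 4 * \<tau>\<^sup>2 * (real N / 2 * Cb * (ny * ng))"
      using mult_left_mono[OF B5, of "4 * \<tau>\<^sup>2"] by (simp add: abs_mult)
    also have "\<dots> = (\<tau> * real N * Cb) * (2 * \<tau> * (ny * ng))" by (simp add: power2_eq_square)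
    also have "\<dots> \<le> 1 * (2 * \<tau> * (ny * ng))" using qc \<tau> nn by (intro mult_right_mono) auto
    finally show ?thesis by simp
  qed
  have C7: "\<bar>2 * \<tau> * bil N (\<lambda>m n. corr d m n * z2 n) F y\<bar> \<le> \<tau> * (32 * k * ny\<^sup>2)"
  proof -
    have "\<bar>2 * \<tau> * bil N (\<lambda>m n. corr d m n * z2 n) F y\<bar> \<le> 2 * \<tau> * (q * Cb * (nrm N F * ny))"
      using mult_left_mono[OF B6, of "2 * \<tau>"] \<tau> by (simp add: abs_mult)
    also have "\<dots> \<le> 2 * \<tau> * (16 * k * ny\<^sup>2)" using qF \<tau> by (intro mult_left_mono) (auto simp: mult_ac)
    finally show ?thesis by simp
  qed
  have C8: "\<bar>2 * \<tau> * bil N (\<lambda>m n. corr d m n * z1 n * cnj (z2 m)) y F\<bar> \<le> \<tau> * (256 * k * ny\<^sup>2)"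
  proof -
    have "\<bar>2 * \<tau> * bil N (\<lambda>m n. corr d m n * z1 n * cnj (z2 m)) y F\<bar>
        \<le> 2 * \<tau> * (8 * q * Cb * (ny * nrm N F))"
      using mult_left_mono[OF B7, of "2 * \<tau>"] \<tau> by (simp add: abs_mult)
    also have "\<dots> = 16 * \<tau> * (q * Cb * (ny * nrm N F))" by simp
    also have "\<dots> \<le> 16 * \<tau> * (16 * k * ny\<^sup>2)" using qF \<tau> by (intro mult_left_mono) auto
    finally show ?thesis by simp
  qed
  have half: "2 * \<tau> * ((q + \<tau> * real N) * Cb * s) \<le> \<tau> * s" if "0 \<le> s" for s
  proof -
    have "2 * \<tau> * ((q + \<tau> * real N) * Cb * s) = ((q + \<tau> * real N) * Cb) * (2 * \<tau> * s)" by simp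
    also have "\<dots> \<le> 1 / 2 * (2 * \<tau> * s)" using qc(2) \<tau> that by (intro mult_right_mono) auto
    finally show ?thesis by simp
  qed
  have C9: "\<bar>2 * \<tau> * bil N (corr d) g y\<bar> \<le> \<tau> * (ny * ng)"
    "\<bar>2 * \<tau> * bil N (\<lambda>m n. corr d m n * z1 n) y g\<bar> \<le> \<tau> * (ny * ng)"
    using mult_left_mono[OF B8, of "2 * \<tau>"] mult_left_mono[OF B9, of "2 * \<tau>"] half[of "ny * ng"] \<tau> nn
    by (simp_all add: abs_mult mult_ac)
  have C10: "\<bar>bil N (\<lambda>m n. corr \<delta> m n * z1 n) x y\<bar> \<le> \<tau> * (nx * ny)"
    "\<bar>bil N (corr \<delta>) y x\<bar> \<le> \<tau> * (nx * ny)"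
  proof -
    have "(q + \<tau> * real N) * (Cb * \<tau>) * (nx * ny) = ((q + \<tau> * real N) * Cb) * (\<tau> * (nx * ny))" by simp
    also have "\<dots> \<le> 1 * (\<tau> * (nx * ny))" using qc(2) \<tau> nn by (intro mult_right_mono) auto
    finally show "\<bar>bil N (\<lambda>m n. corr \<delta> m n * z1 n) x y\<bar> \<le> \<tau> * (nx * ny)"
      "\<bar>bil N (corr \<delta>) y x\<bar> \<le> \<tau> * (nx * ny)"
      using B10 B11 by (simp_all add: mult_ac)
  qed
  have diff: "energy d y z - energy d' x y
    = - 4 * \<tau>\<^sup>2 * Re (ip N F g) + 4 * \<tau> * Re (ip N g z) - 4 * \<tau>\<^sup>2 * ng\<^sup>2
      + 2 * \<tau> * bil N A y x - 2 * \<tau> * bil N (advN \<delta>) x y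
      + 4 * \<tau>\<^sup>2 * bil N K3 y F + 4 * \<tau>\<^sup>2 * bil N (advF d) y g
      + 2 * \<tau> * bil N (\<lambda>m n. corr d m n * z2 n) F y + 2 * \<tau> * bil N (corr d) g y
      + 2 * \<tau> * bil N (\<lambda>m n. corr d m n * z1 n * cnj (z2 m)) y F
      + 2 * \<tau> * bil N (\<lambda>m n. corr d m n * z1 n) y g
      + bil N (\<lambda>m n. corr \<delta> m n * z1 n) x y + bil N (corr \<delta>) y x"
  proof -
    have e7: "2 * \<tau> * bil N (advN d) y x + 2 * \<tau> * bil N (advN d') x y
        = 2 * \<tau> * bil N A y x - 2 * \<tau> * bil N (advN \<delta>) x y"
      using E7 by (simp flip: distrib_left right_diff_distrib)
    have e1: "nz\<^sup>2 - nx\<^sup>2 = 2 * \<tau> * bil N (advN d) y z + 2 * \<tau> * bil N (advN d) y x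
        + (4 * \<tau> * bil N K3 y x + 4 * \<tau>\<^sup>2 * bil N K3 y F + 4 * \<tau>\<^sup>2 * bil N (advF d) y g)
        - 4 * \<tau>\<^sup>2 * Re (ip N F g) + 4 * \<tau> * Re (ip N g z) - 4 * \<tau>\<^sup>2 * ng\<^sup>2"
      unfolding E1 E2 E3 by (simp add: algebra_simps power2_eq_square)
    show ?thesis
      unfolding energy_def E4 E5 E6 nx_ny_nz_ng_def(1-3)[symmetric]
      using e1 e7 E8 by linarith
  qed
  have nsq: "0 \<le> 4 * \<tau>\<^sup>2 * ng\<^sup>2" by simp
  have "energy d y z - energy d' x y \<le> \<tau> * (2 * (ny * ng)) + \<tau> * (4 * (ng * nz)) + \<tau> * (6 * Cb * (nx * ny))
      + \<tau> * (nx * ny) + \<tau> * (64 * k * ny\<^sup>2) + \<tau> * (2 * (ny * ng)) + \<tau> * (32 * k * ny\<^sup>2)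
      + \<tau> * (256 * k * ny\<^sup>2) + \<tau> * (ny * ng) + \<tau> * (ny * ng) + \<tau> * (nx * ny) + \<tau> * (nx * ny)"
    unfolding diff using abs_le_D2[OF C1] abs_le_D1[OF C2] abs_le_D1[OF C3] abs_le_D2[OF C4]
      abs_le_D1[OF C5] abs_le_D1[OF C6] abs_le_D1[OF C7] abs_le_D1[OF C8] abs_le_D1[OF C9(1)]
      abs_le_D1[OF C9(2)] abs_le_D1[OF C10(1)] abs_le_D1[OF C10(2)] nsq by linarith
  also have "\<dots> = \<tau> * (6 * (ny * ng) + 4 * (ng * nz) + 6 * Cb * (nx * ny) + 3 * (nx * ny) + 352 * k * ny\<^sup>2)"
    by (simp add: algebra_simps)
  also have "\<dots> \<le> \<tau> * (Ke * (nx\<^sup>2 + ny\<^sup>2 + nz\<^sup>2 + ng\<^sup>2))"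
  proof (rule mult_left_mono)
    have k0: "0 \<le> k" using c by (simp add: k_def)
    have am: "2 * (a * b) \<le> a\<^sup>2 + b\<^sup>2" for a b :: real using sum_squares_bound[of a b] by simp
    have s1: "Cb * (2 * (nx * ny)) \<le> Cb * (nx\<^sup>2 + ny\<^sup>2)" by (intro mult_left_mono am Cb)
    have s2: "0 \<le> Cb * nx\<^sup>2" "0 \<le> Cb * ny\<^sup>2" "0 \<le> Cb * nz\<^sup>2" "0 \<le> Cb * ng\<^sup>2"
      "0 \<le> k * nx\<^sup>2" "0 \<le> k * ny\<^sup>2" "0 \<le> k * nz\<^sup>2" "0 \<le> k * ng\<^sup>2"
      "0 \<le> nx\<^sup>2" "0 \<le> ny\<^sup>2" "0 \<le> nz\<^sup>2" "0 \<le> ng\<^sup>2"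
      using Cb k0 by simp_all
    have Ke: "Ke = 10 + 6 * Cb + 352 * k" by (simp add: Ke_def k_def)
    have ex: "Ke * (nx\<^sup>2 + ny\<^sup>2 + nz\<^sup>2 + ng\<^sup>2) = 10 * nx\<^sup>2 + 10 * ny\<^sup>2 + 10 * nz\<^sup>2 + 10 * ng\<^sup>2
      + 6 * (Cb * nx\<^sup>2) + 6 * (Cb * ny\<^sup>2) + 6 * (Cb * nz\<^sup>2) + 6 * (Cb * ng\<^sup>2)
      + 352 * (k * nx\<^sup>2) + 352 * (k * ny\<^sup>2) + 352 * (k * nz\<^sup>2) + 352 * (k * ng\<^sup>2)"
      unfolding Ke by (simp add: algebra_simps)
    have s1': "6 * Cb * (nx * ny) \<le> 3 * (Cb * nx\<^sup>2) + 3 * (Cb * ny\<^sup>2)"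
      using s1 by (simp add: algebra_simps)
    show "6 * (ny * ng) + 4 * (ng * nz) + 6 * Cb * (nx * ny) + 3 * (nx * ny) + 352 * k * ny\<^sup>2
      \<le> Ke * (nx\<^sup>2 + ny\<^sup>2 + nz\<^sup>2 + ng\<^sup>2)"
      unfolding ex using s1' s2 am[of ny ng] am[of ng nz] am[of nx ny] by (simp only: mult.assoc)
  qed (use \<tau> in simp)
  finally show ?thesis by (simp add: nx_ny_nz_ng_def mult_ac)
qed


text \<open>
  The new value also occurs on the right hand side; \<open>a \<le> 1 / 2\<close> gives \<open>(1 + a) / (1 - a) \<le> 1 + 4 a\<close>.
\<close>

lemma gronwall:
  fixes H :: "nat \<Rightarrow> real"
  assumes a: "0 \<le> a" "a \<le> 1 / 2" and e: "0 \<le> e" and H: "\<And>j. 0 \<le> H j"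
    and step: "\<And>j. 1 \<le> j \<Longrightarrow> j < J \<Longrightarrow> H j - H (j - 1) \<le> a * (H j + H (j - 1) + e)"
    and j: "j < J"
  shows "H j \<le> exp (4 * a * real j) * (H 0 + e)"
proof -
  have "H j + e \<le> (1 + 4 * a) ^ j * (H 0 + e)"
    using j
  proof (induction j)
    case (Suc j)
    have "H (Suc j) - H j \<le> a * (H (Suc j) + H j + e)" using step[of "Suc j"] Suc by simp
    then have 1: "(1 - a) * (H (Suc j) + e) \<le> (1 + a) * (H j + e)"
    proof -
      have "(1 + a) * (H j + e) - (1 - a) * (H (Suc j) + e)
          = (a * (H (Suc j) + H j + e) - (H (Suc j) - H j)) + a * e"
        by (simp add: algebra_simps)
      moreover have "0 \<le> a * e" using a e by simp
      ultimately show ?thesis using \<open>H (Suc j) - H j \<le> a * (H (Suc j) + H j + e)\<close> by simp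
    qed
    have "1 + a \<le> (1 - a) * (1 + 4 * a)"
      using a mult_left_mono[of a "1 / 2" a] by (simp add: algebra_simps)
    then have "(1 + a) * (H j + e) \<le> (1 - a) * (1 + 4 * a) * (H j + e)"
      using H e by (intro mult_right_mono) (auto simp: add_nonneg_nonneg)
    with 1 have "(1 - a) * (H (Suc j) + e) \<le> (1 - a) * ((1 + 4 * a) * (H j + e))" by (simp add: mult.assoc)
    then have "H (Suc j) + e \<le> (1 + 4 * a) * (H j + e)" using a by simp
    also have "\<dots> \<le> (1 + 4 * a) * ((1 + 4 * a) ^ j * (H 0 + e))"
      using Suc a by (intro mult_left_mono) auto
    finally show ?case by (simp add: mult.assoc)
  qed simp
  also have "(1 + 4 * a) ^ j \<le> exp (4 * a) ^ j"
    using a exp_ge_add_one_self[of "4 * a"] by (intro power_mono) auto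
  also have "exp (4 * a) ^ j = exp (4 * a * real j)"
    by (simp add: exp_of_nat_mult[symmetric] mult_ac)
  finally show ?thesis using H[of 0] e by (simp add: mult_right_mono)
qed

text \<open>
  Gronwall's inequality for the energy. The forcing may contain bounded multiples of the error itself,
  which is how the commutator and the nonlinear remainder enter.
\<close>

lemma stability:
  fixes f g :: "nat \<Rightarrow> int \<Rightarrow> complex" and bb :: "nat \<Rightarrow> int \<Rightarrow> complex"
  assumes per: "\<And>j l. bb j (l + int N) = bb j l"
    and herm: "\<And>j l. bb j (- l) = cnj (bb j l)"
    and w: "\<And>j. wsum N (bb j) \<le> Cb" and w': "\<And>j. wsum N (\<lambda>l. bb (Suc j) l - bb j l) \<le> Cb * \<tau>"
    and rec: "\<And>j m. 1 \<le> j \<Longrightarrow> j < J \<Longrightarrow> m \<in> grid N \<Longrightarrow> f (Suc j) m = z1 m * f (j - 1) m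
      + of_real (2 * \<tau>) * (z2 m * app N (adv (bb j)) (f j) m) + of_real (2 * \<tau>) * g j m"
    and g: "\<And>j. 1 \<le> j \<Longrightarrow> j < J \<Longrightarrow> nrm N (g j) \<le> C1 * nrm N (f j) + \<epsilon>"
    and C1: "0 \<le> C1" and \<epsilon>: "0 \<le> \<epsilon>"
    and small: "\<tau> * (Ke * (2 + 4 * C1\<^sup>2)) \<le> 1 / 2"
    and T: "real J * \<tau> \<le> T" and j: "j \<le> J"
  shows "nrm N (f j) \<le> 2 * exp (2 * (Ke * (2 + 4 * C1\<^sup>2)) * T) * (nrm N (f 0) + nrm N (f 1) + \<epsilon>)"
proof -
  define Ks where "Ks = Ke * (2 + 4 * C1\<^sup>2)"
  define H where "H j = energy (bb j) (f j) (f (Suc j))" for j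
  define S where "S = nrm N (f 0) + nrm N (f 1) + \<epsilon>"
  have Ke: "0 \<le> Ke" using Cb c by (simp add: Ke_def)
  have Ks: "0 \<le> Ks" unfolding Ks_def using Ke by (intro mult_nonneg_nonneg) auto
  have S: "0 \<le> S" using \<epsilon> by (simp add: S_def)
  have Hlow: "((nrm N (f (Suc j)))\<^sup>2 + (nrm N (f j))\<^sup>2) \<le> 2 * H j" for j
    using energy_equiv(1)[where d = "bb j" and y = "f j" and z = "f (Suc j)"] per w by (simp add: H_def)
  have H0: "0 \<le> H j" for j
    using Hlow[of j] by (smt (verit) zero_le_power2)
  have T0: "0 \<le> T" using T \<tau> by (smt (verit) mult_nonneg_nonneg of_nat_0_le_iff)
  have "1 \<le> exp (2 * Ks * T)" using Ks T0 by simp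
  have first: "nrm N (f i) \<le> 2 * exp (2 * Ks * T) * S" if "i \<le> 1" for i
  proof -
    have "nrm N (f i) \<le> 1 * S" using that \<epsilon> by (cases i) (auto simp: S_def)
    also have "\<dots> \<le> 2 * exp (2 * Ks * T) * S"
      using \<open>1 \<le> exp (2 * Ks * T)\<close> S by (intro mult_right_mono) linarith+
    finally show ?thesis .
  qed
  show ?thesis
  proof (cases "j \<le> 1")
    case True
    then show ?thesis using first by (simp add: S_def Ks_def)
  next
    case False
    then obtain i where i: "j = Suc i" "1 \<le> i" "i < J" using j by (cases j) auto
    have step: "H j - H (j - 1) \<le> (\<tau> * Ks) * (H j + H (j - 1) + \<epsilon>\<^sup>2)" if j: "1 \<le> j" "j < J" for j
    proof -
      have sj: "Suc (j - 1) = j" using j by simp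
      have "H j - H (j - 1) \<le> \<tau> * Ke * ((nrm N (f (j - 1)))\<^sup>2 + (nrm N (f j))\<^sup>2 + (nrm N (f (Suc j)))\<^sup>2 + (nrm N (g j))\<^sup>2)"
        unfolding H_def sj
        by (rule energy_step[where d = "bb j" and d' = "bb (j - 1)", OF per per herm w]) (use w'[of "j - 1"] sj rec[OF j] in auto)
      also have "\<dots> \<le> \<tau> * Ke * ((2 + 4 * C1\<^sup>2) * (H j + H (j - 1) + \<epsilon>\<^sup>2))"
      proof (intro mult_left_mono)
        have "(nrm N (g j))\<^sup>2 \<le> (C1 * nrm N (f j) + \<epsilon>)\<^sup>2" using g[OF j] by (intro power_mono) auto
        also have "\<dots> \<le> 2 * (C1 * nrm N (f j))\<^sup>2 + 2 * \<epsilon>\<^sup>2"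
          using sum_squares_bound[of "C1 * nrm N (f j)" \<epsilon>] by (simp add: power2_sum)
        also have "(C1 * nrm N (f j))\<^sup>2 = C1\<^sup>2 * (nrm N (f j))\<^sup>2" by (simp add: power_mult_distrib)
        also have "C1\<^sup>2 * (nrm N (f j))\<^sup>2 \<le> C1\<^sup>2 * (2 * H j)"
          using Hlow[of j] by (intro mult_left_mono) (smt (verit) zero_le_power2, simp)
        finally have g': "(nrm N (g j))\<^sup>2 \<le> 4 * (C1\<^sup>2 * H j) + 2 * \<epsilon>\<^sup>2" by simp
        have nn: "0 \<le> C1\<^sup>2 * H (j - 1)" "0 \<le> C1\<^sup>2 * \<epsilon>\<^sup>2" using H0 by simp_all
        have ex: "(2 + 4 * C1\<^sup>2) * (H j + H (j - 1) + \<epsilon>\<^sup>2) = 2 * H j + 2 * H (j - 1) + 2 * \<epsilon>\<^sup>2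
          + 4 * (C1\<^sup>2 * H j) + 4 * (C1\<^sup>2 * H (j - 1)) + 4 * (C1\<^sup>2 * \<epsilon>\<^sup>2)" by (simp add: algebra_simps)
        have h1: "(nrm N (f j))\<^sup>2 + (nrm N (f (j - 1)))\<^sup>2 \<le> 2 * H (j - 1)" using Hlow[of "j - 1"] sj by simp
        have h2: "(nrm N (f (Suc j)))\<^sup>2 \<le> 2 * H j" using Hlow[of j] by (smt (verit) zero_le_power2)
        show "(nrm N (f (j - 1)))\<^sup>2 + (nrm N (f j))\<^sup>2 + (nrm N (f (Suc j)))\<^sup>2 + (nrm N (g j))\<^sup>2
          \<le> (2 + 4 * C1\<^sup>2) * (H j + H (j - 1) + \<epsilon>\<^sup>2)"
          unfolding ex using g' h1 h2 nn by linarith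
      qed (use \<tau> Ke in auto)
      finally show ?thesis by (simp add: Ks_def mult_ac)
    qed
    have "H i \<le> exp (4 * (\<tau> * Ks) * real i) * (H 0 + \<epsilon>\<^sup>2)"
      by (rule gronwall[where J = J]) (use \<tau> Ks small H0 step i in \<open>auto simp: Ks_def\<close>)
    also have "exp (4 * (\<tau> * Ks) * real i) \<le> exp (4 * Ks * T)"
    proof -
      have "real i * \<tau> \<le> real J * \<tau>" using i \<tau> by simp
      then have "4 * Ks * (real i * \<tau>) \<le> 4 * Ks * T" using T Ks by (intro mult_left_mono) auto
      then show ?thesis by (simp add: mult_ac)
    qed
    also have "H 0 + \<epsilon>\<^sup>2 \<le> 2 * S\<^sup>2"
    proof -
      have gen: "h + e \<le> 2 * s" if "h \<le> 3 / 2 * (b + a)" "a + b + e \<le> s" "0 \<le> s" "0 \<le> e"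
        for h a b e s :: real using that by argo
      have 1: "H 0 \<le> 3 / 2 * ((nrm N (f 1))\<^sup>2 + (nrm N (f 0))\<^sup>2)"
        using energy_equiv(2)[where d = "bb 0" and y = "f 0" and z = "f 1"] per w by (simp add: H_def)
      have 2: "(nrm N (f 0))\<^sup>2 + (nrm N (f 1))\<^sup>2 + \<epsilon>\<^sup>2 \<le> S\<^sup>2"
        using \<epsilon> by (simp add: S_def power2_eq_square algebra_simps)
      show ?thesis by (rule gen[OF 1 2]) auto
    qed
    finally have "H i \<le> exp (4 * Ks * T) * (2 * S\<^sup>2)" using H0[of 0] by (simp add: mult_right_mono)
    then have "2 * H i \<le> 4 * (exp (4 * Ks * T) * S\<^sup>2)" by (simp add: mult_ac)
    moreover have "(nrm N (f j))\<^sup>2 \<le> (nrm N (f (Suc i)))\<^sup>2 + (nrm N (f i))\<^sup>2" using i by simp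
    ultimately have "(nrm N (f j))\<^sup>2 \<le> 4 * (exp (4 * Ks * T) * S\<^sup>2)"
      using Hlow[of i] by (meson order_trans)
    also have "\<dots> = (2 * exp (2 * Ks * T) * S)\<^sup>2"
      by (simp add: power_mult_distrib flip: exp_double)
    finally have "nrm N (f j) \<le> 2 * exp (2 * Ks * T) * S"
      by (rule power2_le_imp_le) (use S in auto)
    then show ?thesis by (simp add: S_def Ks_def)
  qed
qed

end

section \<open>Finite differences and their Fourier symbols\<close>

definition fdiff :: "real \<Rightarrow> (real \<Rightarrow> real) \<Rightarrow> real \<Rightarrow> real" where
  "fdiff h f x = f (x + h) - f x"

definition samp :: "nat \<Rightarrow> (real \<Rightarrow> real) \<Rightarrow> int \<Rightarrow> complex" where
  "samp N f k = of_real (f (gridpt N k))"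

lemma gridpt_Suc: "gridpt N (k + 1) = gridpt N k + mesh N"
  by (simp add: gridpt_def distrib_right)

lemma gridpt_period: "N > 0 \<Longrightarrow> gridpt N (k + int N) = gridpt N k + 2 * pi"
  using mesh_mult[of N] by (simp add: gridpt_def distrib_right)

definition per2pi :: "(real \<Rightarrow> real) \<Rightarrow> bool" where
  "per2pi f \<longleftrightarrow> (\<forall>x. f (x + 2 * pi) = f x)"

lemma fdiff_periodic:
  assumes "per2pi f"
  shows "per2pi ((fdiff h ^^ s) f)"
proof (induction s)
  case (Suc s)
  define g where "g = (fdiff h ^^ s) f"
  have g: "g (x + 2 * pi) = g x" for x using Suc by (simp add: per2pi_def g_def)
  have "fdiff h g (x + 2 * pi) = fdiff h g x" for x
    using g[of x] g[of "x + h"] by (simp add: fdiff_def add_ac)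
  then show ?case by (simp add: per2pi_def g_def)
qed (simp add: assms)

text \<open>
  Translation by one grid point multiplies the \<open>m\<close>-th coefficient by \<open>wave N m\<close>.
\<close>

lemma dft_samp_fdiff:
  assumes N: "even N" "N > 0" and per: "per2pi f"
  shows "dft N (samp N (fdiff (mesh N) f)) m = (wave N m - 1) * dft N (samp N f) m"
proof -
  let ?\<phi> = "\<lambda>k. samp N f k * wave N (- (m * k))"
  have "wave N (- (m * (k + int N))) = wave N (- (m * k))" for k
    using wave_periodic[OF N(2), of "- (m * k)" "- m"] by (simp add: algebra_simps)
  moreover have "samp N f (k + int N) = samp N f k" for k
    using per by (simp add: samp_def gridpt_period N per2pi_def)
  ultimately have sh: "(\<Sum>k\<in>grid N. ?\<phi> (k + 1)) = (\<Sum>k\<in>grid N. ?\<phi> k)"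
    by (intro sum_grid_shift[OF N]) simp
  have "(\<Sum>k\<in>grid N. samp N f (k + 1) * wave N (- (m * k))) = (\<Sum>k\<in>grid N. wave N m * ?\<phi> (k + 1))"
  proof (rule sum.cong[OF refl])
    fix k
    have "- (m * k) = m + - (m * (k + 1))" by (simp add: algebra_simps)
    then have "wave N (- (m * k)) = wave N m * wave N (- (m * (k + 1)))" by (metis wave_add)
    then show "samp N f (k + 1) * wave N (- (m * k)) = wave N m * ?\<phi> (k + 1)" by simp
  qed
  also have "\<dots> = wave N m * (\<Sum>k\<in>grid N. ?\<phi> k)"
    by (simp only: sh sum_distrib_left[symmetric])
  finally have "(\<Sum>k\<in>grid N. samp N f (k + 1) * wave N (- (m * k))) = wave N m * (\<Sum>k\<in>grid N. ?\<phi> k)" .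
  then have "(\<Sum>k\<in>grid N. (samp N f (k + 1) - samp N f k) * wave N (- (m * k)))
      = (wave N m - 1) * (\<Sum>k\<in>grid N. ?\<phi> k)"
    by (simp only: left_diff_distrib sum_subtractf mult_1_left)
  moreover have "samp N (fdiff (mesh N) f) = (\<lambda>k. samp N f (k + 1) - samp N f k)"
    by (rule ext) (simp add: samp_def fdiff_def gridpt_Suc)
  ultimately show ?thesis by (simp add: dft_wave)
qed

lemma dft_samp_fdiff_pow:
  assumes N: "even N" "N > 0" and per: "per2pi f"
  shows "dft N (samp N ((fdiff (mesh N) ^^ s) f)) m = (wave N m - 1) ^ s * dft N (samp N f) m"
proof (induction s)
  case (Suc s)
  show ?case
    using dft_samp_fdiff[OF N fdiff_periodic[OF per]] Suc by simp
qed simp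

lemma sin_ge_half:
  assumes "0 \<le> y" "y \<le> pi / 2"
  shows "y / 2 \<le> sin y"
proof (cases "y \<le> pi / 3")
  case True
  have "sin 0 - 0 / 2 \<le> sin y - y / 2"
  proof (rule DERIV_nonneg_imp_nondecreasing[of 0 y "\<lambda>x. sin x - x / 2"])
    fix x assume "0 \<le> x" "x \<le> y"
    then have "cos (pi / 3) \<le> cos x" using True by (intro cos_monotone_0_pi_le) auto
    then show "\<exists>d. ((\<lambda>x. sin x - x / 2) has_real_derivative d) (at x) \<and> 0 \<le> d"
      by (intro exI[of _ "cos x - 1 / 2"]) (auto intro!: derivative_eq_intros simp: cos_60)
  qed (use assms in simp)
  then show ?thesis by simp
next
  case False
  have "sin (pi / 3) \<le> sin y" using False assms by (intro sin_monotone_2pi_le) auto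
  moreover have "17 / 10 \<le> sqrt 3" by (rule real_le_rsqrt) (simp add: power2_eq_square)
  moreover have "pi < 3.2" by (rule pi_approx(2)[THEN order_le_less_trans]) simp
  ultimately show ?thesis using assms by (simp add: sin_60)
qed

lemma norm_cis_minus_1_ge:
  assumes "\<bar>x\<bar> \<le> pi"
  shows "\<bar>x\<bar> / 2 \<le> cmod (cis x - 1)"
proof -
  have "(cmod (cis x - 1))\<^sup>2 = (2 * sin (\<bar>x\<bar> / 2))\<^sup>2"
  proof -
    have "(cmod (cis x - 1))\<^sup>2 = (cos x - 1)\<^sup>2 + (sin x)\<^sup>2" by (simp add: cmod_power2)
    also have "\<dots> = (cos x)\<^sup>2 + (sin x)\<^sup>2 - 2 * cos x + 1" by (simp add: power2_eq_square algebra_simps)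
    also have "\<dots> = 2 - 2 * cos \<bar>x\<bar>" by simp
    also have "cos \<bar>x\<bar> = 1 - 2 * (sin (\<bar>x\<bar> / 2))\<^sup>2" using cos_double_sin[of "\<bar>x\<bar> / 2"] by simp
    finally show ?thesis by (simp add: power_mult_distrib)
  qed
  note sq = this
  have h: "\<bar>x\<bar> / 2 / 2 \<le> sin (\<bar>x\<bar> / 2)" by (rule sin_ge_half) (use assms in simp_all)
  have "0 \<le> \<bar>x\<bar> / 2 / 2" by simp
  then have "0 \<le> 2 * sin (\<bar>x\<bar> / 2)" using h by linarith
  then have "cmod (cis x - 1) = 2 * sin (\<bar>x\<bar> / 2)"
    using sq by (metis norm_ge_zero power2_eq_imp_eq)
  then show ?thesis using h by linarith
qed

text \<open>
  On the grid \<open>\<bar>m\<bar> h \<le> \<pi>\<close>, and on this range the symbol of the difference quotient is comparable to that of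
  the derivative.
\<close>

lemma symbol_ge:
  assumes N: "even N" "N > 0" and m: "m \<in> grid N"
  shows "\<bar>of_int m\<bar> * mesh N / 2 \<le> cmod (wave N m - 1)"
proof -
  have "\<bar>of_int m * mesh N\<bar> \<le> real N / 2 * mesh N"
    using grid_bound[OF N(1) m] mesh_pos[OF N(2)] by (simp add: abs_mult mult_right_mono)
  also have "\<dots> = pi" using mesh_mult[OF N(2)] by simp
  finally show ?thesis using norm_cis_minus_1_ge[of "of_int m * mesh N"] mesh_pos[OF N(2)]
    by (simp add: wave_def abs_mult)
qed

text \<open>
  Powers of the wave number are traded for difference quotients. Decay of the discrete coefficients thus
  follows from bounds of derivatives, uniformly in \<open>N\<close>, without a Fourier series of the function.
\<close>

lemma norm_power_dft_le:
  assumes N: "even N" "N > 0" and m: "m \<in> grid N" and per: "per2pi f"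
  shows "cmod (of_int m ^ s * dft N (samp N f) m)
    \<le> (2 / mesh N) ^ s * cmod (dft N (samp N ((fdiff (mesh N) ^^ s) f)) m)"
proof -
  have h: "mesh N > 0" using mesh_pos N by simp
  have "\<bar>real_of_int m\<bar> ^ s = (2 / mesh N) ^ s * (\<bar>of_int m\<bar> * mesh N / 2) ^ s"
    using h by (simp add: power_mult_distrib flip: power_mult_distrib)
  also have "\<dots> \<le> (2 / mesh N) ^ s * cmod (wave N m - 1) ^ s"
    using h by (intro mult_left_mono power_mono symbol_ge N m) auto
  finally have "\<bar>real_of_int m\<bar> ^ s * cmod (dft N (samp N f) m)
      \<le> (2 / mesh N) ^ s * cmod (wave N m - 1) ^ s * cmod (dft N (samp N f) m)"
    by (rule mult_right_mono) simp
  then show ?thesis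
    by (simp add: dft_samp_fdiff_pow[OF N per] norm_mult norm_power)
qed

lemma nrm_power_dft_le:
  assumes N: "even N" "N > 0" and per: "per2pi f"
  shows "nrm N (\<lambda>m. of_int m ^ s * dft N (samp N f) m)
    \<le> (2 / mesh N) ^ s * nrm N (dft N (samp N ((fdiff (mesh N) ^^ s) f)))"
  by (rule nrm_mono) (use norm_power_dft_le[OF N _ per] mesh_pos[OF N(2)] in auto)

subsection \<open>Smooth functions with bounded derivatives\<close>

text \<open>
  One constant bounds the function and its first \<open>s\<close> derivatives. This is crude, but it makes bounds of
  products short: each order of differentiation costs a factor 2.
\<close>

fun smooth_bd :: "nat \<Rightarrow> real \<Rightarrow> (real \<Rightarrow> real) \<Rightarrow> bool" where
  "smooth_bd 0 B f \<longleftrightarrow> (\<forall>x. \<bar>f x\<bar> \<le> B)"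
| "smooth_bd (Suc s) B f \<longleftrightarrow> (\<forall>x. \<bar>f x\<bar> \<le> B) \<and>
     (\<exists>f'. (\<forall>x. (f has_real_derivative f' x) (at x)) \<and> smooth_bd s B f')"

lemma smooth_bd_bound: "smooth_bd s B f \<Longrightarrow> \<bar>f x\<bar> \<le> B"
  by (cases s) auto

lemma smooth_bd_nonneg: "smooth_bd s B f \<Longrightarrow> 0 \<le> B"
  using smooth_bd_bound[of s B f 0] by linarith

lemma smooth_bd_SucI:
  "(\<And>x. \<bar>f x\<bar> \<le> B) \<Longrightarrow> (\<And>x. (f has_real_derivative f' x) (at x)) \<Longrightarrow> smooth_bd s B f' \<Longrightarrow> smooth_bd (Suc s) B f"
  by auto

lemma smooth_bd_SucE:
  assumes "smooth_bd (Suc s) B f"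
  obtains f' where "\<And>x. (f has_real_derivative f' x) (at x)" "smooth_bd s B f'"
  using assms by auto

lemma smooth_bd_mono: "smooth_bd s B f \<Longrightarrow> t \<le> s \<Longrightarrow> B \<le> B' \<Longrightarrow> smooth_bd t B' f"
proof (induction s arbitrary: t f)
  case 0
  then show ?case by (auto intro: order_trans)
next
  case (Suc s)
  have b: "\<bar>f x\<bar> \<le> B'" for x using smooth_bd_bound[OF Suc.prems(1), of x] Suc.prems(3) by linarith
  obtain f' where f': "\<And>x. (f has_real_derivative f' x) (at x)" "smooth_bd s B f'"
    using smooth_bd_SucE[OF Suc.prems(1)] by blast
  show ?case
  proof (cases t)
    case (Suc u)
    then have "smooth_bd u B' f'" using Suc.IH[OF f'(2)] Suc.prems by simp
    then show ?thesis unfolding Suc by (intro smooth_bd_SucI[OF b f'(1)])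
  qed (simp add: b)
qed

lemma smooth_bd_add: "smooth_bd s A f \<Longrightarrow> smooth_bd s B g \<Longrightarrow> smooth_bd s (A + B) (\<lambda>x. f x + g x)"
proof (induction s arbitrary: f g)
  case 0
  then show ?case by (auto intro: order_trans[OF abs_triangle_ineq add_mono])
next
  case (Suc s)
  obtain f' g' where d: "\<And>x. (f has_real_derivative f' x) (at x)" "smooth_bd s A f'"
    "\<And>x. (g has_real_derivative g' x) (at x)" "smooth_bd s B g'"
    using smooth_bd_SucE[OF Suc.prems(1)] smooth_bd_SucE[OF Suc.prems(2)] by metis
  have "((\<lambda>x. f x + g x) has_real_derivative (f' x + g' x)) (at x)" for x
    by (intro DERIV_add d)
  moreover have "smooth_bd s (A + B) (\<lambda>x. f' x + g' x)" by (rule Suc.IH[OF d(2,4)])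
  moreover have "\<bar>f x + g x\<bar> \<le> A + B" for x
    using smooth_bd_bound[OF Suc.prems(1), of x] smooth_bd_bound[OF Suc.prems(2), of x] by linarith
  ultimately show ?case by (intro smooth_bd_SucI)
qed

lemma smooth_bd_cmult: "smooth_bd s B f \<Longrightarrow> smooth_bd s (\<bar>a\<bar> * B) (\<lambda>x. a * f x)"
proof (induction s arbitrary: f)
  case 0
  then show ?case by (simp add: abs_mult mult_left_mono)
next
  case (Suc s)
  obtain f' where d: "\<And>x. (f has_real_derivative f' x) (at x)" "smooth_bd s B f'"
    using smooth_bd_SucE[OF Suc.prems] by blast
  have "((\<lambda>x. a * f x) has_real_derivative (a * f' x)) (at x)" for x
    by (intro DERIV_cmult d)
  moreover have "smooth_bd s (\<bar>a\<bar> * B) (\<lambda>x. a * f' x)" by (rule Suc.IH[OF d(2)])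
  moreover have "\<bar>a * f x\<bar> \<le> \<bar>a\<bar> * B" for x
    using smooth_bd_bound[OF Suc.prems, of x] by (simp add: abs_mult mult_left_mono)
  ultimately show ?case by (intro smooth_bd_SucI)
qed

lemma smooth_bd_mult:
  "smooth_bd s A f \<Longrightarrow> smooth_bd s B g \<Longrightarrow> smooth_bd s (2 ^ s * (A * B)) (\<lambda>x. f x * g x)"
proof (induction s arbitrary: f g)
  case 0
  then show ?case by (auto simp: abs_mult intro!: mult_mono intro: order_trans[OF abs_ge_zero])
next
  case (Suc s)
  obtain f' g' where d: "\<And>x. (f has_real_derivative f' x) (at x)" "smooth_bd s A f'"
    "\<And>x. (g has_real_derivative g' x) (at x)" "smooth_bd s B g'"
    using smooth_bd_SucE[OF Suc.prems(1)] smooth_bd_SucE[OF Suc.prems(2)] by metis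
  have AB: "0 \<le> A" "0 \<le> B" using Suc.prems smooth_bd_nonneg by blast+
  have m: "smooth_bd s A f" "smooth_bd s B g"
    by (rule smooth_bd_mono[OF Suc.prems(1)] smooth_bd_mono[OF Suc.prems(2)], simp_all)+
  have "((\<lambda>x. f x * g x) has_real_derivative (f' x * g x + f x * g' x)) (at x)" for x
    using DERIV_mult'[OF d(1)[of x] d(3)[of x]] by (simp add: add.commute)
  moreover have "smooth_bd s (2 ^ s * (A * B) + 2 ^ s * (A * B)) (\<lambda>x. f' x * g x + f x * g' x)"
    by (intro smooth_bd_add Suc.IH d m)
  moreover have "\<bar>f x * g x\<bar> \<le> 2 ^ Suc s * (A * B)" for x
  proof -
    have "\<bar>f x * g x\<bar> \<le> A * B" unfolding abs_mult
      using smooth_bd_bound[OF Suc.prems(1)] smooth_bd_bound[OF Suc.prems(2)] AB by (intro mult_mono) auto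
    also have "\<dots> \<le> 2 ^ Suc s * (A * B)"
      using mult_right_mono[of 1 "2 ^ Suc s :: real" "A * B"] AB one_le_power[of "2::real" "Suc s"] by simp
    finally show ?thesis .
  qed
  ultimately show ?case by (intro smooth_bd_SucI) (auto simp: mult_ac)
qed

lemma smooth_bd_fdiff:
  assumes "smooth_bd (Suc s) B f" "0 \<le> h"
  shows "smooth_bd s (B * h) (fdiff h f)"
  using assms
proof (induction s arbitrary: f)
  case 0
  then obtain f' where d: "\<And>x. (f has_real_derivative f' x) (at x)" "\<And>x. \<bar>f' x\<bar> \<le> B" by auto
  have "\<bar>f (x + h) - f x\<bar> \<le> B * h" for x
  proof -
    have "norm (f (x + h) - f x) \<le> B * norm (x + h - x)"
      by (rule field_differentiable_bound[of UNIV f f']) (use d in auto)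
    then show ?thesis using \<open>0 \<le> h\<close> by simp
  qed
  then show ?case by (simp add: fdiff_def)
next
  case (Suc s)
  then obtain f' where d: "\<And>x. (f has_real_derivative f' x) (at x)" "smooth_bd (Suc s) B f'" by auto
  have "(fdiff h f has_real_derivative fdiff h f' x) (at x)" for x
    unfolding fdiff_def[abs_def] using d DERIV_shift[of f "f' (x + h)" x h] by (auto intro!: DERIV_diff)
  moreover have "\<bar>fdiff h f x\<bar> \<le> B * h" for x
  proof -
    have "norm (f (x + h) - f x) \<le> B * norm (x + h - x)"
      by (rule field_differentiable_bound[of UNIV f f']) (use d smooth_bd_bound[OF d(2)] in auto)
    then show ?thesis using \<open>0 \<le> h\<close> by (simp add: fdiff_def)
  qed
  ultimately show ?case using Suc.IH[OF d(2) \<open>0 \<le> h\<close>] by (intro smooth_bd_SucI)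
qed

lemma smooth_bd_fdiff_pow:
  assumes "smooth_bd s B f" "0 \<le> h"
  shows "\<bar>(fdiff h ^^ s) f x\<bar> \<le> B * h ^ s"
proof -
  have "smooth_bd t (B * h ^ r) ((fdiff h ^^ r) f)" if "s = r + t" for r t
    using that
  proof (induction r arbitrary: t)
    case (Suc r)
    then have "smooth_bd (Suc t) (B * h ^ r) ((fdiff h ^^ r) f)" by (simp del: smooth_bd.simps)
    from smooth_bd_fdiff[OF this assms(2)] show ?case by (simp add: mult_ac)
  qed (use assms in simp)
  from this[of s 0] show ?thesis by simp
qed

lemma smooth_bd_dft:
  assumes N: "even N" "N > 0" and per: "per2pi f" and f: "smooth_bd s B f"
  shows "nrm N (\<lambda>m. of_int m ^ s * dft N (samp N f) m) \<le> 2 ^ s * B"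
    "m \<in> grid N \<Longrightarrow> \<bar>of_int m\<bar> ^ s * cmod (dft N (samp N f) m) \<le> 2 ^ s * B"
proof -
  have h: "mesh N > 0" using mesh_pos N by simp
  have b: "cmod (samp N ((fdiff (mesh N) ^^ s) f) k) \<le> B * mesh N ^ s" for k
    using smooth_bd_fdiff_pow[OF f, of "mesh N"] h by (simp add: samp_def)
  have e: "(2 / mesh N) ^ s * (B * mesh N ^ s) = 2 ^ s * B" using h by (simp add: power_divide)
  have nn: "0 \<le> B * mesh N ^ s" using h smooth_bd_nonneg[OF f] by simp
  show "nrm N (\<lambda>m. of_int m ^ s * dft N (samp N f) m) \<le> 2 ^ s * B"
    unfolding e[symmetric] using h
    by (intro order_trans[OF nrm_power_dft_le[OF N per]] mult_left_mono nrm_dft_sup[OF N] b nn) auto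
  assume m: "m \<in> grid N"
  have "cmod (of_int m ^ s * dft N (samp N f) m) \<le> 2 ^ s * B"
    unfolding e[symmetric] using h
    by (intro order_trans[OF norm_power_dft_le[OF N m per]] mult_left_mono norm_dft_sup[OF N] b) auto
  then show "\<bar>of_int m\<bar> ^ s * cmod (dft N (samp N f) m) \<le> 2 ^ s * B"
    by (simp add: norm_mult norm_power)
qed

text \<open>
  Iterated mean value theorem: differences commute with derivatives, so the induction can exchange one
  difference for one derivative.
\<close>

lemma fdiff_pow_mvt:
  assumes "0 < h" and D: "\<And>i x. i < s \<Longrightarrow> (D i has_real_derivative D (Suc i) x) (at x)"
  shows "\<exists>\<xi>. x \<le> \<xi> \<and> \<xi> \<le> x + real s * h \<and> (fdiff h ^^ s) (D 0) x = h ^ s * D s \<xi>"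
  using D
proof (induction s arbitrary: D)
  case 0
  then show ?case by auto
next
  case (Suc s)
  define E where "E i = fdiff h (D i)" for i
  have "(E i has_real_derivative E (Suc i) x) (at x)" if "i < s" for i x
    unfolding E_def fdiff_def[abs_def]
    using Suc.prems that DERIV_shift[of "D i" "D (Suc i) (x + h)" x h] by (auto intro!: DERIV_diff)
  from Suc.IH[of E, OF this] obtain \<eta> where \<eta>: "x \<le> \<eta>" "\<eta> \<le> x + real s * h"
    "(fdiff h ^^ s) (E 0) x = h ^ s * E s \<eta>" by auto
  obtain \<xi> where \<xi>: "\<eta> < \<xi>" "\<xi> < \<eta> + h" "D s (\<eta> + h) - D s \<eta> = (\<eta> + h - \<eta>) * D (Suc s) \<xi>"
    using MVT2[of \<eta> "\<eta> + h" "D s" "D (Suc s)"] assms(1) Suc.prems by auto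
  have "(fdiff h ^^ Suc s) (D 0) x = h ^ Suc s * D (Suc s) \<xi>"
    using \<eta>(3) \<xi>(3) by (simp add: funpow_swap1 E_def fdiff_def)
  then show ?case using \<eta> \<xi> by (intro exI[of _ \<xi>]) (auto simp: algebra_simps)
qed

section \<open>Periodic functions with a square integrable last derivative\<close>

text \<open>
  Differentiation in the integrated sense, as it relates the last two derivatives of a function of the
  given class: the last one need not be continuous.
\<close>

definition prim :: "(real \<Rightarrow> real) \<Rightarrow> (real \<Rightarrow> real) \<Rightarrow> bool" where
  "prim F g \<longleftrightarrow> (\<forall>a b. a \<le> b \<longrightarrow> (g has_integral (F b - F a)) {a..b})"

lemma prim_integral: "prim F g \<Longrightarrow> a \<le> b \<Longrightarrow> (g has_integral (F b - F a)) {a..b}"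
  by (simp add: prim_def)

lemma prim_continuous:
  assumes "prim F g"
  shows "continuous_on UNIV F"
proof -
  have "continuous (at x) F" for x
  proof -
    have ab: "x - 1 \<le> x + 1" by simp
    have "continuous_on {x - 1..x + 1} (\<lambda>y. integral {x - 1..y} g)"
      by (rule indefinite_integral_continuous_1) (use prim_integral[OF assms ab] in blast)
    moreover have "integral {x - 1..y} g = F y - F (x - 1)" if "y \<in> {x - 1..x + 1}" for y
      using prim_integral[OF assms, of "x - 1" y] that by (simp add: integral_unique)
    ultimately have "continuous_on {x - 1..x + 1} (\<lambda>y. F y - F (x - 1))"
      by (rule continuous_on_eq)
    then have "continuous_on {x - 1..x + 1} (\<lambda>y. F y - F (x - 1) + F (x - 1))"
      by (intro continuous_on_add continuous_on_const)
    then have "continuous_on {x - 1..x + 1} F" by simp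
    then show ?thesis
      by (rule continuous_on_interior) (auto simp: interior_atLeastAtMost_real)
  qed
  then show ?thesis by (simp add: continuous_on_eq_continuous_within)
qed

lemma prim_DERIV:
  assumes "prim F g" "continuous_on UNIV g"
  shows "(F has_real_derivative g x) (at x)"
proof -
  have "((\<lambda>y. integral {x - 1..y} g) has_real_derivative g x) (at x within {x - 1..x + 1})"
    by (rule integral_has_real_derivative) (use assms(2) continuous_on_subset in auto)
  moreover have "integral {x - 1..y} g = F y - F (x - 1)" if "y \<in> {x - 1..x + 1}" for y
    using prim_integral[OF assms(1), of "x - 1" y] that by (simp add: integral_unique)
  ultimately have "((\<lambda>y. F y - F (x - 1)) has_real_derivative g x) (at x within {x - 1..x + 1})"
    by (subst has_field_derivative_cong_eventually[where g = "\<lambda>y. integral {x - 1..y} g"])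
       (auto simp: eventually_at intro!: exI[of _ 1])
  moreover have "at x within {x - 1..x + 1} = at x"
    by (rule at_within_interior) (simp add: interior_atLeastAtMost_real)
  ultimately have "((\<lambda>y. F y - F (x - 1) + F (x - 1)) has_real_derivative g x + 0) (at x)"
    by (intro DERIV_add DERIV_const) simp
  then show ?thesis by simp
qed

lemma prim_shift:
  assumes "prim F g"
  shows "prim (\<lambda>x. F (x + h)) (\<lambda>x. g (x + h))"
  unfolding prim_def
proof (intro allI impI)
  fix a b :: real assume "a \<le> b"
  then have "(g has_integral (F (b + h) - F (a + h))) {a + h..b + h}"
    by (intro prim_integral[OF assms]) simp
  from has_integral_shift_real_ivl[OF this, of h]
  show "((\<lambda>x. g (x + h)) has_integral (F (b + h) - F (a + h))) {a..b}" by simp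
qed

lemma prim_fdiff:
  assumes "prim F g"
  shows "prim (fdiff h F) (fdiff h g)"
  unfolding prim_def fdiff_def[abs_def]
proof (intro allI impI)
  fix a b :: real assume "a \<le> b"
  from has_integral_diff[OF prim_integral[OF prim_shift[OF assms] this, of h] prim_integral[OF assms this]]
  show "((\<lambda>x. g (x + h) - g x) has_integral (F (b + h) - F b - (F (a + h) - F a))) {a..b}"
    by (simp add: algebra_simps)
qed

lemma prim_fdiff_pow: "prim F g \<Longrightarrow> prim ((fdiff h ^^ s) F) ((fdiff h ^^ s) g)"
  by (induction s) (auto intro: prim_fdiff)

text \<open>
  An indefinite integral over one period extends to the line, when the integrand is periodic and the
  primitive grows by a constant over each period.
\<close>

lemma prim_periodic:
  assumes I: "\<And>x. 0 \<le> x \<Longrightarrow> x \<le> 2 * pi \<Longrightarrow> (g has_integral (F x - F 0)) {0..x}"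
    and g: "\<And>x. g (x + 2 * pi) = g x" and F: "\<And>x. F (x + 2 * pi) = F x + c"
  shows "prim F g"
proof -
  define P where "P a b \<longleftrightarrow> (g has_integral (F b - F a)) {a..b}" for a b
  have P_trans: "P a d" if "a \<le> b" "b \<le> d" "P a b" "P b d" for a b d
    using has_integral_combine[OF that(1,2)] that(3,4) unfolding P_def by fastforce
  have base: "P x y" if "0 \<le> x" "x \<le> y" "y \<le> 2 * pi" for x y
  proof -
    have "(g has_integral (F y - F 0)) {0..y}" by (rule I) (use that in auto)
    then have int: "g integrable_on {0..y}" by blast
    then have "g integrable_on {x..y}" by (rule integrable_subinterval_real) (use that in auto)
    moreover have "integral {0..x} g + integral {x..y} g = integral {0..y} g"
      by (rule Henstock_Kurzweil_Integration.integral_combine) (use that int in auto)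
    moreover have "integral {0..x} g = F x - F 0" "integral {0..y} g = F y - F 0"
      by (intro integral_unique I; use that in simp)+
    ultimately show ?thesis unfolding P_def by (simp add: has_integral_iff)
  qed
  have shift: "P (a + 2 * pi) (b + 2 * pi) \<longleftrightarrow> P a b" for a b
    using has_integral_shift_real_ivl_iff[of g "F b - F a" "a + 2 * pi" "b + 2 * pi" "2 * pi"]
    by (simp add: P_def F g)
  have shiftk: "P (a + of_int k * (2 * pi)) (b + of_int k * (2 * pi)) \<longleftrightarrow> P a b" for a b k
  proof (induction k rule: int_induct[where k = 0])
    case (step1 i)
    then show ?case using shift[of "a + of_int i * (2 * pi)" "b + of_int i * (2 * pi)"]
      by (simp add: algebra_simps)
  next
    case (step2 i)
    then show ?case using shift[of "a + of_int (i - 1) * (2 * pi)" "b + of_int (i - 1) * (2 * pi)"]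
      by (simp add: algebra_simps)
  qed simp
  have cell: "P x y" if "of_int k * (2 * pi) \<le> x" "x \<le> y" "y \<le> of_int (k + 1) * (2 * pi)" for x y k
    using base[of "x - of_int k * (2 * pi)" "y - of_int k * (2 * pi)"] that
      shiftk[of "x - of_int k * (2 * pi)" k "y - of_int k * (2 * pi)"]
    by (simp add: algebra_simps)
  have main: "P a b" if "a \<le> b" "of_int k * (2 * pi) \<le> a" "b \<le> of_int (k + int n) * (2 * pi)" for a b k n
    using that
  proof (induction n arbitrary: a k)
    case 0
    then have "a = b" by simp
    then show ?case by (simp add: P_def has_integral_refl)
  next
    case (Suc n)
    let ?m = "of_int (k + 1) * (2 * pi)"
    show ?case
    proof (cases "b \<le> ?m")
      case True
      then show ?thesis using cell[of k a b] Suc.prems by simp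
    next
      case False
      have up: "P (max a ?m) b"
        by (rule Suc.IH[of _ "k + 1"]) (use Suc.prems False in \<open>auto simp: add_ac\<close>)
      show ?thesis
      proof (cases "a \<le> ?m")
        case True
        then have "P a ?m" by (intro cell[of k]) (use Suc.prems in auto)
        then show ?thesis using P_trans[of a ?m b] up True False by (simp add: max_def split: if_splits)
      next
        case False
        then show ?thesis using up by (simp add: max_def split: if_splits)
      qed
    qed
  qed
  have "P a b" if "a \<le> b" for a b
  proof -
    define k where "k = \<lfloor>a / (2 * pi)\<rfloor>"
    define n where "n = nat (\<lceil>b / (2 * pi)\<rceil> - k)"
    have 1: "of_int k * (2 * pi) \<le> a"
      using floor_divide_lower[of "2 * pi" a] by (simp add: k_def)
    have "a / (2 * pi) \<le> b / (2 * pi)" using that by (simp add: divide_right_mono)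
    then have "k \<le> \<lceil>b / (2 * pi)\<rceil>" unfolding k_def by linarith
    then have "k + int n = \<lceil>b / (2 * pi)\<rceil>" by (simp add: n_def)
    moreover have "b \<le> of_int \<lceil>b / (2 * pi)\<rceil> * (2 * pi)"
      by (rule ceiling_divide_upper) simp
    ultimately show ?thesis using main[OF that 1, of n] by simp
  qed
  then show ?thesis by (simp add: prim_def P_def)
qed

text \<open>
  The representative of \<open>x\<close> in the period \<open>[0, 2\<pi>)\<close>.
\<close>

definition pmod :: "real \<Rightarrow> real" where
  "pmod x = x - of_int \<lfloor>x / (2 * pi)\<rfloor> * (2 * pi)"

lemma pmod_shift: "pmod (x + 2 * pi) = pmod x" "\<lfloor>(x + 2 * pi) / (2 * pi)\<rfloor> = \<lfloor>x / (2 * pi)\<rfloor> + 1"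
proof -
  have "(x + 2 * pi) / (2 * pi) = x / (2 * pi) + 1" by (simp add: add_divide_distrib)
  then show "\<lfloor>(x + 2 * pi) / (2 * pi)\<rfloor> = \<lfloor>x / (2 * pi)\<rfloor> + 1" by simp
  then show "pmod (x + 2 * pi) = pmod x" by (simp add: pmod_def algebra_simps)
qed

lemma floor_cell: "0 \<le> x \<Longrightarrow> x < 2 * pi \<Longrightarrow> \<lfloor>x / (2 * pi)\<rfloor> = 0"
  by (simp add: floor_eq_iff)

lemma pmod_id: "0 \<le> x \<Longrightarrow> x < 2 * pi \<Longrightarrow> pmod x = x"
  by (simp add: pmod_def floor_cell)

text \<open>
  This is applied to squares, whose indefinite integral grows from period to period by the integral over
  a period.
\<close>

lemma prim_of_periodic:
  assumes g: "per2pi g" and int: "g integrable_on {0..2 * pi}"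
  obtains G where "prim G g" "\<And>x. G (x + 2 * pi) = G x + integral {0..2 * pi} g"
proof -
  define c where "c = integral {0..2 * pi} g"
  define G where "G x = integral {0..pmod x} g + of_int \<lfloor>x / (2 * pi)\<rfloor> * c" for x
  have sh: "G (x + 2 * pi) = G x + c" for x unfolding G_def pmod_shift by (simp add: algebra_simps)
  have G: "G x = integral {0..x} g" if "0 \<le> x" "x \<le> 2 * pi" for x
  proof (cases "x = 2 * pi")
    case True
    then show ?thesis using sh[of 0] by (simp add: G_def pmod_def c_def)
  next
    case False
    then show ?thesis using that by (simp add: G_def pmod_id floor_cell)
  qed
  have "prim G g"
  proof (rule prim_periodic[where c = c])
    fix x assume x: "0 \<le> x" "x \<le> 2 * pi"
    have "g integrable_on {0..x}" by (rule integrable_subinterval_real[OF int]) (use x in auto)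
    then show "(g has_integral (G x - G 0)) {0..x}" using x by (simp add: G integrable_integral)
  qed (use g sh in \<open>auto simp: per2pi_def\<close>)
  then show ?thesis using that sh c_def by blast
qed

text \<open>
  The regularity of a solution at a fixed time that the estimates depend on: a tower of derivatives with
  bounded \<open>L\<^sup>2\<close> norms, in which only the last function may be discontinuous.
\<close>

definition chain :: "nat \<Rightarrow> real \<Rightarrow> (nat \<Rightarrow> real \<Rightarrow> real) \<Rightarrow> bool" where
  "chain q M E \<longleftrightarrow> (\<forall>i\<le>q. per2pi (E i)) \<and> (\<forall>i<q. prim (E i) (E (Suc i))) \<and>
     (\<forall>i\<le>q. (\<lambda>x. (E i x)\<^sup>2) integrable_on {0..2 * pi} \<and> integral {0..2 * pi} (\<lambda>x. (E i x)\<^sup>2) \<le> M)"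

lemma bounded_variation_bound:
  assumes "bounded_variation 0 (2 * pi) f"
  obtains B where "\<And>x. x \<in> {0..2 * pi} \<Longrightarrow> \<bar>f x\<bar> \<le> B"
proof -
  obtain V where V: "\<And>(n::nat) x. 0 \<le> x 0 \<and> (\<forall>i<n. x i \<le> x (Suc i)) \<and> x n \<le> 2 * pi \<Longrightarrow>
        (\<Sum>i<n. \<bar>f (x (Suc i)) - f (x i)\<bar>) \<le> V"
    using assms unfolding bounded_variation_def by blast
  have "\<bar>f x\<bar> \<le> \<bar>f 0\<bar> + V" if "x \<in> {0..2 * pi}" for x
    using V[of "\<lambda>i. if i = 0 then 0 else x" 1] that by simp
  then show ?thesis using that by blast
qed

lemma square_integrable:
  fixes g :: "real \<Rightarrow> real"
  assumes g: "g integrable_on {a..b}" and B: "\<And>x. x \<in> {a..b} \<Longrightarrow> \<bar>g x\<bar> \<le> B"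
  shows "(\<lambda>x. (g x)\<^sup>2) integrable_on {a..b}"
proof (rule measurable_bounded_by_integrable_imp_integrable)
  show "(\<lambda>x. (g x)\<^sup>2) \<in> borel_measurable (lebesgue_on {a..b})"
    using integrable_imp_measurable[OF g] by (rule borel_measurable_power)
  show "(\<lambda>_. B\<^sup>2) integrable_on {a..b}" by (rule integrable_const_ivl)
  fix x assume "x \<in> {a..b}"
  then have "\<bar>g x\<bar>\<^sup>2 \<le> B\<^sup>2" using B by (intro power_mono) auto
  then show "norm ((g x)\<^sup>2) \<le> B\<^sup>2" by simp
qed auto

text \<open>
  The last derivative is given over one period only. Its periodic extension differs from it in the single
  point \<open>2\<pi>\<close>, which no integral notices.
\<close>

lemma Cq_chain:
  assumes D: "Cq_derivatives q f D" and q: "q \<ge> 1"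
    and M: "\<And>i. i \<le> q \<Longrightarrow> integral {0..2 * pi} (\<lambda>x. (D i x)\<^sup>2) \<le> M"
  obtains E where "chain q M E" "E 0 = f"
proof -
  define E where "E i = (if i = q then (\<lambda>x. D q (pmod x)) else D i)" for i
  have per: "per2pi (E i)" if "i \<le> q" for i
    using D that by (auto simp: E_def per2pi_def pmod_shift Cq_derivatives_def)
  have eqE: "E i x = D i x" if "i \<le> q" "x \<in> {0..2 * pi} - {2 * pi}" for i x
    using that by (auto simp: E_def pmod_id)
  have int: "(D (Suc i) has_integral (D i x - D i 0)) {0..x}" if "i < q" "x \<in> {0..2 * pi}" for i x
    using D that unfolding Cq_derivatives_def rs_derivative_def by blast
  have prm: "prim (E i) (E (Suc i))" if i: "i < q" for i
  proof (rule prim_periodic[where c = 0])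
    fix x assume x: "0 \<le> x" "x \<le> 2 * pi"
    have "(E (Suc i) has_integral (D i x - D i 0)) {0..x}"
      by (rule has_integral_spike_finite[where S = "{2 * pi}", OF _ _ int[of i x]])
         (use x i eqE[of "Suc i"] in auto)
    then show "(E (Suc i) has_integral (E i x - E i 0)) {0..x}" using i by (simp add: E_def)
  qed (use per[of i] per[of "Suc i"] i in \<open>auto simp: per2pi_def\<close>)
  have intD: "(\<lambda>x. (D i x)\<^sup>2) integrable_on {0..2 * pi}" if i: "i \<le> q" for i
  proof (cases "i = 0")
    case False
    then have "bounded_variation 0 (2 * pi) (D i)" using D i by (simp add: Cq_derivatives_def)
    then obtain B where B: "\<And>x. x \<in> {0..2 * pi} \<Longrightarrow> \<bar>D i x\<bar> \<le> B" using bounded_variation_bound by blast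
    have "(D i has_integral (D (i - 1) (2 * pi) - D (i - 1) 0)) {0..2 * pi}"
      using int[of "i - 1" "2 * pi"] False i by simp
    then have "D i integrable_on {0..2 * pi}" by blast
    then show ?thesis using B by (rule square_integrable)
  next
    case True
    have "continuous_on UNIV (E 0)" using prim_continuous[OF prm[of 0]] q by simp
    then have "continuous_on {0..2 * pi} (\<lambda>x. (E 0 x)\<^sup>2)"
      by (intro continuous_on_power) (rule continuous_on_subset, auto)
    then show ?thesis using True q by (simp add: E_def integrable_continuous_real)
  qed
  have "chain q M E"
    unfolding chain_def
  proof (intro conjI allI impI per prm)
    fix i assume i: "i \<le> q"
    have "((\<lambda>x. (E i x)\<^sup>2) has_integral integral {0..2 * pi} (\<lambda>x. (D i x)\<^sup>2)) {0..2 * pi}"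
      by (rule has_integral_spike_finite[where S = "{2 * pi}", OF _ _ integrable_integral[OF intD[OF i]]])
         (use eqE[OF i] in auto)
    then show "(\<lambda>x. (E i x)\<^sup>2) integrable_on {0..2 * pi}" "integral {0..2 * pi} (\<lambda>x. (E i x)\<^sup>2) \<le> M"
      using M[OF i] by (auto simp: integral_unique)
  qed
  moreover have "E 0 = f" using D q by (simp add: E_def Cq_derivatives_def)
  ultimately show ?thesis using that by blast
qed

lemma integral_cauchy_schwarz:
  fixes g :: "real \<Rightarrow> real"
  assumes g: "(g has_integral I) {a..b}" and g2: "((\<lambda>x. (g x)\<^sup>2) has_integral S) {a..b}" and ab: "a < b"
  shows "I\<^sup>2 \<le> (b - a) * S"
proof -
  define m where "m = I / (b - a)"
  have "((\<lambda>x. (g x)\<^sup>2 - 2 * m * g x + m\<^sup>2) has_integral (S - 2 * m * I + m\<^sup>2 * (b - a))) {a..b}"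
    using has_integral_add[OF has_integral_diff[OF g2 has_integral_mult_right[OF g, of "2 * m"]]
        has_integral_const_real[of "m\<^sup>2" a b]] ab by (simp add: mult.commute)
  moreover have "0 \<le> (g x)\<^sup>2 - 2 * m * g x + m\<^sup>2" for x
    using zero_le_power2[of "g x - m"] by (simp add: power2_diff mult_ac)
  ultimately have "0 \<le> S - 2 * m * I + m\<^sup>2 * (b - a)" by (rule has_integral_nonneg)
  moreover have I: "I = m * (b - a)" using ab by (simp add: m_def)
  ultimately have "m\<^sup>2 * (b - a) \<le> S" by (simp add: power2_eq_square mult.assoc)
  then have "(b - a) * (m\<^sup>2 * (b - a)) \<le> (b - a) * S" using ab by (intro mult_left_mono) auto
  moreover have "(b - a) * (m\<^sup>2 * (b - a)) = I\<^sup>2" by (simp add: I power2_eq_square)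
  ultimately show ?thesis by simp
qed

text \<open>
  After subtraction of a linear function \<open>\<psi>\<close> becomes periodic, and its differences sum to zero over the
  grid.
\<close>

lemma sum_grid_period:
  fixes \<psi> :: "int \<Rightarrow> real"
  assumes N: "even N" "N > 0" and per: "\<And>k. \<psi> (k + int N) = \<psi> k + c"
  shows "(\<Sum>k\<in>grid N. \<psi> (k + 1) - \<psi> k) = c"
proof -
  define \<phi> where "\<phi> k = \<psi> k - c * of_int k / real N" for k
  have "(\<Sum>k\<in>grid N. \<phi> (k + 1)) = (\<Sum>k\<in>grid N. \<phi> k)"
    by (rule sum_grid_shift[OF N]) (use N in \<open>simp add: \<phi>_def per field_simps\<close>)
  then have "0 = (\<Sum>k\<in>grid N. \<phi> (k + 1) - \<phi> k)" by (simp add: sum_subtractf)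
  also have "\<dots> = (\<Sum>k\<in>grid N. (\<psi> (k + 1) - \<psi> k) - c / real N)"
    by (intro sum.cong refl) (use N in \<open>simp add: \<phi>_def field_simps\<close>)
  also have "\<dots> = (\<Sum>k\<in>grid N. \<psi> (k + 1) - \<psi> k) - c"
    using N by (simp add: sum_subtractf card_grid)
  finally show ?thesis by simp
qed

text \<open>
  Discrete Sobolev inequality: the grid norm of an \<open>s\<close>-th difference quotient is bounded by the
  \<open>L\<^sup>2\<close> norm of the \<open>s\<close>-th derivative. A single difference is an integral over one cell; all shifts \<open>y\<close>
  of the grid have to be treated together for the induction.
\<close>

lemma chain_fdiff:
  assumes ch: "chain q M E" and N: "even N" "N > 0" and le: "i + s \<le> q" "s \<ge> 1"
  shows "(\<Sum>k\<in>grid N. ((fdiff (mesh N) ^^ s) (E i) (gridpt N k + y))\<^sup>2) \<le> mesh N ^ (2 * s - 1) * M"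
  using le
proof (induction s arbitrary: i y)
  case (Suc s)
  define h where "h = mesh N"
  have h: "h > 0" using mesh_pos N by (simp add: h_def)
  have prm: "prim (E i) (E (Suc i))" using ch Suc.prems by (simp add: chain_def)
  show ?case
  proof (cases "s = 0")
    case True
    have per: "per2pi (\<lambda>x. (E (Suc i) x)\<^sup>2)" and int: "(\<lambda>x. (E (Suc i) x)\<^sup>2) integrable_on {0..2 * pi}"
      and M: "integral {0..2 * pi} (\<lambda>x. (E (Suc i) x)\<^sup>2) \<le> M"
      using ch Suc.prems by (auto simp: chain_def per2pi_def)
    obtain G where G: "prim G (\<lambda>x. (E (Suc i) x)\<^sup>2)"
      "\<And>x. G (x + 2 * pi) = G x + integral {0..2 * pi} (\<lambda>x. (E (Suc i) x)\<^sup>2)"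
      using prim_of_periodic[OF per int] by blast
    have one: "(fdiff h (E i) x)\<^sup>2 \<le> h * (G (x + h) - G x)" for x
      using integral_cauchy_schwarz[OF prim_integral[OF prm] prim_integral[OF G(1)], of x "x + h"] h
      by (simp add: fdiff_def)
    have "(\<Sum>k\<in>grid N. (fdiff h (E i) (gridpt N k + y))\<^sup>2)
        \<le> (\<Sum>k\<in>grid N. h * (G (gridpt N (k + 1) + y) - G (gridpt N k + y)))"
    proof (rule sum_mono)
      fix k
      show "(fdiff h (E i) (gridpt N k + y))\<^sup>2 \<le> h * (G (gridpt N (k + 1) + y) - G (gridpt N k + y))"
        using one[of "gridpt N k + y"] unfolding gridpt_Suc h_def by (simp add: add_ac)
    qed
    also have "\<dots> = h * (\<Sum>k\<in>grid N. G (gridpt N (k + 1) + y) - G (gridpt N k + y))"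
      by (simp add: sum_distrib_left)
    also have "(\<Sum>k\<in>grid N. G (gridpt N (k + 1) + y) - G (gridpt N k + y))
        = integral {0..2 * pi} (\<lambda>x. (E (Suc i) x)\<^sup>2)"
    proof (rule sum_grid_period[OF N, where \<psi> = "\<lambda>k. G (gridpt N k + y)"])
      fix k show "G (gridpt N (k + int N) + y) = G (gridpt N k + y) + integral {0..2 * pi} (\<lambda>x. (E (Suc i) x)\<^sup>2)"
        using G(2)[of "gridpt N k + y"] by (simp add: gridpt_period N add_ac)
    qed
    also have "h * \<dots> \<le> h * M" using M h by (intro mult_left_mono) auto
    finally show ?thesis using True by (simp add: h_def)
  next
    case False
    define f where "f = (fdiff h ^^ s) (E i)"
    define g where "g = (fdiff h ^^ s) (E (Suc i))"
    define B where "B = h ^ (2 * s - 1) * M"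
    have fg: "prim f g" unfolding f_def g_def by (rule prim_fdiff_pow[OF prm])
    have "prim (E (Suc i)) (E (Suc (Suc i)))" using ch Suc.prems False by (simp add: chain_def)
    then have cont: "continuous_on UNIV g" unfolding g_def by (rule prim_continuous[OF prim_fdiff_pow])
    have contc: "continuous_on S (\<lambda>z. (g (x + z))\<^sup>2)" for S x
      by (intro continuous_on_power continuous_on_compose2[OF cont] continuous_intros) auto
    have one: "(fdiff h f x)\<^sup>2 \<le> h * integral {0..h} (\<lambda>z. (g (x + z))\<^sup>2)" for x
    proof -
      have i1: "((\<lambda>z. g (z + x)) has_integral (f (x + h) - f x)) {0..h}"
        using prim_integral[OF prim_shift[OF fg, of x], of 0 h] h by (simp add: add.commute)
      have i2: "((\<lambda>z. (g (z + x))\<^sup>2) has_integral (integral {0..h} (\<lambda>z. (g (z + x))\<^sup>2))) {0..h}"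
        using contc[of "{0..h}" x] by (intro integrable_integral integrable_continuous_real) (simp add: add.commute)
      show ?thesis using integral_cauchy_schwarz[OF i1 i2 h] by (simp add: fdiff_def add.commute)
    qed
    have "(\<Sum>k\<in>grid N. (fdiff h f (gridpt N k + y))\<^sup>2)
        \<le> (\<Sum>k\<in>grid N. h * integral {0..h} (\<lambda>z. (g (gridpt N k + y + z))\<^sup>2))"
      by (intro sum_mono one)
    also have "\<dots> = h * integral {0..h} (\<lambda>z. \<Sum>k\<in>grid N. (g (gridpt N k + y + z))\<^sup>2)"
      by (subst integral_sum) (auto simp: sum_distrib_left intro!: integrable_continuous_real contc)
    also have "integral {0..h} (\<lambda>z. \<Sum>k\<in>grid N. (g (gridpt N k + y + z))\<^sup>2) \<le> integral {0..h} (\<lambda>z. B)"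
    proof (rule integral_le)
      show "(\<lambda>z. \<Sum>k\<in>grid N. (g (gridpt N k + y + z))\<^sup>2) integrable_on {0..h}"
        by (intro integrable_sum integrable_continuous_real contc) auto
      fix z
      show "(\<Sum>k\<in>grid N. (g (gridpt N k + y + z))\<^sup>2) \<le> B"
        using Suc.IH[of "Suc i" "y + z"] Suc.prems False by (simp add: g_def B_def h_def add_ac)
    qed auto
    also have "integral {0..h} (\<lambda>z. B) = h * B" using h by simp
    finally have "(\<Sum>k\<in>grid N. (fdiff h f (gridpt N k + y))\<^sup>2) \<le> h * (h * B)" using h by simp
    also have "h * (h * B) = h ^ (2 * Suc s - 1) * M"
    proof -
      obtain t where "s = Suc t" using False by (cases s) auto
      then show ?thesis by (simp add: B_def)
    qed
    finally show ?thesis by (simp add: f_def h_def)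
  qed
qed simp

lemma chain_dft:
  assumes ch: "chain q M E" and N: "even N" "N > 0" and le: "i + s \<le> q" "s \<ge> 1"
  shows "nrm N (\<lambda>m. of_int m ^ s * dft N (samp N (E i)) m) \<le> 2 ^ s * sqrt M"
proof -
  define h where "h = mesh N"
  define F where "F = (fdiff h ^^ s) (E i)"
  have h: "h > 0" using mesh_pos N by (simp add: h_def)
  have Nh: "real N * h = 2 * pi" using mesh_mult N by (simp add: h_def)
  have "h * M \<ge> 0"
  proof -
    have "0 \<le> integral {0..2 * pi} (\<lambda>x. (E 0 x)\<^sup>2)" by (rule integral_nonneg) (use ch in \<open>auto simp: chain_def\<close>)
    then show ?thesis using ch h by (auto simp: chain_def intro: order_trans)
  qed
  then have M: "0 \<le> M" using h by (simp add: zero_le_mult_iff)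
  have "(nrm N (samp N F))\<^sup>2 \<le> h ^ (2 * s - 1) * M"
    using chain_fdiff[OF assms, of 0] by (simp add: nrm_sq samp_def F_def h_def)
  then have "real N * (nrm N (dft N (samp N F)))\<^sup>2 \<le> h ^ (2 * s - 1) * M"
    using nrm_dft[OF N, of "samp N F", symmetric] by (simp add: power_mult_distrib)
  then have "h * (real N * (nrm N (dft N (samp N F)))\<^sup>2) \<le> h * (h ^ (2 * s - 1) * M)"
    using h by (intro mult_left_mono) auto
  moreover have "h * h ^ (2 * s - 1) = (h ^ s)\<^sup>2"
    using le by (simp add: power_mult[symmetric] mult.commute flip: power_Suc)
  ultimately have "2 * pi * (nrm N (dft N (samp N F)))\<^sup>2 \<le> (h ^ s)\<^sup>2 * M"
    using Nh by (metis mult.assoc mult.commute)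
  moreover have "1 * (nrm N (dft N (samp N F)))\<^sup>2 \<le> 2 * pi * (nrm N (dft N (samp N F)))\<^sup>2"
    using pi_ge_two by (intro mult_right_mono) auto
  ultimately have "(nrm N (dft N (samp N F)))\<^sup>2 \<le> (h ^ s * sqrt M)\<^sup>2"
    using M by (simp add: power_mult_distrib)
  then have "nrm N (dft N (samp N F)) \<le> h ^ s * sqrt M"
    by (rule power2_le_imp_le) (use h M in auto)
  then have "(2 / h) ^ s * nrm N (dft N (samp N F)) \<le> (2 / h) ^ s * (h ^ s * sqrt M)"
    using h by (intro mult_left_mono) auto
  also have "\<dots> = 2 ^ s * sqrt M" using h by (simp add: power_divide)
  finally have "(2 / h) ^ s * nrm N (dft N (samp N F)) \<le> 2 ^ s * sqrt M" .
  moreover have "per2pi (E i)" using ch le by (simp add: chain_def)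
  ultimately show ?thesis
    using nrm_power_dft_le[OF N, of "E i" s] by (auto simp: F_def h_def)
qed

lemma chain_DERIV:
  assumes "chain q M E" "Suc i < q"
  shows "(E i has_real_derivative E (Suc i) x) (at x)"
  using assms by (intro prim_DERIV prim_continuous[of _ "E (Suc (Suc i))"]) (auto simp: chain_def)

text \<open>
  A derivative has mean zero over a period, and the Cauchy-Schwarz inequality bounds its oscillation by
  the \<open>L\<^sup>2\<close> norm of the next derivative.
\<close>

lemma chain_sup:
  assumes ch: "chain q M E" and i: "1 \<le> i" "i < q"
  shows "\<bar>E i x\<bar> \<le> sqrt (2 * pi * M)"
proof -
  define K where "K = sqrt (2 * pi * M)"
  have per: "per2pi (\<lambda>x. (E (Suc i) x)\<^sup>2)" and int: "(\<lambda>x. (E (Suc i) x)\<^sup>2) integrable_on {0..2 * pi}"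
    and M: "integral {0..2 * pi} (\<lambda>x. (E (Suc i) x)\<^sup>2) \<le> M" and prm: "prim (E i) (E (Suc i))"
    and prm': "prim (E (i - 1)) (E i)" and per': "per2pi (E (i - 1))"
    using ch i by (auto simp: chain_def per2pi_def)
      (metis One_nat_def Suc_pred less_imp_diff_less order_less_le_trans zero_less_one less_Suc_eq_le)+
  obtain G where G: "prim G (\<lambda>x. (E (Suc i) x)\<^sup>2)"
    "\<And>x. G (x + 2 * pi) = G x + integral {0..2 * pi} (\<lambda>x. (E (Suc i) x)\<^sup>2)"
    using prim_of_periodic[OF per int] by blast
  have mono: "G a \<le> G b" if "a \<le> b" for a b
    using has_integral_nonneg[OF prim_integral[OF G(1) that]] by simp
  have osc: "\<bar>E i y - E i x\<bar> \<le> K" if y: "y \<in> {x..x + 2 * pi}" for y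
  proof (cases "y = x")
    case False
    then have "(E i y - E i x)\<^sup>2 \<le> (y - x) * (G y - G x)"
      using integral_cauchy_schwarz[OF prim_integral[OF prm] prim_integral[OF G(1)], of x y] y by auto
    also have "\<dots> \<le> (2 * pi) * M"
      using y mono[of x y] mono[of y "x + 2 * pi"] G(2)[of x] M by (intro mult_mono) auto
    finally have "sqrt ((E i y - E i x)\<^sup>2) \<le> K" unfolding K_def by (rule real_sqrt_le_mono)
    then show ?thesis by simp
  qed (use M in \<open>simp add: K_def order_trans[OF integral_nonneg[OF int] M]\<close>)
  have zero: "(E i has_integral 0) {x..x + 2 * pi}"
    using prim_integral[OF prm', of x "x + 2 * pi"] per' by (simp add: per2pi_def)
  have c: "((\<lambda>_. e) has_integral (e * (2 * pi))) {x..x + 2 * pi}" for e :: real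
    using has_integral_const_real[of e x "x + 2 * pi"] by (simp add: mult.commute)
  have "(E i x - K) * (2 * pi) \<le> 0"
    by (rule has_integral_le[OF c zero]) (use osc in \<open>smt (verit)\<close>)
  moreover have "0 \<le> (E i x + K) * (2 * pi)"
    by (rule has_integral_le[OF zero c]) (use osc in \<open>smt (verit)\<close>)
  ultimately have "E i x - K \<le> 0" "0 \<le> E i x + K"
    using pi_gt_zero by (simp_all add: mult_le_0_iff zero_le_mult_iff)
  then show ?thesis by (simp add: K_def)
qed

section \<open>Accuracy of the pseudospectral derivative\<close>

lemma sum_inverse_squares_nat: "(\<Sum>p\<in>{1..n}. 1 / (real p)\<^sup>2) \<le> 2"
proof -
  have *: "(\<Sum>p\<in>{1..n}. 1 / (real p)\<^sup>2) \<le> 2 - 1 / real n" if "n \<ge> 1" for n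
    using that
  proof (induction n rule: dec_induct)
    case (step n)
    have n: "real n > 0" using step by simp
    have "1 / (real (Suc n))\<^sup>2 \<le> 1 / (real n * real (Suc n))"
      using n by (intro divide_left_mono) (auto simp: power2_eq_square)
    also have "\<dots> = 1 / real n - 1 / real (Suc n)" using n by (simp add: field_simps)
    finally show ?case using step by simp
  qed simp
  show ?thesis
  proof (cases "n = 0")
    case False
    then have "(\<Sum>p\<in>{1..n}. 1 / (real p)\<^sup>2) \<le> 2 - 1 / real n" by (intro *) simp
    also have "\<dots> \<le> 2" by simp
    finally show ?thesis .
  qed simp
qed

lemma sum_inverse_squares:
  assumes "finite S" "0 \<notin> S"
  shows "(\<Sum>p\<in>S. 1 / (real_of_int p)\<^sup>2) \<le> 4"
proof -
  obtain n :: nat where n: "S \<subseteq> {- int n..int n}"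
  proof -
    define m where "m = (\<Sum>p\<in>S. nat \<bar>p\<bar>)"
    have "nat \<bar>p\<bar> \<le> m" if "p \<in> S" for p
      unfolding m_def using assms(1) that by (intro member_le_sum) auto
    then have "\<bar>p\<bar> \<le> int m" if "p \<in> S" for p using that by fastforce
    then have "S \<subseteq> {- int m..int m}" by (auto simp: abs_le_iff) (metis minus_le_iff)
    then show ?thesis using that by blast
  qed
  have "(\<Sum>p\<in>S. 1 / (real_of_int p)\<^sup>2) \<le> (\<Sum>p\<in>int ` {1..n} \<union> (\<lambda>p. - int p) ` {1..n}. 1 / (real_of_int p)\<^sup>2)"
  proof (rule sum_mono2)
    show "S \<subseteq> int ` {1..n} \<union> (\<lambda>p. - int p) ` {1..n}"
    proof
      fix p assume p: "p \<in> S"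
      then have "p = int (nat p) \<and> nat p \<in> {1..n} \<or> p = - int (nat (- p)) \<and> nat (- p) \<in> {1..n}"
        using n assms(2) by (cases "p = 0"; cases "p > 0") auto
      then show "p \<in> int ` {1..n} \<union> (\<lambda>p. - int p) ` {1..n}" by blast
    qed
  qed auto
  also have "\<dots> \<le> (\<Sum>p\<in>int ` {1..n}. 1 / (real_of_int p)\<^sup>2) + (\<Sum>p\<in>(\<lambda>p. - int p) ` {1..n}. 1 / (real_of_int p)\<^sup>2)"
    by (subst sum.union_disjoint) auto
  also have "\<dots> = (\<Sum>p\<in>{1..n}. 1 / (real p)\<^sup>2) + (\<Sum>p\<in>{1..n}. 1 / (real p)\<^sup>2)"
    by (intro arg_cong2[where f = "(+)"]; subst sum.reindex) (auto simp: inj_on_def)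
  finally show ?thesis using sum_inverse_squares_nat[of n] by linarith
qed

text \<open>
  Summation by parts gives cubic decay of the discrete Fourier coefficients, which makes the weighted
  sum of the multiplier's coefficients finite uniformly in \<open>N\<close>.
\<close>

lemma wsum_smooth:
  assumes N: "even N" "N > 0" and per: "per2pi f" and f: "smooth_bd 3 B f"
  shows "wsum N (dft N (samp N f)) \<le> 65 * B"
proof -
  have B: "0 \<le> B" using smooth_bd_nonneg[OF f] .
  have N2: "0 \<in> grid N" using N by (auto simp: grid_def)
  have z: "cmod (dft N (samp N f) 0) \<le> B"
    by (rule norm_dft_sup[OF N]) (use smooth_bd_bound[OF f] in \<open>simp add: samp_def\<close>)
  have nz: "(1 + \<bar>real_of_int l\<bar>) * cmod (dft N (samp N f) l) \<le> 16 * B * (1 / (real_of_int l)\<^sup>2)"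
    if l: "l \<in> grid N" "l \<noteq> 0" for l
  proof -
    have l1: "\<bar>real_of_int l\<bar> \<ge> 1" using l(2) by linarith
    have "\<bar>real_of_int l\<bar> ^ 3 * cmod (dft N (samp N f) l) \<le> 8 * B"
      using smooth_bd_dft(2)[OF N per f l(1)] by simp
    then have c: "cmod (dft N (samp N f) l) \<le> 8 * B / \<bar>real_of_int l\<bar> ^ 3"
      using l1 by (simp add: field_simps)
    have "(1 + \<bar>real_of_int l\<bar>) * cmod (dft N (samp N f) l) \<le> (2 * \<bar>real_of_int l\<bar>) * (8 * B / \<bar>real_of_int l\<bar> ^ 3)"
      using l1 c by (intro mult_mono) auto
    also have "\<dots> = 16 * B / (\<bar>real_of_int l\<bar>)\<^sup>2"
      using l1 by (simp add: power2_eq_square power3_eq_cube)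
    finally show ?thesis by simp
  qed
  have "wsum N (dft N (samp N f)) = cmod (dft N (samp N f) 0)
      + (\<Sum>l\<in>grid N - {0}. (1 + \<bar>real_of_int l\<bar>) * cmod (dft N (samp N f) l))"
    unfolding wsum_def by (subst sum.remove[OF finite_grid N2]) simp
  also have "\<dots> \<le> B + (\<Sum>l\<in>grid N - {0}. 16 * B * (1 / (real_of_int l)\<^sup>2))"
    by (intro add_mono z sum_mono nz) auto
  also have "\<dots> = B + 16 * B * (\<Sum>l\<in>grid N - {0}. 1 / (real_of_int l)\<^sup>2)"
    by (simp add: sum_distrib_left)
  also have "\<dots> \<le> B + 16 * B * 4"
    using B by (intro add_left_mono mult_left_mono sum_inverse_squares) auto
  finally show ?thesis by simp
qed

lemma norm_power_diff_le:
  fixes a b :: complex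
  assumes "cmod a \<le> R" "cmod b \<le> R"
  shows "cmod (a ^ d - b ^ d) \<le> real d * R ^ (d - 1) * cmod (a - b)"
proof (cases d)
  case (Suc e)
  have R: "0 \<le> R" using assms(1) norm_ge_zero order_trans by blast
  have "a ^ Suc e - b ^ Suc e = (a - b) * (\<Sum>p<Suc e. a ^ p * b ^ (e - p))"
    by (rule diff_power_eq_sum)
  moreover have "cmod (\<Sum>p<Suc e. a ^ p * b ^ (e - p)) \<le> (\<Sum>p<Suc e. R ^ e)"
  proof (rule order_trans[OF norm_sum sum_mono])
    fix p assume "p \<in> {..<Suc e}"
    then have "R ^ e = R ^ p * R ^ (e - p)" by (simp flip: power_add)
    moreover have "cmod (a ^ p * b ^ (e - p)) \<le> R ^ p * R ^ (e - p)"
      unfolding norm_mult norm_power using assms R by (intro mult_mono power_mono) auto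
    ultimately show "cmod (a ^ p * b ^ (e - p)) \<le> R ^ e" by simp
  qed
  ultimately have "cmod (a ^ Suc e - b ^ Suc e) \<le> cmod (a - b) * (real (Suc e) * R ^ e)"
    by (simp add: norm_mult mult_left_mono)
  then show ?thesis using Suc by (simp add: mult_ac)
qed simp

lemma norm_cis_linear: "cmod (cis x - 1) \<le> \<bar>x\<bar>" "cmod (cis x - 1 - \<i> * of_real x) \<le> x\<^sup>2"
proof -
  show "cmod (cis x - 1) \<le> \<bar>x\<bar>"
    using Taylor_exp[of "\<i> * of_real x" 0] by (simp add: cis_conv_exp norm_mult)
  have "cmod (cis x - (1 + \<i> * of_real x)) \<le> x\<^sup>2"
    using Taylor_exp[of "\<i> * of_real x" 1] by (simp add: cis_conv_exp norm_mult power2_eq_square)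
  then show "cmod (cis x - 1 - \<i> * of_real x) \<le> x\<^sup>2" by (simp add: algebra_simps)
qed

definition spec :: "nat \<Rightarrow> nat \<Rightarrow> (real \<Rightarrow> real) \<Rightarrow> int \<Rightarrow> complex" where
  "spec N d f m = (\<i> * of_int m) ^ d * dft N (samp N f) m"

text \<open>
  For a fixed smooth function the spectral derivative on the grid of size \<open>N\<close> tends to the derivative,
  because both are close to a difference quotient with step \<open>2 \<pi> / N\<close>. The first order rate is far from
  optimal, but it identifies the limit.
\<close>

lemma spec_sup_error:
  assumes N: "even N" "N > 0" and per: "per2pi (D 0)"
    and D: "\<And>i x. i < d + 3 \<Longrightarrow> (D i has_real_derivative D (Suc i) x) (at x)"
    and B: "\<And>x. \<bar>D (Suc d) x\<bar> \<le> B" "\<And>x. \<bar>D (d + 3) x\<bar> \<le> B"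
    and k: "k \<in> grid N"
  shows "cmod (samp N (D d) k - idft N (spec N d (D 0)) k) \<le> (4 * real d * 2 ^ (d + 3) + real d) * B * mesh N"
proof -
  define h where "h = mesh N"
  have h: "h > 0" using mesh_pos N by (simp add: h_def)
  have B0: "0 \<le> B" using B(1)[of 0] by linarith
  define q where "q = dft N (samp N (D 0))"
  define Q where "Q x = (fdiff h ^^ d) (D 0) x / h ^ d" for x
  have decay: "\<bar>of_int m\<bar> ^ (d + 3) * cmod (q m) \<le> 2 ^ (d + 3) * B" if m: "m \<in> grid N" for m
  proof -
    have b: "cmod (samp N ((fdiff h ^^ (d + 3)) (D 0)) j) \<le> B * h ^ (d + 3)" for j
    proof -
      obtain \<xi> where "(fdiff h ^^ (d + 3)) (D 0) (gridpt N j) = h ^ (d + 3) * D (d + 3) \<xi>"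
        using fdiff_pow_mvt[OF h, of "d + 3" D "gridpt N j"] D by blast
      then have "cmod (samp N ((fdiff h ^^ (d + 3)) (D 0)) j) = \<bar>D (d + 3) \<xi>\<bar> * h ^ (d + 3)"
        unfolding samp_def norm_of_real using h by (simp add: abs_mult)
      also have "\<dots> \<le> B * h ^ (d + 3)" using B(2)[of \<xi>] h by (intro mult_right_mono) auto
      finally show ?thesis .
    qed
    have "cmod (of_int m ^ (d + 3) * q m) \<le> (2 / h) ^ (d + 3) * (B * h ^ (d + 3))"
      unfolding q_def h_def using h h_def
      by (intro order_trans[OF norm_power_dft_le[OF N m per]] mult_left_mono norm_dft_sup[OF N] b[unfolded h_def]) auto
    also have "\<dots> = 2 ^ (d + 3) * B" using h by (simp add: power_divide)
    finally show ?thesis by (simp add: norm_mult norm_power)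
  qed
  obtain \<xi> where \<xi>: "gridpt N k \<le> \<xi>" "\<xi> \<le> gridpt N k + real d * h"
      "(fdiff h ^^ d) (D 0) (gridpt N k) = h ^ d * D d \<xi>"
    using fdiff_pow_mvt[OF h, of d D "gridpt N k"] D by auto
  have "norm (D d (gridpt N k) - D d \<xi>) \<le> B * norm (gridpt N k - \<xi>)"
    by (rule field_differentiable_bound[of UNIV "D d" "D (Suc d)"]) (use D B in auto)
  also have "\<dots> \<le> B * (real d * h)" using \<xi> B0 by (intro mult_left_mono) auto
  finally have 1: "\<bar>D d (gridpt N k) - Q (gridpt N k)\<bar> \<le> real d * B * h"
    using \<xi>(3) h by (simp add: Q_def mult_ac)
  have "of_real (Q (gridpt N k)) = samp N ((fdiff h ^^ d) (D 0)) k / of_real (h ^ d)"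
    by (simp add: Q_def samp_def)
  also have "samp N ((fdiff h ^^ d) (D 0)) k = (\<Sum>m\<in>grid N. (wave N m - 1) ^ d * q m * wave N (m * k))"
    using idft_dft[OF N k, of "samp N ((fdiff h ^^ d) (D 0))"]
    by (simp add: idft_wave dft_samp_fdiff_pow[OF N per] h_def q_def)
  finally have Q: "of_real (Q (gridpt N k)) = (\<Sum>m\<in>grid N. ((wave N m - 1) / of_real h) ^ d * q m * wave N (m * k))"
    by (simp add: sum_divide_distrib power_divide)
  have "cmod (of_real (Q (gridpt N k)) - idft N (spec N d (D 0)) k)
      = cmod (\<Sum>m\<in>grid N. (((wave N m - 1) / of_real h) ^ d - (\<i> * of_int m) ^ d) * q m * wave N (m * k))"
    unfolding Q idft_wave spec_def q_def[symmetric]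
    by (simp add: algebra_simps sum_subtractf)
  also have "\<dots> \<le> (\<Sum>m\<in>grid N. cmod (((wave N m - 1) / of_real h) ^ d - (\<i> * of_int m) ^ d) * cmod (q m))"
    by (rule order_trans[OF norm_sum]) (simp add: norm_mult)
  also have "\<dots> \<le> (\<Sum>m\<in>grid N - {0}. real d * 2 ^ (d + 3) * B * h * (1 / (real_of_int m)\<^sup>2))"
  proof -
    have "(\<Sum>m\<in>grid N. cmod (((wave N m - 1) / of_real h) ^ d - (\<i> * of_int m) ^ d) * cmod (q m))
       = (\<Sum>m\<in>grid N - {0}. cmod (((wave N m - 1) / of_real h) ^ d - (\<i> * of_int m) ^ d) * cmod (q m))"
      by (rule sum.mono_neutral_right) (auto split: if_splits)
    also have "\<dots> \<le> (\<Sum>m\<in>grid N - {0}. real d * 2 ^ (d + 3) * B * h * (1 / (real_of_int m)\<^sup>2))"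
    proof (rule sum_mono)
      fix m assume m: "m \<in> grid N - {0}"
      define x where "x = of_int m * h"
      have m1: "\<bar>real_of_int m\<bar> > 0" using m by simp
      have w: "wave N m = cis x" by (simp add: wave_def x_def h_def)
      have "cmod (wave N m - 1) \<le> \<bar>of_int m\<bar> * h" using norm_cis_linear(1)[of x] h by (simp add: w x_def abs_mult)
      then have a: "cmod ((wave N m - 1) / of_real h) \<le> \<bar>of_int m\<bar>"
        using h by (simp add: norm_divide field_simps)
      have b: "cmod (\<i> * of_int m) \<le> \<bar>of_int m\<bar>" by (simp add: norm_mult)
      have "cmod ((wave N m - 1) / of_real h - \<i> * of_int m) = cmod (cis x - 1 - \<i> * of_real x) / h"
      proof -
        have "(wave N m - 1) / of_real h - \<i> * of_int m = (cis x - 1 - \<i> * of_real x) / of_real h"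
          using h by (simp add: w x_def field_simps)
        then show ?thesis using h by (simp add: norm_divide)
      qed
      also have "\<dots> \<le> x\<^sup>2 / h" using norm_cis_linear(2)[of x] h by (intro divide_right_mono) auto
      also have "\<dots> = \<bar>of_int m\<bar>\<^sup>2 * h" using h by (simp add: x_def power2_eq_square)
      finally have c: "cmod ((wave N m - 1) / of_real h - \<i> * of_int m) \<le> \<bar>of_int m\<bar>\<^sup>2 * h" .
      have "cmod (((wave N m - 1) / of_real h) ^ d - (\<i> * of_int m) ^ d)
          \<le> real d * \<bar>of_int m\<bar> ^ (d - 1) * (\<bar>of_int m\<bar>\<^sup>2 * h)"
        by (rule order_trans[OF norm_power_diff_le[OF a b] mult_left_mono[OF c]]) simp
      also have "\<dots> = real d * \<bar>of_int m\<bar> ^ (d + 1) * h"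
        by (cases d) (simp_all add: power2_eq_square)
      finally have e: "cmod (((wave N m - 1) / of_real h) ^ d - (\<i> * of_int m) ^ d) \<le> real d * \<bar>of_int m\<bar> ^ (d + 1) * h" .
      have "cmod (((wave N m - 1) / of_real h) ^ d - (\<i> * of_int m) ^ d) * cmod (q m)
          \<le> real d * \<bar>of_int m\<bar> ^ (d + 1) * h * cmod (q m)"
        by (rule mult_right_mono[OF e]) simp
      also have "\<dots> = real d * h * (\<bar>of_int m\<bar> ^ (d + 3) * cmod (q m)) * (1 / (real_of_int m)\<^sup>2)"
        using m1 by (simp add: power_add power2_eq_square power3_eq_cube)
      also have "\<dots> \<le> real d * h * (2 ^ (d + 3) * B) * (1 / (real_of_int m)\<^sup>2)"
        using h m by (intro mult_right_mono mult_left_mono decay) auto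
      finally show "cmod (((wave N m - 1) / of_real h) ^ d - (\<i> * of_int m) ^ d) * cmod (q m)
          \<le> real d * 2 ^ (d + 3) * B * h * (1 / (real_of_int m)\<^sup>2)" by (simp add: mult_ac)
    qed
    finally show ?thesis .
  qed
  also have "\<dots> = real d * 2 ^ (d + 3) * B * h * (\<Sum>m\<in>grid N - {0}. 1 / (real_of_int m)\<^sup>2)"
    by (simp add: sum_distrib_left)
  also have "\<dots> \<le> real d * 2 ^ (d + 3) * B * h * 4"
    using B0 h by (intro mult_left_mono sum_inverse_squares) auto
  finally have 2: "cmod (of_real (Q (gridpt N k)) - idft N (spec N d (D 0)) k) \<le> 4 * real d * 2 ^ (d + 3) * B * h"
    by (simp add: mult_ac)
  have "samp N (D d) k - idft N (spec N d (D 0)) k = of_real (D d (gridpt N k) - Q (gridpt N k))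
      + (of_real (Q (gridpt N k)) - idft N (spec N d (D 0)) k)" by (simp add: samp_def)
  then have "cmod (samp N (D d) k - idft N (spec N d (D 0)) k)
      \<le> \<bar>D d (gridpt N k) - Q (gridpt N k)\<bar> + cmod (of_real (Q (gridpt N k)) - idft N (spec N d (D 0)) k)"
    by (metis norm_of_real norm_triangle_ineq)
  also have "\<dots> \<le> real d * B * h + 4 * real d * 2 ^ (d + 3) * B * h" by (rule add_mono[OF 1 2])
  finally show ?thesis by (simp add: h_def algebra_simps)
qed

lemma gridpt_refine: "J > 0 \<Longrightarrow> N > 0 \<Longrightarrow> gridpt N k = gridpt (J * N) (int J * k)"
  by (simp add: gridpt_def mesh_def)

lemma wave_refine: "J > 0 \<Longrightarrow> N > 0 \<Longrightarrow> wave (J * N) (int J * a) = wave N a"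
  by (simp add: wave_def mesh_def)

lemma grid_refine:
  assumes "even N" "N > 0" "J > 0" "k \<in> grid N"
  shows "int J * k \<in> grid (J * N)"
proof -
  have k: "- int N < 2 * k" "2 * k \<le> int N" using assms by (simp_all add: mem_grid)
  have "int J * (- int N) < int J * (2 * k)" "int J * (2 * k) \<le> int J * int N"
    using k assms(3) by (simp_all only: mult_less_cancel_left_pos mult_le_cancel_left_pos of_nat_0_less_iff)
  then show ?thesis using assms by (simp add: mem_grid algebra_simps)
qed

text \<open>Aliasing: on a coarse grid the wave numbers of one residue class add up.\<close>

lemma dft_alias:
  assumes N: "even N" "N > 0" and J: "J > 0"
  shows "dft N (\<lambda>k. idft (J * N) c (int J * k)) m = (\<Sum>q\<in>{q \<in> grid (J * N). int N dvd q - m}. c q)"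
proof -
  have "dft N (\<lambda>k. idft (J * N) c (int J * k)) m
      = (\<Sum>k\<in>grid N. \<Sum>q\<in>grid (J * N). c q * wave N ((q - m) * k)) / of_nat N"
  proof -
    have "wave (J * N) (q * (int J * k)) * wave N (- (m * k)) = wave N ((q - m) * k)" for q k
    proof -
      have "wave (J * N) (q * (int J * k)) = wave N (q * k)"
        using wave_refine[OF J N(2), of "q * k"] by (simp add: mult_ac)
      then show ?thesis by (simp add: left_diff_distrib flip: wave_add)
    qed
    then show ?thesis unfolding dft_wave idft_wave sum_distrib_right by (simp add: mult.assoc)
  qed
  also have "(\<Sum>k\<in>grid N. \<Sum>q\<in>grid (J * N). c q * wave N ((q - m) * k))
      = (\<Sum>q\<in>grid (J * N). c q * (\<Sum>k\<in>grid N. wave N ((q - m) * k)))"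
    by (subst sum.swap) (simp add: sum_distrib_left)
  also have "\<dots> = (\<Sum>q\<in>grid (J * N). if int N dvd q - m then c q * of_nat N else 0)"
    by (intro sum.cong refl) (simp add: sum_wave N)
  also have "\<dots> = (\<Sum>q\<in>{q \<in> grid (J * N). int N dvd q - m}. c q) * of_nat N"
    by (simp add: sum.If_cases Int_def sum_distrib_right)
  finally show ?thesis using N by simp
qed

lemma sum_residue_classes:
  fixes \<phi> :: "int \<Rightarrow> real"
  assumes N: "even N" "N > 0" and "finite S"
  shows "(\<Sum>m\<in>grid N. \<Sum>q\<in>{q \<in> S. int N dvd q - m}. \<phi> q) = (\<Sum>q\<in>S. \<phi> q)"
proof -
  have "(\<Sum>m\<in>grid N. \<Sum>q\<in>{q \<in> S. int N dvd q - m}. \<phi> q)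
      = (\<Sum>m\<in>grid N. \<Sum>q\<in>S. if int N dvd q - m then \<phi> q else 0)"
    using assms(3) by (simp add: sum.If_cases Int_def)
  also have "\<dots> = (\<Sum>q\<in>S. \<Sum>m\<in>grid N. if int N dvd q - m then \<phi> q else 0)" by (rule sum.swap)
  also have "\<dots> = (\<Sum>q\<in>S. \<Sum>m\<in>grid N. if m = rep N q then \<phi> q else 0)"
    using rep_eq[OF N] rep_dvd by (intro sum.cong refl if_cong) auto
  also have "\<dots> = (\<Sum>q\<in>S. \<phi> q)" using rep_grid[OF N] by simp
  finally show ?thesis .
qed

text \<open>
  A nontrivial alias \<open>q = m + N p\<close> satisfies \<open>\<bar>q\<bar> \<ge> \<bar>p\<bar> N / 2\<close>, so that the sum is dominated by
  \<open>\<Sum> p\<^sup>-\<^sup>2\<close>.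
\<close>

lemma alias_tail:
  assumes N: "even N" "N > 0" and m: "m \<in> grid N" and S: "finite S" and a: "a \<ge> 1"
  shows "(\<Sum>q\<in>{q \<in> S. int N dvd q - m} - {m}. (1 / \<bar>real_of_int q\<bar> ^ a)\<^sup>2) \<le> 4 * ((2 / real N) ^ a)\<^sup>2"
    "q \<noteq> m \<Longrightarrow> int N dvd q - m \<Longrightarrow> \<bar>m\<bar> \<le> \<bar>q\<bar> \<and> q \<noteq> 0"
proof -
  have b: "- int N < 2 * m" "2 * m \<le> int N" using m N by (simp_all add: mem_grid)
  have key: "\<bar>p\<bar> * int N \<le> 2 * \<bar>q\<bar>" if "q = m + int N * p" "p \<noteq> 0" for p q
  proof -
    have "2 * \<bar>int N * p\<bar> \<le> 2 * \<bar>q\<bar> + 2 * \<bar>m\<bar>" using that by linarith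
    also have "2 * \<bar>m\<bar> \<le> int N" using b by linarith
    also have "int N \<le> \<bar>int N * p\<bar>"
      using mult_left_mono[of 1 "\<bar>p\<bar>" "int N"] that by (simp add: abs_mult)
    finally show ?thesis by (simp add: abs_mult mult.commute)
  qed
  show "\<bar>m\<bar> \<le> \<bar>q\<bar> \<and> q \<noteq> 0" if q: "q \<noteq> m" "int N dvd q - m"
  proof -
    obtain p where p: "q - m = int N * p" using q(2) by (rule dvdE)
    have p0: "p \<noteq> 0" using p q(1) by auto
    have "int N \<le> \<bar>p\<bar> * int N" using mult_right_mono[of 1 "\<bar>p\<bar>" "int N"] p0 by simp
    then have "int N \<le> 2 * \<bar>q\<bar>" using key[of q p] p p0 by simp
    then show ?thesis using b N by auto
  qed
  define A where "A = {q \<in> S. int N dvd q - m} - {m}"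
  define f where "f q = (q - m) div int N" for q
  have f: "q = m + int N * f q" "f q \<noteq> 0" if "q \<in> A" for q
  proof -
    show e: "q = m + int N * f q" using that by (simp add: A_def f_def)
    show "f q \<noteq> 0"
    proof
      assume "f q = 0"
      then show False using e that by (simp add: A_def)
    qed
  qed
  have inj: "inj_on f A" by (rule inj_onI) (metis f(1))
  have "(\<Sum>q\<in>A. (1 / \<bar>real_of_int q\<bar> ^ a)\<^sup>2) \<le> (\<Sum>q\<in>A. ((2 / real N) ^ a)\<^sup>2 * (1 / (real_of_int (f q))\<^sup>2))"
  proof (rule sum_mono)
    fix q assume q: "q \<in> A"
    have "real_of_int (\<bar>f q\<bar> * int N) \<le> real_of_int (2 * \<bar>q\<bar>)"
      unfolding of_int_le_iff by (rule key[OF f[OF q]])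
    then have k: "\<bar>real_of_int (f q)\<bar> * (real N / 2) \<le> \<bar>real_of_int q\<bar>" by simp
    have f1: "\<bar>real_of_int (f q)\<bar> \<ge> 1" using f(2)[OF q] by linarith
    have "0 < \<bar>real_of_int (f q)\<bar> * (real N / 2)" using f1 N by (intro mult_pos_pos) auto
    then have q1: "0 < \<bar>real_of_int q\<bar>" using k by linarith
    have "\<bar>real_of_int (f q)\<bar> * (real N / 2) ^ a \<le> \<bar>real_of_int (f q)\<bar> ^ a * (real N / 2) ^ a"
      using self_le_power[OF f1, of a] a by (intro mult_right_mono) auto
    also have "\<dots> = (\<bar>real_of_int (f q)\<bar> * (real N / 2)) ^ a" by (simp only: power_mult_distrib)
    also have "\<dots> \<le> \<bar>real_of_int q\<bar> ^ a" using k by (intro power_mono) auto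
    finally have "1 / \<bar>real_of_int q\<bar> ^ a \<le> 1 / (\<bar>real_of_int (f q)\<bar> * (real N / 2) ^ a)"
      using f1 N q1 by (intro divide_left_mono mult_pos_pos zero_less_power) auto
    also have "\<dots> = (2 / real N) ^ a * (1 / \<bar>real_of_int (f q)\<bar>)" by (simp add: power_divide)
    finally have "(1 / \<bar>real_of_int q\<bar> ^ a)\<^sup>2 \<le> ((2 / real N) ^ a * (1 / \<bar>real_of_int (f q)\<bar>))\<^sup>2"
      by (intro power_mono) auto
    then show "(1 / \<bar>real_of_int q\<bar> ^ a)\<^sup>2 \<le> ((2 / real N) ^ a)\<^sup>2 * (1 / (real_of_int (f q))\<^sup>2)"
      by (simp only: power_mult_distrib power_one_over power2_abs)
  qed
  also have "\<dots> = ((2 / real N) ^ a)\<^sup>2 * (\<Sum>p\<in>f ` A. 1 / (real_of_int p)\<^sup>2)"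
    using inj by (simp add: sum.reindex sum_distrib_left)
  also have "\<dots> \<le> ((2 / real N) ^ a)\<^sup>2 * 4"
  proof (intro mult_left_mono sum_inverse_squares)
    show "finite (f ` A)" using S by (simp add: A_def)
    show "0 \<notin> f ` A" using f(2) by fastforce
  qed simp
  finally show "(\<Sum>q\<in>{q \<in> S. int N dvd q - m} - {m}. (1 / \<bar>real_of_int q\<bar> ^ a)\<^sup>2) \<le> 4 * ((2 / real N) ^ a)\<^sup>2"
    by (simp add: A_def mult.commute)
qed

text \<open>
  The grid is compared with a refinement by a factor \<open>J\<close>, on which the spectral derivative tends to the
  derivative as \<open>J \<rightarrow> \<infinity>\<close>. The difference between the two grids consists of the aliased wave numbers
  \<open>q \<noteq> m\<close>, all of modulus at least \<open>N / 2\<close>, and these carry little of a smooth function.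
\<close>

lemma spectral_accuracy:
  assumes N: "even N" "N > 0" and per: "per2pi (D 0)"
    and D: "\<And>i x. i < d + 3 \<Longrightarrow> (D i has_real_derivative D (Suc i) x) (at x)"
    and B: "\<And>x. \<bar>D (Suc d) x\<bar> \<le> B" "\<And>x. \<bar>D (d + 3) x\<bar> \<le> B"
    and S: "\<And>M. even M \<Longrightarrow> M > 0 \<Longrightarrow> nrm M (\<lambda>m. of_int m ^ s * dft M (samp M (D 0)) m) \<le> R"
    and a: "s = d + a" "a \<ge> 1"
  shows "nrm N (\<lambda>m. dft N (samp N (D d)) m - spec N d (D 0) m) \<le> 4 * (2 / real N) ^ a * R"
proof -
  define K where "K = (4 * real d * 2 ^ (d + 3) + real d) * B"
  have B0: "0 \<le> B" using B(1)[of 0] by linarith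
  have K0: "0 \<le> K" using B0 by (simp add: K_def)
  have R0: "0 \<le> R" using S[OF N] nrm_nonneg order_trans by blast
  have fine: "nrm N (\<lambda>m. dft N (samp N (D d)) m - spec N d (D 0) m)
      \<le> K * mesh (J * N) + 4 * (2 / real N) ^ a * R" if J: "J > 0" for J
  proof -
    define M where "M = J * N"
    have M: "even M" "M > 0" using N J by (simp_all add: M_def)
    define c where "c = dft M (samp M (D 0))"
    define Cl where "Cl m = {q \<in> grid M. int N dvd q - m}" for m
    define r where "r k = samp M (D d) (int J * k) - idft M (spec M d (D 0)) (int J * k)" for k
    have sampN: "samp N f k = samp M f (int J * k)" for f k
      using gridpt_refine[OF J N(2)] by (simp add: samp_def M_def)
    have rb: "cmod (r k) \<le> K * mesh M" if "k \<in> grid N" for k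
      unfolding r_def K_def
      by (rule spec_sup_error[OF M per D B]) (use grid_refine[OF N J that] in \<open>auto simp: M_def\<close>)
    have cN: "dft N (samp N (D 0)) m = (\<Sum>q\<in>Cl m. c q)" for m
    proof -
      have "dft N (samp N (D 0)) m = dft N (\<lambda>k. idft M c (int J * k)) m"
      proof (rule dft_cong)
        fix k assume k: "k \<in> grid N"
        show "samp N (D 0) k = idft M c (int J * k)"
          using idft_dft[OF M, of "int J * k" "samp M (D 0)"] grid_refine[OF N J k]
          by (simp add: sampN c_def M_def)
      qed
      then show ?thesis using dft_alias[OF N J, of c m] by (simp add: Cl_def M_def)
    qed
    have dN: "dft N (samp N (D d)) m = dft N r m + (\<Sum>q\<in>Cl m. (\<i> * of_int q) ^ d * c q)" for m
    proof -
      have "samp N (D d) = (\<lambda>k. r k + idft M (spec M d (D 0)) (int J * k))"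
        by (rule ext) (simp add: r_def sampN)
      then have "dft N (samp N (D d)) m = dft N r m + dft N (\<lambda>k. idft M (spec M d (D 0)) (int J * k)) m"
        by (simp add: dft_add)
      then show ?thesis using dft_alias[OF N J, of "spec M d (D 0)" m]
        by (simp add: Cl_def M_def spec_def c_def)
    qed
    define e where "e m = (\<Sum>q\<in>Cl m. ((\<i> * of_int q) ^ d - (\<i> * of_int m) ^ d) * c q)" for m
    have split: "dft N (samp N (D d)) m - spec N d (D 0) m = dft N r m + e m" for m
      by (simp add: dN spec_def cN e_def sum_distrib_left left_diff_distrib sum_subtractf)
    have "(nrm N e)\<^sup>2 \<le> (\<Sum>m\<in>grid N. 16 * ((2 / real N) ^ a)\<^sup>2 * (\<Sum>q\<in>Cl m. (cmod (of_int q ^ s * c q))\<^sup>2))"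
      unfolding nrm_sq
    proof (rule sum_mono)
      fix m assume m: "m \<in> grid N"
      have fin: "finite (Cl m)" by (simp add: Cl_def)
      note tail = alias_tail[OF N m finite_grid[of M] a(2)]
      have "cmod (e m) \<le> (\<Sum>q\<in>Cl m. cmod (((\<i> * of_int q) ^ d - (\<i> * of_int m) ^ d) * c q))"
        unfolding e_def by (rule norm_sum)
      also have "\<dots> = (\<Sum>q\<in>Cl m - {m}. cmod (((\<i> * of_int q) ^ d - (\<i> * of_int m) ^ d) * c q))"
        using fin by (intro sum.mono_neutral_right) auto
      also have "\<dots> \<le> (\<Sum>q\<in>Cl m - {m}. \<bar>2 / \<bar>of_int q\<bar> ^ a\<bar> * \<bar>cmod (of_int q ^ s * c q)\<bar>)"
      proof (rule sum_mono)
        fix q assume q: "q \<in> Cl m - {m}"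
        then have mq: "\<bar>m\<bar> \<le> \<bar>q\<bar>" "q \<noteq> 0" using tail(2)[of q] by (auto simp: Cl_def)
        have q1: "\<bar>real_of_int q\<bar> > 0" using mq by simp
        have "real_of_int \<bar>m\<bar> \<le> real_of_int \<bar>q\<bar>" using mq(1) by (simp only: of_int_le_iff)
        then have "\<bar>real_of_int m\<bar> ^ d \<le> \<bar>real_of_int q\<bar> ^ d" by (intro power_mono) auto
        then have "cmod ((\<i> * of_int q) ^ d - (\<i> * of_int m) ^ d) \<le> 2 * \<bar>of_int q\<bar> ^ d"
          by (intro order_trans[OF norm_triangle_ineq4]) (simp add: norm_power norm_mult)
        then have "cmod (((\<i> * of_int q) ^ d - (\<i> * of_int m) ^ d) * c q) \<le> 2 * \<bar>of_int q\<bar> ^ d * cmod (c q)"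
          by (simp add: norm_mult mult_right_mono)
        also have "\<dots> = \<bar>2 / \<bar>of_int q\<bar> ^ a\<bar> * \<bar>cmod (of_int q ^ s * c q)\<bar>"
          using q1 by (simp add: a(1) power_add norm_mult norm_power)
        finally show "cmod (((\<i> * of_int q) ^ d - (\<i> * of_int m) ^ d) * c q)
          \<le> \<bar>2 / \<bar>of_int q\<bar> ^ a\<bar> * \<bar>cmod (of_int q ^ s * c q)\<bar>" .
      qed
      also have "\<dots> \<le> L2_set (\<lambda>q. 2 / \<bar>of_int q\<bar> ^ a) (Cl m - {m}) * L2_set (\<lambda>q. cmod (of_int q ^ s * c q)) (Cl m - {m})"
        by (rule L2_set_mult_ineq)
      finally have "(cmod (e m))\<^sup>2 \<le> (L2_set (\<lambda>q. 2 / \<bar>of_int q\<bar> ^ a) (Cl m - {m}) * L2_set (\<lambda>q. cmod (of_int q ^ s * c q)) (Cl m - {m}))\<^sup>2"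
        by (intro power_mono) auto
      also have "\<dots> = (\<Sum>q\<in>Cl m - {m}. (2 / \<bar>of_int q\<bar> ^ a)\<^sup>2) * (\<Sum>q\<in>Cl m - {m}. (cmod (of_int q ^ s * c q))\<^sup>2)"
        by (simp add: power_mult_distrib L2_set_def sum_nonneg)
      also have "(\<Sum>q\<in>Cl m - {m}. (2 / \<bar>of_int q\<bar> ^ a)\<^sup>2) = 4 * (\<Sum>q\<in>Cl m - {m}. (1 / \<bar>real_of_int q\<bar> ^ a)\<^sup>2)"
        by (simp add: sum_distrib_left power_divide)
      also have "(\<Sum>q\<in>Cl m - {m}. (1 / \<bar>real_of_int q\<bar> ^ a)\<^sup>2) \<le> 4 * ((2 / real N) ^ a)\<^sup>2"
        using tail(1) by (simp add: Cl_def)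
      also have "(\<Sum>q\<in>Cl m - {m}. (cmod (of_int q ^ s * c q))\<^sup>2) \<le> (\<Sum>q\<in>Cl m. (cmod (of_int q ^ s * c q))\<^sup>2)"
        using fin by (intro sum_mono2) auto
      finally show "(cmod (e m))\<^sup>2 \<le> 16 * ((2 / real N) ^ a)\<^sup>2 * (\<Sum>q\<in>Cl m. (cmod (of_int q ^ s * c q))\<^sup>2)"
        by (simp add: sum_nonneg mult_left_mono mult_right_mono)
    qed
    also have "\<dots> = 16 * ((2 / real N) ^ a)\<^sup>2 * (\<Sum>m\<in>grid N. \<Sum>q\<in>Cl m. (cmod (of_int q ^ s * c q))\<^sup>2)"
      by (simp add: sum_distrib_left)
    also have "(\<Sum>m\<in>grid N. \<Sum>q\<in>Cl m. (cmod (of_int q ^ s * c q))\<^sup>2) = (nrm M (\<lambda>q. of_int q ^ s * c q))\<^sup>2"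
      unfolding Cl_def nrm_sq by (rule sum_residue_classes[OF N]) simp
    also have "16 * ((2 / real N) ^ a)\<^sup>2 * \<dots> \<le> 16 * ((2 / real N) ^ a)\<^sup>2 * R\<^sup>2"
      using S[OF M] by (intro mult_left_mono power_mono) (auto simp: c_def)
    also have "\<dots> = (4 * (2 / real N) ^ a * R)\<^sup>2" by (simp add: power_mult_distrib)
    finally have ne: "nrm N e \<le> 4 * (2 / real N) ^ a * R"
      by (rule power2_le_imp_le) (use R0 in simp)
    have nr: "nrm N (dft N r) \<le> K * mesh M"
      by (rule nrm_dft_sup[OF N]) (use rb K0 mesh_pos[OF M(2)] in auto)
    have "nrm N (\<lambda>m. dft N r m + e m) \<le> K * mesh M + 4 * (2 / real N) ^ a * R"
      using nrm_triangle[of N "dft N r" e] ne nr by linarith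
    then show ?thesis by (simp add: split M_def)
  qed
  have "(\<lambda>J. K * mesh (Suc J * N) + 4 * (2 / real N) ^ a * R) \<longlonglongrightarrow> K * 0 + 4 * (2 / real N) ^ a * R"
  proof (intro tendsto_intros)
    have "(\<lambda>J. (2 * pi / real N) * (1 / real (Suc J))) \<longlonglongrightarrow> (2 * pi / real N) * 0"
      by (intro tendsto_intros LIMSEQ_inverse_real_of_nat[unfolded inverse_eq_divide])
    then show "(\<lambda>J. mesh (Suc J * N)) \<longlonglongrightarrow> 0"
      by (simp add: mesh_def algebra_simps)
  qed
  then have "nrm N (\<lambda>m. dft N (samp N (D d)) m - spec N d (D 0) m) \<le> K * 0 + 4 * (2 / real N) ^ a * R"
    by (rule LIMSEQ_le_const) (use fine in blast)
  then show ?thesis by simp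
qed

section \<open>Regularity of the exact solution in time\<close>

text \<open>The mean value inequality for grid functions, by duality with the increment itself.\<close>

lemma nrm_mvt:
  fixes V V' :: "real \<Rightarrow> int \<Rightarrow> complex"
  assumes ab: "a \<le> b" and K: "0 \<le> K"
    and d: "\<And>m s. m \<in> grid N \<Longrightarrow> s \<in> {a..b} \<Longrightarrow> ((\<lambda>s. V s m) has_vector_derivative V' s m) (at s within {a..b})"
    and b: "\<And>s. s \<in> {a..b} \<Longrightarrow> nrm N (V' s) \<le> K"
  shows "nrm N (\<lambda>m. V b m - V a m) \<le> K * (b - a)"
proof -
  define y where "y m = V b m - V a m" for m
  define \<phi> where "\<phi> s = Re (ip N (V s) y)" for s
  have d\<phi>: "(\<phi> has_vector_derivative Re (ip N (V' s) y)) (at s within {a..b})" if "s \<in> {a..b}" for s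
  proof -
    have "((\<lambda>s. ip N (V s) y) has_vector_derivative ip N (V' s) y) (at s within {a..b})"
      unfolding ip_def by (intro has_vector_derivative_sum has_vector_derivative_mult_left d that)
    from bounded_linear.has_vector_derivative[OF bounded_linear_Re this] show ?thesis
      by (simp add: \<phi>_def[abs_def])
  qed
  have "norm (\<phi> b - \<phi> a) \<le> (K * nrm N y) * norm (b - a)"
  proof (rule field_differentiable_bound[of "{a..b}" \<phi> "\<lambda>s. Re (ip N (V' s) y)"])
    fix s assume s: "s \<in> {a..b}"
    show "(\<phi> has_field_derivative Re (ip N (V' s) y)) (at s within {a..b})"
      using d\<phi>[OF s] by (simp add: has_real_derivative_iff_has_vector_derivative)
    have "\<bar>Re (ip N (V' s) y)\<bar> \<le> nrm N (V' s) * nrm N y" by (rule Re_ip_le)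
    also have "\<dots> \<le> K * nrm N y" using b[OF s] by (intro mult_right_mono) auto
    finally show "norm (Re (ip N (V' s) y)) \<le> K * nrm N y" by simp
  qed (use ab in auto)
  moreover have "\<phi> b - \<phi> a = (nrm N y)\<^sup>2"
  proof -
    have "ip N (V b) y - ip N (V a) y = ip N y y"
      by (simp add: ip_def y_def left_diff_distrib sum_subtractf)
    then show ?thesis by (metis Re_ip_self \<phi>_def minus_complex.sel(1))
  qed
  ultimately have "nrm N y * nrm N y \<le> nrm N y * (K * (b - a))"
    using ab by (simp add: power2_eq_square mult_ac)
  then have "nrm N y \<le> K * (b - a)"
    using K ab by (cases "nrm N y = 0") (auto simp: less_le)
  then show ?thesis by (simp add: y_def[abs_def])
qed

text \<open>
  Difference quotients of all small steps control a derivative. This is how estimates in time pass from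
  the solution to its \<open>\<alpha>\<close>-derivatives, whose differentiability in time is not assumed.
\<close>

lemma derivative_bound_of_fdiff:
  assumes D: "\<And>j x. j \<le> i \<Longrightarrow> (E j has_real_derivative E (Suc j) x) (at x)"
    and B: "\<And>x. \<bar>E (Suc i) x\<bar> \<le> B"
    and A: "\<And>\<epsilon> x. \<epsilon> > 0 \<Longrightarrow> \<bar>(fdiff \<epsilon> ^^ i) (E 0) x\<bar> \<le> A * \<epsilon> ^ i"
  shows "\<bar>E i x\<bar> \<le> A"
proof (rule field_le_epsilon)
  fix e :: real assume e: "e > 0"
  have B0: "0 \<le> B" using B[of 0] by linarith
  define \<epsilon> where "\<epsilon> = e / (B * real i + 1)"
  have den: "B * real i + 1 > 0" using B0 by (simp add: add_nonneg_pos)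
  have \<epsilon>: "\<epsilon> > 0" using e den by (simp add: \<epsilon>_def)
  obtain \<xi> where \<xi>: "x \<le> \<xi>" "\<xi> \<le> x + real i * \<epsilon>" "(fdiff \<epsilon> ^^ i) (E 0) x = \<epsilon> ^ i * E i \<xi>"
    using fdiff_pow_mvt[OF \<epsilon>, of i E x] D by auto
  have "\<bar>E i \<xi>\<bar> * \<epsilon> ^ i \<le> A * \<epsilon> ^ i" using A[OF \<epsilon>, of x] \<epsilon> by (simp add: \<xi>(3) abs_mult mult.commute)
  then have 1: "\<bar>E i \<xi>\<bar> \<le> A" using \<epsilon> by simp
  have "norm (E i x - E i \<xi>) \<le> B * norm (x - \<xi>)"
    by (rule field_differentiable_bound[of UNIV "E i" "E (Suc i)"]) (use D B in auto)
  also have "\<dots> \<le> B * (real i * \<epsilon>)" using \<xi> B0 by (intro mult_left_mono) auto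
  also have "\<dots> = (B * real i) * e / (B * real i + 1)" by (simp add: \<epsilon>_def)
  also have "\<dots> \<le> e" using e den by (simp add: divide_le_eq algebra_simps)
  finally show "\<bar>E i x\<bar> \<le> A + e" using 1 by simp
qed

text \<open>
  A solution with its \<open>\<alpha>\<close>-derivatives \<open>D t i\<close>. The function \<open>\<theta>\<close> itself is not bounded by \<open>B\<close>, only its
  derivatives are, and the factor \<open>m\<^sup>9\<close> removes the mean from the discrete coefficients. Hence \<open>B\<close> can be
  chosen in terms of the curvature.
\<close>

locale flow =
  fixes T c B :: real and \<theta> :: "real \<Rightarrow> real \<Rightarrow> real" and D :: "real \<Rightarrow> nat \<Rightarrow> real \<Rightarrow> real"
  assumes c: "c > 0" and B: "B \<ge> 0"
    and D0: "t \<in> {0..T} \<Longrightarrow> D t 0 = (\<lambda>x. \<theta> x t)"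
    and per: "t \<in> {0..T} \<Longrightarrow> i \<le> 8 \<Longrightarrow> per2pi (D t i)"
    and der: "t \<in> {0..T} \<Longrightarrow> i \<le> 7 \<Longrightarrow> (D t i has_real_derivative D t (Suc i) x) (at x)"
    and bd: "t \<in> {0..T} \<Longrightarrow> 1 \<le> i \<Longrightarrow> i \<le> 8 \<Longrightarrow> \<bar>D t i x\<bar> \<le> B"
    and sob: "t \<in> {0..T} \<Longrightarrow> even N \<Longrightarrow> N > 0 \<Longrightarrow> nrm N (\<lambda>m. of_int m ^ 9 * dft N (samp N (D t 0)) m) \<le> B"
    and sob3: "t \<in> {0..T} \<Longrightarrow> even N \<Longrightarrow> N > 0 \<Longrightarrow> nrm N (\<lambda>m. of_int m ^ 6 * dft N (samp N (D t 3)) m) \<le> B"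
    and evol: "t \<in> {0..T} \<Longrightarrow>
      ((\<lambda>\<tau>. \<theta> x \<tau>) has_real_derivative c ^ 3 * (D t 3 x + (D t 1 x) ^ 3 / 2)) (at t within {0..T})"
begin

text \<open>
  The equation reads \<open>\<theta>\<^sub>t = \<Phi>\<close> with the nonlinear part \<open>nl\<close>, and \<open>bq\<close> is the derivative of \<open>nl\<close> with respect
  to \<open>\<theta>\<^sub>\<alpha>\<close>, the speed of the linearized advection.
\<close>

definition nl :: "real \<Rightarrow> real \<Rightarrow> real" where
  "nl t x = c ^ 3 / 2 * (D t 1 x * (D t 1 x * D t 1 x))"

definition \<Phi> :: "real \<Rightarrow> real \<Rightarrow> real" where
  "\<Phi> t x = c ^ 3 * D t 3 x + nl t x"

definition bq :: "real \<Rightarrow> real \<Rightarrow> real" where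
  "bq t x = 3 * c ^ 3 / 2 * (D t 1 x * D t 1 x)"

lemma evol': "t \<in> {0..T} \<Longrightarrow> ((\<lambda>\<tau>. \<theta> x \<tau>) has_real_derivative \<Phi> t x) (at t within {0..T})"
  using evol[of t x] by (simp add: \<Phi>_def nl_def algebra_simps power3_eq_cube)

lemma smooth_D:
  assumes "t \<in> {0..T}" "1 \<le> i" "i + s \<le> 8"
  shows "smooth_bd s B (D t i)"
  using assms
proof (induction s arbitrary: i)
  case (Suc s)
  then show ?case by (intro smooth_bd_SucI[where f' = "D t (Suc i)"] bd der Suc.IH) auto
qed (simp add: bd)

text \<open>
  The constants of all estimates are functions of \<open>c\<close> and \<open>B\<close>. They are named, not hidden in
  existential quantifiers, because the mesh restriction has to be chosen before the solution is known.
\<close>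

definition Cn where "Cn = c ^ 3 / 2 * (2 ^ 7 * (B * (2 ^ 7 * (B * B))))"
definition P0 where "P0 = c ^ 3 * B + Cn"

lemma Cn_nonneg: "0 \<le> Cn" using c B by (simp add: Cn_def)
lemma P0_nonneg: "0 \<le> P0" using c B Cn_nonneg by (simp add: P0_def)

lemma smooth_nl: "t \<in> {0..T} \<Longrightarrow> s \<le> 7 \<Longrightarrow> smooth_bd s Cn (nl t)"
proof -
  assume t: "t \<in> {0..T}" "s \<le> 7"
  have 1: "smooth_bd 7 B (D t 1)" by (rule smooth_D) (use t in auto)
  have "smooth_bd 7 (\<bar>c ^ 3 / 2\<bar> * (2 ^ 7 * (B * (2 ^ 7 * (B * B)))))
      (\<lambda>x. c ^ 3 / 2 * (D t 1 x * (D t 1 x * D t 1 x)))"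
    by (intro smooth_bd_cmult smooth_bd_mult 1)
  then have "smooth_bd 7 Cn (nl t)" using c by (simp add: Cn_def nl_def[abs_def] del: smooth_bd.simps)
  then show ?thesis by (rule smooth_bd_mono) (use t in auto)
qed

lemma smooth_\<Phi>: "t \<in> {0..T} \<Longrightarrow> s \<le> 5 \<Longrightarrow> smooth_bd s P0 (\<Phi> t)"
proof -
  assume t: "t \<in> {0..T}" "s \<le> 5"
  have "smooth_bd s (\<bar>c ^ 3\<bar> * B + Cn) (\<lambda>x. c ^ 3 * D t 3 x + nl t x)"
    by (intro smooth_bd_add smooth_bd_cmult smooth_nl smooth_D) (use t in auto)
  then show ?thesis using c by (simp add: P0_def \<Phi>_def[abs_def] del: smooth_bd.simps)
qed

lemma per_nl: "t \<in> {0..T} \<Longrightarrow> per2pi (nl t)" and per_\<Phi>: "t \<in> {0..T} \<Longrightarrow> per2pi (\<Phi> t)"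
  and per_bq: "t \<in> {0..T} \<Longrightarrow> per2pi (bq t)"
  using per[of t 1] per[of t 3] by (simp_all add: per2pi_def nl_def \<Phi>_def bq_def)

lemma fdiff_pow_evol:
  assumes "t \<in> {0..T}"
  shows "((\<lambda>s. (fdiff \<epsilon> ^^ i) (\<lambda>x. \<theta> x s) x) has_real_derivative (fdiff \<epsilon> ^^ i) (\<Phi> t) x) (at t within {0..T})"
proof (induction i arbitrary: x)
  case (Suc i)
  have e: "(fdiff \<epsilon> ^^ Suc i) f x = (fdiff \<epsilon> ^^ i) f (x + \<epsilon>) - (fdiff \<epsilon> ^^ i) f x" for f
    by (simp add: fdiff_def)
  show ?case unfolding e by (intro DERIV_diff Suc)
qed (use assms evol' in simp)

text \<open>
  Differences in \<open>\<alpha>\<close> of \<open>\<theta>\<close> can be differentiated in time, with the differences of \<open>\<Phi>\<close> as derivatives, and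
  those are bounded by the smoothness of \<open>\<Phi>\<close>.
\<close>

lemma D_lipschitz:
  assumes t: "t \<in> {0..T}" "t' \<in> {0..T}" and i: "i \<le> 5"
  shows "\<bar>D t' i x - D t i x\<bar> \<le> P0 * \<bar>t' - t\<bar>"
proof (rule derivative_bound_of_fdiff[where E = "\<lambda>i x. D t' i x - D t i x" and B = "2 * B"])
  fix j x assume "j \<le> i"
  then show "((\<lambda>x. D t' j x - D t j x) has_real_derivative D t' (Suc j) x - D t (Suc j) x) (at x)"
    using t i by (intro DERIV_diff der) auto
next
  fix x show "\<bar>D t' (Suc i) x - D t (Suc i) x\<bar> \<le> 2 * B"
    using bd[OF t(1), of "Suc i" x] bd[OF t(2), of "Suc i" x] i by linarith
next
  fix \<epsilon> x :: real assume \<epsilon>: "\<epsilon> > 0"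
  have lin: "(fdiff \<epsilon> ^^ i) (\<lambda>x. f x - g x) x = (fdiff \<epsilon> ^^ i) f x - (fdiff \<epsilon> ^^ i) g x" for f g
  proof -
    have "(fdiff \<epsilon> ^^ i) (\<lambda>x. f x - g x) = (\<lambda>x. (fdiff \<epsilon> ^^ i) f x - (fdiff \<epsilon> ^^ i) g x)"
      by (induction i) (auto simp: fdiff_def)
    then show ?thesis by simp
  qed
  have "norm ((fdiff \<epsilon> ^^ i) (\<lambda>x. \<theta> x t') x - (fdiff \<epsilon> ^^ i) (\<lambda>x. \<theta> x t) x) \<le> (P0 * \<epsilon> ^ i) * norm (t' - t)"
  proof (rule field_differentiable_bound[of "{0..T}" "\<lambda>s. (fdiff \<epsilon> ^^ i) (\<lambda>x. \<theta> x s) x" "\<lambda>s. (fdiff \<epsilon> ^^ i) (\<Phi> s) x"])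
    fix s assume s: "s \<in> {0..T}"
    show "norm ((fdiff \<epsilon> ^^ i) (\<Phi> s) x) \<le> P0 * \<epsilon> ^ i"
      using smooth_bd_fdiff_pow[OF smooth_\<Phi>[OF s i], of \<epsilon> x] \<epsilon> by simp
  qed (use fdiff_pow_evol t in auto)
  then show "\<bar>(fdiff \<epsilon> ^^ i) (\<lambda>x. D t' 0 x - D t 0 x) x\<bar> \<le> P0 * \<bar>t' - t\<bar> * \<epsilon> ^ i"
    unfolding lin D0[OF t(1)] D0[OF t(2)] by (simp add: mult_ac)
qed

lemma smooth_D_lipschitz:
  assumes t: "t \<in> {0..T}" "t' \<in> {0..T}" and "i + s \<le> 5"
  shows "smooth_bd s (P0 * \<bar>t' - t\<bar>) (\<lambda>x. D t' i x - D t i x)"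
  using assms(3)
proof (induction s arbitrary: i)
  case 0
  then show ?case using D_lipschitz[OF t] by simp
next
  case (Suc s)
  then show ?case
    using t by (intro smooth_bd_SucI[where f' = "\<lambda>x. D t' (Suc i) x - D t (Suc i) x"] D_lipschitz DERIV_diff der Suc.IH) auto
qed

definition Ln where "Ln = c ^ 3 / 2 * (2 ^ 3 * (P0 * (2 ^ 3 * (B * B) + 2 ^ 3 * (B * B) + 2 ^ 3 * (B * B))))"
definition Lb where "Lb = 3 * c ^ 3 / 2 * (2 ^ 3 * (P0 * (B + B)))"
definition Cb0 where "Cb0 = 3 * c ^ 3 / 2 * (2 ^ 3 * (B * B))"
definition P1 where "P1 = c ^ 3 * P0 + Ln"

lemma const_nonneg: "0 \<le> Ln" "0 \<le> Lb" "0 \<le> Cb0" "0 \<le> P1"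
  using c B P0_nonneg by (simp_all add: Ln_def Lb_def Cb0_def P1_def)

lemma smooth_nl_lipschitz:
  assumes t: "t \<in> {0..T}" "t' \<in> {0..T}"
  shows "smooth_bd 3 (Ln * \<bar>t' - t\<bar>) (\<lambda>x. nl t' x - nl t x)"
proof -
  have s: "smooth_bd 3 B (D t 1)" "smooth_bd 3 B (D t' 1)" by (rule smooth_D; use t in simp)+
  have A: "smooth_bd 3 (\<bar>c ^ 3 / 2\<bar> * (2 ^ 3 * ((P0 * \<bar>t' - t\<bar>) * (2 ^ 3 * (B * B) + 2 ^ 3 * (B * B) + 2 ^ 3 * (B * B)))))
    (\<lambda>x. c ^ 3 / 2 * ((D t' 1 x - D t 1 x) * (D t' 1 x * D t' 1 x + D t' 1 x * D t 1 x + D t 1 x * D t 1 x)))"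
    by (intro smooth_bd_cmult smooth_bd_mult smooth_bd_add smooth_D_lipschitz s t) simp
  have E1: "(\<lambda>x. nl t' x - nl t x) =
    (\<lambda>x. c ^ 3 / 2 * ((D t' 1 x - D t 1 x) * (D t' 1 x * D t' 1 x + D t' 1 x * D t 1 x + D t 1 x * D t 1 x)))"
    by (rule ext) (simp add: nl_def field_simps)
  have E2: "\<bar>c ^ 3 / 2\<bar> * (2 ^ 3 * ((P0 * \<bar>t' - t\<bar>) * (2 ^ 3 * (B * B) + 2 ^ 3 * (B * B) + 2 ^ 3 * (B * B)))) = Ln * \<bar>t' - t\<bar>"
    using c by (simp add: Ln_def)
  show ?thesis using A unfolding E1 E2 .
qed

lemma smooth_\<Phi>_lipschitz:
  assumes t: "t \<in> {0..T}" "t' \<in> {0..T}"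
  shows "smooth_bd 1 (P1 * \<bar>t' - t\<bar>) (\<lambda>x. \<Phi> t' x - \<Phi> t x)"
proof -
  have A: "smooth_bd 1 (\<bar>c ^ 3\<bar> * (P0 * \<bar>t' - t\<bar>) + Ln * \<bar>t' - t\<bar>)
     (\<lambda>x. c ^ 3 * (D t' 3 x - D t 3 x) + (nl t' x - nl t x))"
    by (intro smooth_bd_add smooth_bd_cmult smooth_D_lipschitz t)
       (use smooth_bd_mono[OF smooth_nl_lipschitz[OF t], of 1 "Ln * \<bar>t' - t\<bar>"] in \<open>simp_all del: smooth_bd.simps\<close>)
  have E1: "(\<lambda>x. \<Phi> t' x - \<Phi> t x) = (\<lambda>x. c ^ 3 * (D t' 3 x - D t 3 x) + (nl t' x - nl t x))"
    by (rule ext) (simp add: \<Phi>_def algebra_simps)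
  have E2: "\<bar>c ^ 3\<bar> * (P0 * \<bar>t' - t\<bar>) + Ln * \<bar>t' - t\<bar> = P1 * \<bar>t' - t\<bar>"
    using c by (simp add: P1_def algebra_simps)
  show ?thesis using A unfolding E1 E2 .
qed

lemma smooth_bq: "t \<in> {0..T} \<Longrightarrow> smooth_bd 3 Cb0 (bq t)"
proof -
  assume t: "t \<in> {0..T}"
  have s: "smooth_bd 3 B (D t 1)" by (rule smooth_D) (use t in auto)
  have "smooth_bd 3 (\<bar>3 * c ^ 3 / 2\<bar> * (2 ^ 3 * (B * B))) (\<lambda>x. 3 * c ^ 3 / 2 * (D t 1 x * D t 1 x))"
    by (intro smooth_bd_cmult smooth_bd_mult s)
  then show ?thesis using c by (simp add: Cb0_def bq_def[abs_def] del: smooth_bd.simps)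
qed

lemma smooth_bq_lipschitz:
  assumes t: "t \<in> {0..T}" "t' \<in> {0..T}"
  shows "smooth_bd 3 (Lb * \<bar>t' - t\<bar>) (\<lambda>x. bq t' x - bq t x)"
proof -
  have s: "smooth_bd 3 B (D t 1)" "smooth_bd 3 B (D t' 1)" by (rule smooth_D; use t in simp)+
  have A: "smooth_bd 3 (\<bar>3 * c ^ 3 / 2\<bar> * (2 ^ 3 * ((P0 * \<bar>t' - t\<bar>) * (B + B))))
    (\<lambda>x. 3 * c ^ 3 / 2 * ((D t' 1 x - D t 1 x) * (D t' 1 x + D t 1 x)))"
    by (intro smooth_bd_cmult smooth_bd_mult smooth_bd_add smooth_D_lipschitz s t) simp
  have E1: "(\<lambda>x. bq t' x - bq t x) = (\<lambda>x. 3 * c ^ 3 / 2 * ((D t' 1 x - D t 1 x) * (D t' 1 x + D t 1 x)))"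
    by (rule ext) (simp add: bq_def field_simps)
  have E2: "\<bar>3 * c ^ 3 / 2\<bar> * (2 ^ 3 * ((P0 * \<bar>t' - t\<bar>) * (B + B))) = Lb * \<bar>t' - t\<bar>"
    using c by (simp add: Lb_def)
  show ?thesis using A unfolding E1 E2 .
qed

text \<open>
  A difference in \<open>\<alpha>\<close> of \<open>\<theta> (t + s) + \<theta> (t - s)\<close> has as derivative in \<open>s\<close> the same difference of
  \<open>\<Phi> (t + s) - \<Phi> (t - s)\<close>, which is of first order in \<open>s\<close>.
\<close>

lemma D1_second_difference:
  assumes s: "0 \<le> s" "0 \<le> t - s" "t + s \<le> T"
  shows "\<bar>D (t + s) 1 x + D (t - s) 1 x - 2 * D t 1 x\<bar> \<le> 2 * P1 * s\<^sup>2"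
proof (rule derivative_bound_of_fdiff[where E = "\<lambda>i x. D (t + s) i x + D (t - s) i x - 2 * D t i x"
      and B = "4 * B" and i = 1])
  have ts: "t + s \<in> {0..T}" "t - s \<in> {0..T}" "t \<in> {0..T}" using s by auto
  show "((\<lambda>x. D (t + s) j x + D (t - s) j x - 2 * D t j x) has_real_derivative
      D (t + s) (Suc j) x + D (t - s) (Suc j) x - 2 * D t (Suc j) x) (at x)" if "j \<le> 1" for j x
    using ts that by (intro DERIV_diff DERIV_add DERIV_cmult der) auto
  show "\<bar>D (t + s) (Suc 1) x + D (t - s) (Suc 1) x - 2 * D t (Suc 1) x\<bar> \<le> 4 * B" for x
    using bd[OF ts(1), of 2 x] bd[OF ts(2), of 2 x] bd[OF ts(3), of 2 x] by (simp add: numeral_2_eq_2)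
  fix \<epsilon> x :: real assume \<epsilon>: "\<epsilon> > 0"
  define G where "G \<sigma> = fdiff \<epsilon> (\<lambda>x. \<theta> x (t + \<sigma>)) x + fdiff \<epsilon> (\<lambda>x. \<theta> x (t - \<sigma>)) x" for \<sigma>
  have dG: "(G has_real_derivative (fdiff \<epsilon> (\<Phi> (t + \<sigma>)) x - fdiff \<epsilon> (\<Phi> (t - \<sigma>)) x)) (at \<sigma> within {0..s})"
    if \<sigma>: "\<sigma> \<in> {0..s}" for \<sigma>
  proof -
    have f: "((\<lambda>s. fdiff \<epsilon> (\<lambda>x. \<theta> x s) x) has_real_derivative fdiff \<epsilon> (\<Phi> u) x) (at u within {0..T})"
      if "u \<in> {0..T}" for u using fdiff_pow_evol[OF that, where i = 1] by simp
    have "((\<lambda>s. fdiff \<epsilon> (\<lambda>x. \<theta> x s) x) \<circ> (\<lambda>\<sigma>. t + \<sigma>) has_real_derivative fdiff \<epsilon> (\<Phi> (t + \<sigma>)) x * 1) (at \<sigma> within {0..s})"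
      by (rule DERIV_image_chain[OF DERIV_subset[OF f]]) (use \<sigma> s in \<open>auto intro!: derivative_eq_intros\<close>)
    moreover have "((\<lambda>s. fdiff \<epsilon> (\<lambda>x. \<theta> x s) x) \<circ> (\<lambda>\<sigma>. t - \<sigma>) has_real_derivative fdiff \<epsilon> (\<Phi> (t - \<sigma>)) x * - 1) (at \<sigma> within {0..s})"
      by (rule DERIV_image_chain[OF DERIV_subset[OF f]]) (use \<sigma> s in \<open>auto intro!: derivative_eq_intros\<close>)
    ultimately show ?thesis unfolding G_def[abs_def] by (auto dest: DERIV_add simp: comp_def)
  qed
  have "norm (G s - G 0) \<le> (P1 * (2 * s) * \<epsilon>) * norm (s - 0)"
  proof (rule field_differentiable_bound[OF _ dG])
    fix \<sigma> assume \<sigma>: "\<sigma> \<in> {0..s}"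
    have u: "t - \<sigma> \<in> {0..T}" "t + \<sigma> \<in> {0..T}" using \<sigma> s by auto
    have "smooth_bd (Suc 0) (P1 * \<bar>(t + \<sigma>) - (t - \<sigma>)\<bar>) (\<lambda>x. \<Phi> (t + \<sigma>) x - \<Phi> (t - \<sigma>) x)"
      using smooth_\<Phi>_lipschitz[OF u] by (simp del: smooth_bd.simps)
    then have "smooth_bd 0 (P1 * \<bar>(t + \<sigma>) - (t - \<sigma>)\<bar> * \<epsilon>) (fdiff \<epsilon> (\<lambda>x. \<Phi> (t + \<sigma>) x - \<Phi> (t - \<sigma>) x))"
      using \<epsilon> by (intro smooth_bd_fdiff) auto
    then have "\<bar>fdiff \<epsilon> (\<lambda>x. \<Phi> (t + \<sigma>) x - \<Phi> (t - \<sigma>) x) x\<bar> \<le> P1 * (2 * \<sigma>) * \<epsilon>"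
      using \<sigma> by simp
    also have "\<dots> \<le> P1 * (2 * s) * \<epsilon>" using \<sigma> \<epsilon> const_nonneg by (intro mult_right_mono mult_left_mono) auto
    finally show "norm (fdiff \<epsilon> (\<Phi> (t + \<sigma>)) x - fdiff \<epsilon> (\<Phi> (t - \<sigma>)) x) \<le> P1 * (2 * s) * \<epsilon>"
      by (simp add: fdiff_def algebra_simps)
  qed (use s in auto)
  moreover have "(fdiff \<epsilon> ^^ 1) (\<lambda>x. D (t + s) 0 x + D (t - s) 0 x - 2 * D t 0 x) x = G s - G 0"
    by (simp add: D0[OF ts(1)] D0[OF ts(2)] D0[OF ts(3)] G_def fdiff_def)
  ultimately show "\<bar>(fdiff \<epsilon> ^^ 1) (\<lambda>x. D (t + s) 0 x + D (t - s) 0 x - 2 * D t 0 x) x\<bar> \<le> 2 * P1 * s\<^sup>2 * \<epsilon> ^ 1"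
    using s by (simp add: power2_eq_square mult_ac)
qed

definition N2 where "N2 = c ^ 3 / 2 * (6 * B\<^sup>2 * P1 + 10 * B * P0\<^sup>2)"

lemma N2_nonneg: "0 \<le> N2" using c B const_nonneg by (simp add: N2_def)

lemma nl_second_difference:
  assumes s: "0 \<le> s" "0 \<le> t - s" "t + s \<le> T"
  shows "\<bar>nl (t + s) x + nl (t - s) x - 2 * nl t x\<bar> \<le> N2 * s\<^sup>2"
proof -
  have ts: "t + s \<in> {0..T}" "t - s \<in> {0..T}" "t \<in> {0..T}" using s by auto
  define p \<alpha> \<beta> where "p = D t 1 x" "\<alpha> = D (t + s) 1 x - p" "\<beta> = D (t - s) 1 x - p"
  have p: "\<bar>p\<bar> \<le> B" using bd[OF ts(3), of 1 x] by (simp add: p_\<alpha>_\<beta>_def)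
  have a: "\<bar>\<alpha>\<bar> \<le> P0 * s" "\<bar>\<beta>\<bar> \<le> P0 * s"
    using D_lipschitz[OF ts(3) ts(1), of 1 x] D_lipschitz[OF ts(3) ts(2), of 1 x] s by (simp_all add: p_\<alpha>_\<beta>_def)
  have a2: "\<bar>\<alpha>\<bar> \<le> 2 * B" "\<bar>\<beta>\<bar> \<le> 2 * B"
    using bd[OF ts(1), of 1 x] bd[OF ts(2), of 1 x] p by (simp_all add: p_\<alpha>_\<beta>_def)
  have ab: "\<bar>\<alpha> + \<beta>\<bar> \<le> 2 * P1 * s\<^sup>2"
    using D1_second_difference[OF s, of x] by (simp add: p_\<alpha>_\<beta>_def algebra_simps)
  have sq: "\<alpha>\<^sup>2 \<le> P0\<^sup>2 * s\<^sup>2" "\<beta>\<^sup>2 \<le> P0\<^sup>2 * s\<^sup>2"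
    using power_mono[OF a(1), of 2] power_mono[OF a(2), of 2] by (simp_all add: power_mult_distrib)
  have t1: "\<bar>3 * p\<^sup>2 * (\<alpha> + \<beta>)\<bar> \<le> 3 * B\<^sup>2 * (2 * P1 * s\<^sup>2)"
    unfolding abs_mult using p ab power_mono[OF p, of 2] by (intro mult_mono) auto
  have t2: "\<bar>(3 * p + \<alpha>) * \<alpha>\<^sup>2\<bar> \<le> (5 * B) * (P0\<^sup>2 * s\<^sup>2)"
    unfolding abs_mult using p a2 sq by (intro mult_mono) auto
  have t3: "\<bar>(3 * p + \<beta>) * \<beta>\<^sup>2\<bar> \<le> (5 * B) * (P0\<^sup>2 * s\<^sup>2)"
    unfolding abs_mult using p a2 sq by (intro mult_mono) auto
  have e: "nl (t + s) x + nl (t - s) x - 2 * nl t x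
      = c ^ 3 / 2 * (3 * p\<^sup>2 * (\<alpha> + \<beta>) + (3 * p + \<alpha>) * \<alpha>\<^sup>2 + (3 * p + \<beta>) * \<beta>\<^sup>2)"
  proof -
    have "D (t + s) 1 x = p + \<alpha>" "D (t - s) 1 x = p + \<beta>" "D t 1 x = p" by (simp_all add: p_\<alpha>_\<beta>_def)
    then show ?thesis unfolding nl_def by (simp add: power2_eq_square field_simps)
  qed
  have "\<bar>3 * p\<^sup>2 * (\<alpha> + \<beta>) + (3 * p + \<alpha>) * \<alpha>\<^sup>2 + (3 * p + \<beta>) * \<beta>\<^sup>2\<bar>
      \<le> 3 * B\<^sup>2 * (2 * P1 * s\<^sup>2) + (5 * B) * (P0\<^sup>2 * s\<^sup>2) + (5 * B) * (P0\<^sup>2 * s\<^sup>2)"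
    by (intro order_trans[OF abs_triangle_ineq] add_mono t1 t2 t3)
  also have "\<dots> = (6 * B\<^sup>2 * P1 + 10 * B * P0\<^sup>2) * s\<^sup>2" by (simp add: algebra_simps)
  finally have "c ^ 3 / 2 * \<bar>3 * p\<^sup>2 * (\<alpha> + \<beta>) + (3 * p + \<alpha>) * \<alpha>\<^sup>2 + (3 * p + \<beta>) * \<beta>\<^sup>2\<bar>
      \<le> c ^ 3 / 2 * ((6 * B\<^sup>2 * P1 + 10 * B * P0\<^sup>2) * s\<^sup>2)"
    using c by (intro mult_left_mono) auto
  then show ?thesis unfolding e abs_mult N2_def using c by (simp add: mult.assoc)
qed

section \<open>Consistency of the scheme\<close>

text \<open>
  The coefficients of \<open>\<theta>\<close>, of its nonlinear term and of its time derivative on the grid. They satisfy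
  the semidiscrete equation \<open>ph_eq\<close> up to the defect \<open>ep\<close> of the spectral third derivative.
\<close>

definition v :: "nat \<Rightarrow> real \<Rightarrow> int \<Rightarrow> complex" where "v N t = dft N (samp N (\<lambda>x. \<theta> x t))"
definition nh :: "nat \<Rightarrow> real \<Rightarrow> int \<Rightarrow> complex" where "nh N t = dft N (samp N (nl t))"
definition ph :: "nat \<Rightarrow> real \<Rightarrow> int \<Rightarrow> complex" where "ph N t = dft N (samp N (\<Phi> t))"
definition ep :: "nat \<Rightarrow> real \<Rightarrow> int \<Rightarrow> complex" where
  "ep N t m = of_real (c ^ 3) * (dft N (samp N (D t 3)) m - spec N 3 (D t 0) m)"
definition lam :: "int \<Rightarrow> real" where "lam m = (c * of_int m) ^ 3"

lemma v_eq: "t \<in> {0..T} \<Longrightarrow> v N t = dft N (samp N (D t 0))"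
  by (simp add: v_def D0)

lemma ph_split: "ph N t m = of_real (c ^ 3) * dft N (samp N (D t 3)) m + nh N t m"
proof -
  have "samp N (\<Phi> t) = (\<lambda>k. of_real (c ^ 3) * samp N (D t 3) k + samp N (nl t) k)"
    by (rule ext) (simp add: samp_def \<Phi>_def)
  then show ?thesis by (simp only: ph_def nh_def dft_add dft_cmult)
qed

lemma ph_eq:
  assumes "t \<in> {0..T}"
  shows "ph N t m = - \<i> * of_real (lam m) * v N t m + nh N t m + ep N t m"
proof -
  have "\<i> ^ 3 = - \<i>" by (simp add: power3_eq_cube)
  then have "(\<i> * of_int m) ^ 3 = - \<i> * of_int m ^ 3" by (simp only: power_mult_distrib)
  then show ?thesis unfolding ph_split v_eq[OF assms] ep_def spec_def lam_def
    by (simp add: algebra_simps power_mult_distrib)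
qed

lemma v_deriv:
  assumes "t \<in> {0..T}"
  shows "((\<lambda>s. v N s m) has_vector_derivative ph N t m) (at t within {0..T})"
proof -
  have e: "dft N f m = (\<Sum>k\<in>grid N. f k * (wave N (- (m * k)) / of_nat N))" for f
    by (simp add: dft_wave sum_divide_distrib)
  have "((\<lambda>s. of_real (\<theta> x s) :: complex) has_vector_derivative of_real (\<Phi> t x)) (at t within {0..T})" for x
    using evol'[OF assms, of x]
    by (intro has_vector_derivative_of_real) (simp add: has_real_derivative_iff_has_vector_derivative)
  then show ?thesis unfolding v_def ph_def e samp_def
    by (intro has_vector_derivative_sum has_vector_derivative_mult_left)
qed

context
  fixes N :: nat assumes N: "even N" "N > 0"
begin

lemma dft_samp_diff: "dft N (samp N f) m - dft N (samp N g) m = dft N (samp N (\<lambda>x. f x - g x)) m"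
proof -
  have "samp N (\<lambda>x. f x - g x) = (\<lambda>k. samp N f k - samp N g k)" by (rule ext) (simp add: samp_def)
  then show ?thesis by (simp only: dft_diff)
qed

lemma per_diff: "per2pi f \<Longrightarrow> per2pi g \<Longrightarrow> per2pi (\<lambda>x. f x - g x)"
  by (simp add: per2pi_def)

definition V6 where "V6 = c ^ 3 * B + 2 ^ 6 * Cn"

lemma V6_nonneg: "0 \<le> V6" using c B Cn_nonneg by (simp add: V6_def)

lemma nrm_ph6: "t \<in> {0..T} \<Longrightarrow> nrm N (\<lambda>m. of_int m ^ 6 * ph N t m) \<le> V6"
proof -
  assume t: "t \<in> {0..T}"
  have "nrm N (\<lambda>m. of_int m ^ 6 * ph N t m)
      = nrm N (\<lambda>m. of_real (c ^ 3) * (of_int m ^ 6 * dft N (samp N (D t 3)) m) + of_int m ^ 6 * nh N t m)"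
    by (simp add: ph_split algebra_simps)
  also have "\<dots> \<le> nrm N (\<lambda>m. of_real (c ^ 3) * (of_int m ^ 6 * dft N (samp N (D t 3)) m)) + nrm N (\<lambda>m. of_int m ^ 6 * nh N t m)"
    by (rule nrm_triangle)
  also have "\<dots> \<le> c ^ 3 * B + 2 ^ 6 * Cn"
  proof (rule add_mono)
    show "nrm N (\<lambda>m. of_real (c ^ 3) * (of_int m ^ 6 * dft N (samp N (D t 3)) m)) \<le> c ^ 3 * B"
      unfolding nrm_cmult using sob3[OF t N] c by (simp add: mult_left_mono norm_power)
    show "nrm N (\<lambda>m. of_int m ^ 6 * nh N t m) \<le> 2 ^ 6 * Cn"
      unfolding nh_def by (rule smooth_bd_dft(1)[OF N per_nl[OF t] smooth_nl[OF t]]) simp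
  qed
  finally show ?thesis by (simp add: V6_def)
qed

lemma nrm_v6:
  assumes t: "t \<in> {0..T}" "t' \<in> {0..T}" "t \<le> t'"
  shows "nrm N (\<lambda>m. of_int m ^ 6 * (v N t' m - v N t m)) \<le> V6 * (t' - t)"
proof -
  have "nrm N (\<lambda>m. of_int m ^ 6 * v N t' m - of_int m ^ 6 * v N t m) \<le> V6 * (t' - t)"
  proof (rule nrm_mvt[OF t(3) V6_nonneg])
    fix m s assume s: "s \<in> {t..t'}"
    then have s': "s \<in> {0..T}" using t by auto
    show "((\<lambda>s. of_int m ^ 6 * v N s m) has_vector_derivative of_int m ^ 6 * ph N s m) (at s within {t..t'})"
      by (intro has_vector_derivative_mult_right has_vector_derivative_within_subset[OF v_deriv[OF s']]) (use t in auto)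
  next
    fix s assume "s \<in> {t..t'}"
    then show "nrm N (\<lambda>m. of_int m ^ 6 * ph N s m) \<le> V6" using t by (intro nrm_ph6) auto
  qed
  then show ?thesis by (simp add: right_diff_distrib)
qed

lemma nrm_nh3:
  assumes t: "t \<in> {0..T}" "t' \<in> {0..T}"
  shows "nrm N (\<lambda>m. of_int m ^ 3 * (nh N t' m - nh N t m)) \<le> 8 * Ln * \<bar>t' - t\<bar>"
  unfolding nh_def dft_samp_diff
  using smooth_bd_dft(1)[OF N per_diff[OF per_nl[OF t(2)] per_nl[OF t(1)]] smooth_nl_lipschitz[OF t]] by simp

lemma nrm_nh_second:
  assumes s: "0 \<le> s" "0 \<le> t - s" "t + s \<le> T"
  shows "nrm N (\<lambda>m. nh N (t + s) m + nh N (t - s) m - 2 * nh N t m) \<le> N2 * s\<^sup>2"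
proof -
  have "nh N (t + s) m + nh N (t - s) m - 2 * nh N t m
     = dft N (samp N (\<lambda>x. nl (t + s) x + nl (t - s) x - 2 * nl t x)) m" for m
  proof -
    have "samp N (\<lambda>x. nl (t + s) x + nl (t - s) x - 2 * nl t x)
      = (\<lambda>k. samp N (nl (t + s)) k + samp N (nl (t - s)) k - 2 * samp N (nl t) k)"
      by (rule ext) (simp add: samp_def)
    then show ?thesis by (simp only: nh_def dft_add dft_diff dft_cmult)
  qed
  moreover have "nrm N (dft N (samp N (\<lambda>x. nl (t + s) x + nl (t - s) x - 2 * nl t x))) \<le> N2 * s\<^sup>2"
    by (rule nrm_dft_sup[OF N])
       (use nl_second_difference[OF s] N2_nonneg in \<open>simp_all add: samp_def del: of_real_add of_real_diff of_real_mult\<close>)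
  ultimately show ?thesis by simp
qed

lemma nrm_weighted1:
  assumes p: "per2pi f" and f: "smooth_bd 1 A f"
  shows "nrm N (\<lambda>m. of_real (1 + \<bar>of_int m\<bar>) * dft N (samp N f) m) \<le> 3 * A"
proof -
  have "nrm N (\<lambda>m. of_real (1 + \<bar>of_int m\<bar>) * dft N (samp N f) m)
      \<le> nrm N (dft N (samp N f)) + nrm N (\<lambda>m. of_int m ^ 1 * dft N (samp N f) m)"
    by (rule nrm_le_sum2) (simp add: norm_mult algebra_simps flip: of_real_add)
  also have "nrm N (\<lambda>m. of_int m ^ 1 * dft N (samp N f) m) \<le> 2 ^ 1 * A"
    by (rule smooth_bd_dft(1)[OF N p f])
  also have "nrm N (dft N (samp N f)) \<le> A"
    by (rule nrm_dft_sup[OF N]) (use smooth_bd_bound[OF f] smooth_bd_nonneg[OF f] in \<open>auto simp: samp_def\<close>)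
  finally show ?thesis by simp
qed

lemma nrm_ph1:
  assumes t: "t \<in> {0..T}" "t' \<in> {0..T}"
  shows "nrm N (\<lambda>m. of_real (1 + \<bar>of_int m\<bar>) * (ph N t' m - ph N t m)) \<le> 3 * P1 * \<bar>t' - t\<bar>"
  unfolding ph_def dft_samp_diff
  using nrm_weighted1[OF per_diff[OF per_\<Phi>[OF t(2)] per_\<Phi>[OF t(1)]] smooth_\<Phi>_lipschitz[OF t]] by simp

lemma int_weight: "(1 + \<bar>real_of_int m\<bar>) * \<bar>real_of_int m\<bar> ^ k \<le> 2 * \<bar>real_of_int m\<bar> ^ Suc k" if "k \<ge> 1"
proof (cases "m = 0")
  case False
  then have "1 \<le> \<bar>real_of_int m\<bar>" by linarith
  then have "(1 + \<bar>real_of_int m\<bar>) * \<bar>real_of_int m\<bar> ^ k \<le> (2 * \<bar>real_of_int m\<bar>) * \<bar>real_of_int m\<bar> ^ k"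
    by (intro mult_right_mono) auto
  then show ?thesis by (simp add: mult_ac)
qed (use that in \<open>cases k; simp\<close>)

lemma nrm_nh4: "t \<in> {0..T} \<Longrightarrow> nrm N (\<lambda>m. of_real (1 + \<bar>of_int m\<bar>) * (of_int m ^ 3 * nh N t m)) \<le> 32 * Cn"
proof -
  assume t: "t \<in> {0..T}"
  have "nrm N (\<lambda>m. of_real (1 + \<bar>of_int m\<bar>) * (of_int m ^ 3 * nh N t m)) \<le> 2 * nrm N (\<lambda>m. of_int m ^ 4 * nh N t m)"
  proof (rule nrm_mono)
    fix m
    have "((1 + \<bar>real_of_int m\<bar>) * \<bar>real_of_int m\<bar> ^ 3) * cmod (nh N t m) \<le> (2 * \<bar>real_of_int m\<bar> ^ Suc 3) * cmod (nh N t m)"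
      by (intro mult_right_mono int_weight) auto
    then show "cmod (of_real (1 + \<bar>of_int m\<bar>) * (of_int m ^ 3 * nh N t m)) \<le> 2 * cmod (of_int m ^ 4 * nh N t m)"
      by (simp only: norm_mult norm_power norm_of_real norm_of_int) (simp add: mult_ac eval_nat_numeral)
  qed simp
  also have "nrm N (\<lambda>m. of_int m ^ 4 * nh N t m) \<le> 2 ^ 4 * Cn"
    unfolding nh_def by (rule smooth_bd_dft(1)[OF N per_nl[OF t] smooth_nl[OF t]]) simp
  finally show ?thesis by simp
qed

lemma nrm_v7: "t \<in> {0..T} \<Longrightarrow> nrm N (\<lambda>m. of_real (1 + \<bar>of_int m\<bar>) * (of_int m ^ 6 * v N t m)) \<le> 2 * B"
proof -
  assume t: "t \<in> {0..T}"
  have "nrm N (\<lambda>m. of_real (1 + \<bar>of_int m\<bar>) * (of_int m ^ 6 * v N t m)) \<le> 2 * nrm N (\<lambda>m. of_int m ^ 9 * v N t m)"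
  proof (rule nrm_mono)
    fix m
    have "(1 + \<bar>real_of_int m\<bar>) * \<bar>real_of_int m\<bar> ^ 6 \<le> 2 * \<bar>real_of_int m\<bar> ^ 9"
    proof (cases "m = 0")
      case False
      then have "1 \<le> \<bar>real_of_int m\<bar>" by linarith
      then have "\<bar>real_of_int m\<bar> ^ Suc 6 \<le> \<bar>real_of_int m\<bar> ^ 9" by (intro power_increasing) auto
      then show ?thesis using int_weight[of 6 m] by linarith
    qed simp
    then have "((1 + \<bar>real_of_int m\<bar>) * \<bar>real_of_int m\<bar> ^ 6) * cmod (v N t m) \<le> (2 * \<bar>real_of_int m\<bar> ^ 9) * cmod (v N t m)"
      by (intro mult_right_mono) auto
    then show "cmod (of_real (1 + \<bar>of_int m\<bar>) * (of_int m ^ 6 * v N t m)) \<le> 2 * cmod (of_int m ^ 9 * v N t m)"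
      by (simp only: norm_mult norm_power norm_of_real norm_of_int abs_of_nonneg add_nonneg_nonneg zero_le_one abs_ge_zero mult.assoc)
  qed simp
  then show ?thesis using sob[OF t N] by (simp add: v_eq[OF t])
qed

text \<open>
  The truncation error of the two-step scheme, as a function of the time step \<open>s\<close>, vanishes at \<open>s = 0\<close>,
  and its derivative in \<open>s\<close> is of second order up to the spatial defect. The equation has to be used
  twice on the dispersive term, which costs \<open>\<lambda>\<^sup>2\<close>, that is six powers of \<open>m\<close>, on a time difference. The
  factor \<open>\<mu>\<close> stands for a weight times the smoothing factor of the scheme, and \<open>\<Omega>\<close> for its size on the
  terms where the smoothing is used up by the dispersion.
\<close>

lemma truncation:
  assumes \<tau>: "0 \<le> \<tau>" "0 \<le> t - \<tau>" "t + \<tau> \<le> T"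
    and e0: "\<And>t. t \<in> {0..T} \<Longrightarrow> nrm N (ep N t) \<le> e0"
    and \<mu>: "\<And>m. m \<in> grid N \<Longrightarrow> cmod (\<mu> m) \<le> C" "\<And>m. m \<in> grid N \<Longrightarrow> cmod (\<mu> m) * (\<tau> * \<bar>lam m\<bar>) \<le> \<Omega>"
    and C: "0 \<le> C" "0 \<le> \<Omega>"
  shows "nrm N (\<lambda>m. \<mu> m * ((1 + \<i> * of_real (\<tau> * lam m)) * v N (t + \<tau>) m
      - (1 - \<i> * of_real (\<tau> * lam m)) * v N (t - \<tau>) m - 2 * of_real \<tau> * nh N t m))
    \<le> (C * (N2 + 2 * c ^ 6 * V6 + 16 * c ^ 3 * Ln) * \<tau>\<^sup>2 + 2 * (C + \<Omega>) * e0) * \<tau>"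
proof -
  have tT: "t \<in> {0..T}" using \<tau> by auto
  have e00: "0 \<le> e0" using e0[OF tT] nrm_nonneg order_trans by blast
  define V where "V s m = \<mu> m * ((1 + \<i> * of_real (lam m) * of_real s) * v N (t + s) m
      - (1 - \<i> * of_real (lam m) * of_real s) * v N (t - s) m - of_real s * (2 * nh N t m))" for s m
  define V' where "V' s m = \<mu> m * (((1 + \<i> * of_real (lam m) * of_real s) * ph N (t + s) m + \<i> * of_real (lam m) * v N (t + s) m)
      - ((1 - \<i> * of_real (lam m) * of_real s) * - ph N (t - s) m + - (\<i> * of_real (lam m)) * v N (t - s) m) - 2 * nh N t m)" for s m
  define K where "K = C * (N2 + 2 * c ^ 6 * V6 + 16 * c ^ 3 * Ln) * \<tau>\<^sup>2 + 2 * (C + \<Omega>) * e0"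
  have K0: "0 \<le> K" unfolding K_def
    using C e00 N2_nonneg V6_nonneg const_nonneg c by (intro add_nonneg_nonneg mult_nonneg_nonneg) auto
  have "nrm N (\<lambda>m. V \<tau> m - V 0 m) \<le> K * (\<tau> - 0)"
  proof (rule nrm_mvt[OF \<tau>(1) K0])
    fix m s assume s: "s \<in> {0..\<tau>}"
    then have ts: "t + s \<in> {0..T}" "t - s \<in> {0..T}" using \<tau> by auto
    have 1: "((\<lambda>s. v N (t + s) m) has_vector_derivative ph N (t + s) m) (at s within {0..\<tau>})"
    proof -
      have "((\<lambda>s. v N s m) \<circ> (\<lambda>s. t + s) has_vector_derivative 1 *\<^sub>R ph N (t + s) m) (at s within {0..\<tau>})"
      proof (rule vector_diff_chain_within)
        show "((\<lambda>s. t + s) has_vector_derivative 1) (at s within {0..\<tau>})" by (auto intro!: derivative_eq_intros)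
        show "((\<lambda>s. v N s m) has_vector_derivative ph N (t + s) m) (at (t + s) within (\<lambda>s. t + s) ` {0..\<tau>})"
          by (rule has_vector_derivative_within_subset[OF v_deriv[OF ts(1)]]) (use \<tau> in auto)
      qed
      then show ?thesis by (simp add: comp_def)
    qed
    have 2: "((\<lambda>s. v N (t - s) m) has_vector_derivative - ph N (t - s) m) (at s within {0..\<tau>})"
    proof -
      have "((\<lambda>s. v N s m) \<circ> (\<lambda>s. t - s) has_vector_derivative (- 1) *\<^sub>R ph N (t - s) m) (at s within {0..\<tau>})"
      proof (rule vector_diff_chain_within)
        show "((\<lambda>s. t - s) has_vector_derivative - 1) (at s within {0..\<tau>})" by (auto intro!: derivative_eq_intros)
        show "((\<lambda>s. v N s m) has_vector_derivative ph N (t - s) m) (at (t - s) within (\<lambda>s. t - s) ` {0..\<tau>})"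
          by (rule has_vector_derivative_within_subset[OF v_deriv[OF ts(2)]]) (use \<tau> in auto)
      qed
      then show ?thesis by (simp add: comp_def)
    qed
    have r: "((\<lambda>s. a * of_real s :: complex) has_vector_derivative a) (at s within {0..\<tau>})" for a
      using has_vector_derivative_mult_right[OF has_vector_derivative_of_real[OF DERIV_ident], of a]
      by (simp add: id_def)
    have r1: "((\<lambda>s. 1 + a * of_real s :: complex) has_vector_derivative a) (at s within {0..\<tau>})" for a
      using has_vector_derivative_add[OF has_vector_derivative_const[of 1] r[of a]] by simp
    have r2: "((\<lambda>s. 1 - a * of_real s :: complex) has_vector_derivative - a) (at s within {0..\<tau>})" for a
      using has_vector_derivative_diff[OF has_vector_derivative_const[of 1] r[of a]] by simp
    have r3: "((\<lambda>s. of_real s * a :: complex) has_vector_derivative a) (at s within {0..\<tau>})" for a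
      using r[of a] by (simp add: mult.commute)
    show "((\<lambda>s. V s m) has_vector_derivative V' s m) (at s within {0..\<tau>})"
      unfolding V_def V'_def
      by (intro has_vector_derivative_mult_right has_vector_derivative_diff has_vector_derivative_mult r1 r2 r3 1 2)
  next
    fix s assume s: "s \<in> {0..\<tau>}"
    then have ts: "t + s \<in> {0..T}" "t - s \<in> {0..T}" and s0: "0 \<le> s" "s \<le> \<tau>" using \<tau> by auto
    have s2: "s\<^sup>2 \<le> \<tau>\<^sup>2" using s0 by (intro power_mono) auto
    define A1 where "A1 m = \<mu> m * (nh N (t + s) m + nh N (t - s) m - 2 * nh N t m)" for m
    define A2 where "A2 m = \<mu> m * (ep N (t + s) m + ep N (t - s) m)" for m
    define A3 where "A3 m = \<mu> m * (of_real ((lam m)\<^sup>2 * s) * (v N (t + s) m - v N (t - s) m))" for m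
    define A4 where "A4 m = \<mu> m * (\<i> * of_real (lam m * s) * (nh N (t + s) m - nh N (t - s) m))" for m
    define A5 where "A5 m = \<mu> m * (\<i> * of_real (lam m * s) * (ep N (t + s) m - ep N (t - s) m))" for m
    have split: "V' s m = A1 m + A2 m + A3 m + A4 m + A5 m" for m
    proof -
      have i: "\<i> * (\<i> * z) = - z" for z by (simp flip: mult.assoc)
      show ?thesis
        unfolding V'_def A1_def A2_def A3_def A4_def A5_def ph_eq[OF ts(1)] ph_eq[OF ts(2)]
        by (simp add: algebra_simps power2_eq_square i)
    qed
    have n1: "nrm N A1 \<le> C * (N2 * \<tau>\<^sup>2)"
    proof -
      have "nrm N A1 \<le> C * nrm N (\<lambda>m. nh N (t + s) m + nh N (t - s) m - 2 * nh N t m)"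
        unfolding A1_def by (rule nrm_mono) (use \<mu> C in \<open>auto simp: norm_mult mult_right_mono\<close>)
      also have "\<dots> \<le> C * (N2 * s\<^sup>2)"
        using nrm_nh_second[of s t] s0 ts C by (intro mult_left_mono) auto
      also have "\<dots> \<le> C * (N2 * \<tau>\<^sup>2)" using C N2_nonneg s2 by (intro mult_left_mono) auto
      finally show ?thesis .
    qed
    have n2: "nrm N A2 \<le> C * (2 * e0)"
    proof -
      have "nrm N A2 \<le> C * nrm N (\<lambda>m. ep N (t + s) m + ep N (t - s) m)"
        unfolding A2_def by (rule nrm_mono) (use \<mu> C in \<open>auto simp: norm_mult mult_right_mono\<close>)
      also have "\<dots> \<le> C * (2 * e0)"
        using nrm_triangle[of N "ep N (t + s)" "ep N (t - s)"] e0[OF ts(1)] e0[OF ts(2)] C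
        by (intro mult_left_mono) auto
      finally show ?thesis .
    qed
    have lamm: "\<bar>lam m\<bar> = c ^ 3 * \<bar>of_int m\<bar> ^ 3" for m
      using c by (simp add: lam_def power_mult_distrib abs_mult power_abs)
    have n3: "nrm N A3 \<le> C * (2 * c ^ 6 * V6 * \<tau>\<^sup>2)"
    proof -
      have "nrm N A3 \<le> (C * (c ^ 6 * s)) * nrm N (\<lambda>m. of_int m ^ 6 * (v N (t + s) m - v N (t - s) m))"
      proof (rule nrm_mono)
        fix m assume m: "m \<in> grid N"
        have "(lam m)\<^sup>2 = c ^ 6 * \<bar>of_int m\<bar> ^ 6"
          by (simp add: lam_def power_mult_distrib flip: power_mult)
        then have "cmod (A3 m) = cmod (\<mu> m) * ((c ^ 6 * s) * cmod (of_int m ^ 6 * (v N (t + s) m - v N (t - s) m)))"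
          using s0 c unfolding A3_def norm_mult norm_of_real abs_mult by (simp add: norm_mult norm_power)
        also have "\<dots> \<le> C * ((c ^ 6 * s) * cmod (of_int m ^ 6 * (v N (t + s) m - v N (t - s) m)))"
          using \<mu>(1)[OF m] c s0 by (intro mult_right_mono) auto
        finally show "cmod (A3 m) \<le> C * (c ^ 6 * s) * cmod (of_int m ^ 6 * (v N (t + s) m - v N (t - s) m))" by simp
      qed (use C c s0 in simp)
      also have "\<dots> \<le> (C * (c ^ 6 * s)) * (V6 * (2 * s))"
        using nrm_v6[OF ts(2,1)] s0 C c by (intro mult_left_mono) auto
      also have "\<dots> = C * (2 * c ^ 6 * V6 * s\<^sup>2)" by (simp add: power2_eq_square)
      also have "\<dots> \<le> C * (2 * c ^ 6 * V6 * \<tau>\<^sup>2)" using C c V6_nonneg s2 by (intro mult_left_mono) auto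
      finally show ?thesis .
    qed
    have n4: "nrm N A4 \<le> C * (16 * c ^ 3 * Ln * \<tau>\<^sup>2)"
    proof -
      have "nrm N A4 \<le> (C * (c ^ 3 * s)) * nrm N (\<lambda>m. of_int m ^ 3 * (nh N (t + s) m - nh N (t - s) m))"
      proof (rule nrm_mono)
        fix m assume m: "m \<in> grid N"
        have "cmod (A4 m) = cmod (\<mu> m) * ((c ^ 3 * s) * cmod (of_int m ^ 3 * (nh N (t + s) m - nh N (t - s) m)))"
          using s0 c unfolding A4_def norm_mult norm_of_real abs_mult lamm by (simp add: norm_mult norm_power)
        also have "\<dots> \<le> C * ((c ^ 3 * s) * cmod (of_int m ^ 3 * (nh N (t + s) m - nh N (t - s) m)))"
          using \<mu>(1)[OF m] c s0 by (intro mult_right_mono) auto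
        finally show "cmod (A4 m) \<le> C * (c ^ 3 * s) * cmod (of_int m ^ 3 * (nh N (t + s) m - nh N (t - s) m))" by simp
      qed (use C c s0 in simp)
      also have "\<dots> \<le> (C * (c ^ 3 * s)) * (8 * Ln * (2 * s))"
        using nrm_nh3[OF ts(2,1)] s0 C c by (intro mult_left_mono) auto
      also have "\<dots> = C * (16 * c ^ 3 * Ln * s\<^sup>2)" by (simp add: power2_eq_square)
      also have "\<dots> \<le> C * (16 * c ^ 3 * Ln * \<tau>\<^sup>2)" using C c const_nonneg s2 by (intro mult_left_mono) auto
      finally show ?thesis .
    qed
    have n5: "nrm N A5 \<le> \<Omega> * (2 * e0)"
    proof -
      have "nrm N A5 \<le> \<Omega> * nrm N (\<lambda>m. ep N (t + s) m - ep N (t - s) m)"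
      proof (rule nrm_mono)
        fix m assume m: "m \<in> grid N"
        have "cmod (A5 m) = (cmod (\<mu> m) * (s * \<bar>lam m\<bar>)) * cmod (ep N (t + s) m - ep N (t - s) m)"
          using s0 unfolding A5_def norm_mult norm_of_real abs_mult by simp
        also have "cmod (\<mu> m) * (s * \<bar>lam m\<bar>) \<le> cmod (\<mu> m) * (\<tau> * \<bar>lam m\<bar>)"
          using s0 by (intro mult_left_mono mult_right_mono) auto
        also have "\<dots> \<le> \<Omega>" by (rule \<mu>(2)[OF m])
        finally show "cmod (A5 m) \<le> \<Omega> * cmod (ep N (t + s) m - ep N (t - s) m)" by (simp add: mult_right_mono)
      qed (use C in simp)
      also have "\<dots> \<le> \<Omega> * (2 * e0)"
        using nrm_triangle_minus[of N "ep N (t + s)" "ep N (t - s)"] e0[OF ts(1)] e0[OF ts(2)] C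
        by (intro mult_left_mono) auto
      finally show ?thesis .
    qed
    have "nrm N (V' s) = nrm N (\<lambda>m. A1 m + A2 m + A3 m + A4 m + A5 m)" by (rule nrm_cong) (rule split)
    also have "\<dots> \<le> nrm N A1 + nrm N A2 + nrm N A3 + nrm N A4 + nrm N A5"
      by (intro order_trans[OF nrm_triangle] add_mono order_refl)
    also have "\<dots> \<le> C * (N2 * \<tau>\<^sup>2) + C * (2 * e0) + C * (2 * c ^ 6 * V6 * \<tau>\<^sup>2) + C * (16 * c ^ 3 * Ln * \<tau>\<^sup>2) + \<Omega> * (2 * e0)"
      by (intro add_mono n1 n2 n3 n4 n5)
    also have "\<dots> = K" by (simp add: K_def algebra_simps)
    finally show "nrm N (V' s) \<le> K" .
  qed
  moreover have "V 0 m = 0" for m by (simp add: V_def)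
  moreover have "V \<tau> m = \<mu> m * ((1 + \<i> * of_real (\<tau> * lam m)) * v N (t + \<tau>) m
      - (1 - \<i> * of_real (\<tau> * lam m)) * v N (t - \<tau>) m - 2 * of_real \<tau> * nh N t m)" for m
    by (simp add: V_def mult_ac)
  ultimately show ?thesis by (simp add: K_def)
qed

text \<open>
  The starting step is taken once, so a local error of second order is enough: the exponentials are
  compared with their linear and constant Taylor polynomials. The factor of \<open>nh N 0\<close> has an error of first
  order only, which \<open>\<tau>\<close> completes.
\<close>

lemma initial_step:
  assumes \<tau>: "0 \<le> \<tau>" "\<tau> \<le> T"
    and e0: "\<And>t. t \<in> {0..T} \<Longrightarrow> nrm N (ep N t) \<le> e0"
    and w: "\<And>m. m \<in> grid N \<Longrightarrow> 0 \<le> w m \<and> w m \<le> 1 + \<bar>of_int m\<bar> \<and> w m \<le> \<Omega>" and \<Omega>: "0 \<le> \<Omega>"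
    and y: "\<And>m. m \<in> grid N \<Longrightarrow> y m = v N 0 m * (1 / 2) * (cis (- (\<tau> * lam m)) + (1 - \<i> * of_real (\<tau> * lam m)))
      + z m * (of_real \<tau> / 2) * (1 + cis (- (\<tau> * lam m)))"
  shows "nrm N (\<lambda>m. of_real (w m) * (y m - v N \<tau> m))
    \<le> (3 * P1 + 2 * c ^ 6 * B + 32 * c ^ 3 * Cn) * \<tau>\<^sup>2 + \<tau> * \<Omega> * (e0 + nrm N (\<lambda>m. z m - nh N 0 m))"
proof -
  have T: "0 \<in> {0..T}" "\<tau> \<in> {0..T}" using \<tau> by auto
  define E where "E m = cis (- (\<tau> * lam m))" for m
  define A1 where "A1 m = of_real (w m) * (v N \<tau> m - v N 0 m - of_real \<tau> * ph N 0 m)" for m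
  define A2 where "A2 m = of_real (w m) * (v N 0 m * (1 / 2) * (E m - 1 + \<i> * of_real (\<tau> * lam m)))" for m
  define A3 where "A3 m = of_real (w m) * (nh N 0 m * (of_real \<tau> / 2) * (E m - 1))" for m
  define A4 where "A4 m = of_real (w m) * (of_real \<tau> * ep N 0 m)" for m
  define A5 where "A5 m = of_real (w m) * ((z m - nh N 0 m) * (of_real \<tau> / 2) * (1 + E m))" for m
  have lamm: "\<bar>lam m\<bar> = c ^ 3 * \<bar>of_int m\<bar> ^ 3" for m
    using c by (simp add: lam_def power_mult_distrib abs_mult power_abs)
  have lam2: "(lam m)\<^sup>2 = c ^ 6 * \<bar>of_int m\<bar> ^ 6" for m
    by (simp add: lam_def power_mult_distrib flip: power_mult)
  have w1: "w m * x \<le> (1 + \<bar>of_int m\<bar>) * x" "w m * x \<le> \<Omega> * x" "0 \<le> w m * x"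
    if "m \<in> grid N" "0 \<le> x" for m x
    using w[OF that(1)] that(2) by (auto intro: mult_right_mono)
  have split: "of_real (w m) * (y m - v N \<tau> m) = - A1 m + A2 m + A3 m - A4 m + A5 m" if "m \<in> grid N" for m
    unfolding y[OF that] A1_def A2_def A3_def A4_def A5_def ph_eq[OF T(1)] E_def[symmetric]
    by (simp add: field_simps)
  have n1: "nrm N A1 \<le> 3 * P1 * \<tau>\<^sup>2"
  proof -
    define V where "V s m = of_real (w m) * (v N s m - of_real s * ph N 0 m)" for s m
    have "nrm N (\<lambda>m. V \<tau> m - V 0 m) \<le> (3 * P1 * \<tau>) * (\<tau> - 0)"
    proof (rule nrm_mvt[where V' = "\<lambda>s m. of_real (w m) * (ph N s m - ph N 0 m)"])
      show "0 \<le> 3 * P1 * \<tau>" using const_nonneg \<tau> by simp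
      fix m s assume s: "s \<in> {0..\<tau>}"
      then have s': "s \<in> {0..T}" using \<tau> by auto
      have r: "((\<lambda>s. of_real s * a :: complex) has_vector_derivative a) (at s within {0..\<tau>})" for a
        using has_vector_derivative_mult_left[OF has_vector_derivative_of_real[OF DERIV_ident], of a]
        by (simp add: id_def)
      show "((\<lambda>s. V s m) has_vector_derivative of_real (w m) * (ph N s m - ph N 0 m)) (at s within {0..\<tau>})"
        unfolding V_def
        by (intro has_vector_derivative_mult_right has_vector_derivative_diff r
            has_vector_derivative_within_subset[OF v_deriv[OF s']]) (use \<tau> in auto)
    next
      fix s assume s: "s \<in> {0..\<tau>}"
      then have s': "s \<in> {0..T}" using \<tau> by auto
      have "nrm N (\<lambda>m. of_real (w m) * (ph N s m - ph N 0 m))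
          \<le> 1 * nrm N (\<lambda>m. of_real (1 + \<bar>of_int m\<bar>) * (ph N s m - ph N 0 m))"
      proof (rule nrm_mono)
        fix m assume m: "m \<in> grid N"
        show "cmod (of_real (w m) * (ph N s m - ph N 0 m)) \<le> 1 * cmod (of_real (1 + \<bar>of_int m\<bar>) * (ph N s m - ph N 0 m))"
          unfolding norm_mult norm_of_real using w1(1)[OF m, of "cmod (ph N s m - ph N 0 m)"] w[OF m] by simp
      qed simp
      also have "\<dots> \<le> 3 * P1 * \<bar>s - 0\<bar>" using nrm_ph1[OF T(1) s'] by simp
      also have "\<dots> \<le> 3 * P1 * \<tau>" using s const_nonneg by (intro mult_left_mono) auto
      finally show "nrm N (\<lambda>m. of_real (w m) * (ph N s m - ph N 0 m)) \<le> 3 * P1 * \<tau>" .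
    qed (use \<tau> in auto)
    moreover have "V \<tau> m - V 0 m = A1 m" for m by (simp add: V_def A1_def algebra_simps)
    ultimately show ?thesis by (simp add: power2_eq_square)
  qed
  have n2: "nrm N A2 \<le> (\<tau>\<^sup>2 * c ^ 6) * (2 * B)"
  proof -
    have "nrm N A2 \<le> (\<tau>\<^sup>2 * c ^ 6) * nrm N (\<lambda>m. of_real (1 + \<bar>of_int m\<bar>) * (of_int m ^ 6 * v N 0 m))"
    proof (rule nrm_mono)
      fix m assume m: "m \<in> grid N"
      have "cmod (E m - 1 + \<i> * of_real (\<tau> * lam m)) \<le> (\<tau> * lam m)\<^sup>2"
        using norm_cis_linear(2)[of "- (\<tau> * lam m)"] by (simp add: E_def)
      then have "cmod (A2 m) \<le> w m * (cmod (v N 0 m) * (1 / 2) * (\<tau> * lam m)\<^sup>2)"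
        unfolding A2_def norm_mult using w[OF m] by (intro mult_mono) auto
      also have "\<dots> \<le> (1 + \<bar>of_int m\<bar>) * (cmod (v N 0 m) * (1 / 2) * (\<tau> * lam m)\<^sup>2)"
        by (rule w1[OF m]) simp
      also have "\<dots> \<le> (1 + \<bar>of_int m\<bar>) * (cmod (v N 0 m) * 1 * (\<tau> * lam m)\<^sup>2)"
        by (intro mult_left_mono mult_right_mono) auto
      also have "\<dots> = (\<tau>\<^sup>2 * c ^ 6) * cmod (of_real (1 + \<bar>of_int m\<bar>) * (of_int m ^ 6 * v N 0 m))"
        unfolding norm_mult norm_of_real norm_power norm_of_int power_mult_distrib lam2 by simp
      finally show "cmod (A2 m) \<le> (\<tau>\<^sup>2 * c ^ 6) * cmod (of_real (1 + \<bar>of_int m\<bar>) * (of_int m ^ 6 * v N 0 m))" .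
    qed (use c in simp)
    also have "\<dots> \<le> (\<tau>\<^sup>2 * c ^ 6) * (2 * B)" using c by (intro mult_left_mono nrm_v7[OF T(1)]) auto
    finally show ?thesis .
  qed
  have n3: "nrm N A3 \<le> (\<tau>\<^sup>2 * c ^ 3) * (32 * Cn)"
  proof -
    have "nrm N A3 \<le> (\<tau>\<^sup>2 * c ^ 3) * nrm N (\<lambda>m. of_real (1 + \<bar>of_int m\<bar>) * (of_int m ^ 3 * nh N 0 m))"
    proof (rule nrm_mono)
      fix m assume m: "m \<in> grid N"
      have "cmod (E m - 1) \<le> \<tau> * \<bar>lam m\<bar>"
        using norm_cis_linear(1)[of "- (\<tau> * lam m)"] \<tau> by (simp add: E_def abs_mult)
      then have "cmod (A3 m) \<le> w m * (cmod (nh N 0 m) * (\<tau> / 2) * (\<tau> * \<bar>lam m\<bar>))"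
        unfolding A3_def norm_mult using w[OF m] \<tau> by (intro mult_mono) (auto simp: norm_divide)
      also have "\<dots> \<le> (1 + \<bar>of_int m\<bar>) * (cmod (nh N 0 m) * (\<tau> / 2) * (\<tau> * \<bar>lam m\<bar>))"
        by (rule w1[OF m]) (use \<tau> in simp)
      also have "\<dots> \<le> (1 + \<bar>of_int m\<bar>) * (cmod (nh N 0 m) * \<tau> * (\<tau> * \<bar>lam m\<bar>))"
        using \<tau> by (intro mult_left_mono mult_right_mono) auto
      also have "\<dots> = (\<tau>\<^sup>2 * c ^ 3) * cmod (of_real (1 + \<bar>of_int m\<bar>) * (of_int m ^ 3 * nh N 0 m))"
        unfolding norm_mult norm_of_real norm_power norm_of_int lamm by (simp add: power2_eq_square)
      finally show "cmod (A3 m) \<le> (\<tau>\<^sup>2 * c ^ 3) * cmod (of_real (1 + \<bar>of_int m\<bar>) * (of_int m ^ 3 * nh N 0 m))" .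
    qed (use c in simp)
    also have "\<dots> \<le> (\<tau>\<^sup>2 * c ^ 3) * (32 * Cn)" using c by (intro mult_left_mono nrm_nh4[OF T(1)]) auto
    finally show ?thesis .
  qed
  have n4: "nrm N A4 \<le> (\<tau> * \<Omega>) * e0"
  proof -
    have "nrm N A4 \<le> (\<tau> * \<Omega>) * nrm N (ep N 0)"
    proof (rule nrm_mono)
      fix m assume m: "m \<in> grid N"
      show "cmod (A4 m) \<le> (\<tau> * \<Omega>) * cmod (ep N 0 m)"
        unfolding A4_def norm_mult norm_of_real using w1(2)[OF m, of "\<tau> * cmod (ep N 0 m)"] w[OF m] \<tau>
        by (simp add: mult_ac)
    qed (use \<tau> \<Omega> in simp)
    also have "\<dots> \<le> (\<tau> * \<Omega>) * e0" using e0[OF T(1)] \<tau> \<Omega> by (intro mult_left_mono) auto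
    finally show ?thesis .
  qed
  have n5: "nrm N A5 \<le> (\<tau> * \<Omega>) * nrm N (\<lambda>m. z m - nh N 0 m)"
  proof (rule nrm_mono)
    fix m assume m: "m \<in> grid N"
    have "cmod (1 + E m) \<le> 2" using norm_triangle_ineq[of 1 "E m"] by (simp add: E_def)
    then have "cmod (A5 m) \<le> w m * (cmod (z m - nh N 0 m) * (\<tau> / 2) * 2)"
      unfolding A5_def norm_mult using w[OF m] \<tau> by (intro mult_mono) (auto simp: norm_divide)
    also have "\<dots> \<le> \<Omega> * (cmod (z m - nh N 0 m) * (\<tau> / 2) * 2)" by (rule w1[OF m]) (use \<tau> in simp)
    finally show "cmod (A5 m) \<le> (\<tau> * \<Omega>) * cmod (z m - nh N 0 m)" by (simp add: mult_ac)
  qed (use \<tau> \<Omega> in simp)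
  have "nrm N (\<lambda>m. of_real (w m) * (y m - v N \<tau> m)) = nrm N (\<lambda>m. - A1 m + A2 m + A3 m - A4 m + A5 m)"
    by (rule nrm_cong) (rule split)
  also have "\<dots> \<le> nrm N A1 + nrm N A2 + nrm N A3 + nrm N A4 + nrm N A5"
    using nrm_triangle[of N "\<lambda>m. - A1 m + A2 m + A3 m - A4 m" A5]
      nrm_triangle_minus[of N "\<lambda>m. - A1 m + A2 m + A3 m" A4]
      nrm_triangle[of N "\<lambda>m. - A1 m + A2 m" A3] nrm_triangle[of N "\<lambda>m. - A1 m" A2] by simp
  also have "\<dots> \<le> 3 * P1 * \<tau>\<^sup>2 + (\<tau>\<^sup>2 * c ^ 6) * (2 * B) + (\<tau>\<^sup>2 * c ^ 3) * (32 * Cn) + (\<tau> * \<Omega>) * e0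
      + (\<tau> * \<Omega>) * nrm N (\<lambda>m. z m - nh N 0 m)"
    by (intro add_mono n1 n2 n3 n4 n5)
  also have "\<dots> = (3 * P1 + 2 * c ^ 6 * B + 32 * c ^ 3 * Cn) * \<tau>\<^sup>2 + \<tau> * \<Omega> * (e0 + nrm N (\<lambda>m. z m - nh N 0 m))"
    by (simp add: algebra_simps)
  finally show ?thesis .
qed

end

end

section \<open>The nonlinear error equation\<close>

text \<open>
  In the application \<open>p\<close> is the exact derivative, \<open>\<eta>\<close> its spectral defect and \<open>d\<close> the derivative of the error.
  After subtraction of the linearization at \<open>p\<close>, no term linear in \<open>d\<close> alone is left.
\<close>

lemma cubic_remainder:
  fixes \<eta> d :: complex
  assumes p: "\<bar>p\<bar> \<le> B" and \<eta>: "cmod \<eta> \<le> 1" and d: "cmod d \<le> 1"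
  shows "cmod ((of_real p + \<eta> + d) ^ 3 - of_real (p ^ 3) - 3 * of_real (p\<^sup>2) * d)
    \<le> (3 * B\<^sup>2 + 6 * B + 7) * (cmod \<eta> + (cmod \<eta> + cmod d) * cmod d)"
proof -
  have B: "0 \<le> B" using p by linarith
  define a b where "a = cmod \<eta>" and "b = cmod d"
  have ab: "0 \<le> a" "a \<le> 1" "0 \<le> b" "b \<le> 1" using \<eta> d by (simp_all add: a_def b_def)
  have p2: "p\<^sup>2 \<le> B\<^sup>2" using power_mono[OF p, of 2] by simp
  define X where "X = 3 * of_real (p\<^sup>2) + 3 * of_real p * \<eta> + \<eta>\<^sup>2"
  define Y where "Y = 6 * of_real p * \<eta> + 3 * of_real p * d + 3 * \<eta>\<^sup>2 + 3 * \<eta> * d + d\<^sup>2"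
  have e: "(of_real p + \<eta> + d) ^ 3 - of_real (p ^ 3) - 3 * of_real (p\<^sup>2) * d = X * \<eta> + Y * d"
    by (simp add: X_def Y_def power2_eq_square power3_eq_cube algebra_simps)
  have "cmod X \<le> cmod (3 * of_real (p\<^sup>2)) + cmod (3 * of_real p * \<eta>) + cmod (\<eta>\<^sup>2)"
    unfolding X_def by (intro order_trans[OF norm_triangle_ineq] add_mono order_refl)
  also have "\<dots> = 3 * p\<^sup>2 + 3 * \<bar>p\<bar> * a + a\<^sup>2"
    by (simp add: norm_mult norm_power a_def)
  also have "\<dots> \<le> 3 * B\<^sup>2 + 3 * B * 1 + 1"
    using p p2 ab by (intro add_mono mult_mono power_le_one) auto
  also have "\<dots> \<le> 3 * B\<^sup>2 + 6 * B + 7" using B by simp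
  finally have X: "cmod X \<le> 3 * B\<^sup>2 + 6 * B + 7" .
  have "cmod Y \<le> cmod (6 * of_real p * \<eta>) + cmod (3 * of_real p * d) + cmod (3 * \<eta>\<^sup>2) + cmod (3 * \<eta> * d) + cmod (d\<^sup>2)"
    unfolding Y_def by (intro order_trans[OF norm_triangle_ineq] add_mono order_refl)
  also have "\<dots> = 6 * \<bar>p\<bar> * a + 3 * \<bar>p\<bar> * b + 3 * (a * a) + 3 * (a * b) + b * b"
    by (simp add: norm_mult norm_power a_def b_def power2_eq_square)
  also have "\<dots> \<le> 6 * B * a + 3 * B * b + 3 * (a * 1) + 3 * (a * 1) + b * 1"
    using p ab by (intro add_mono mult_mono) auto
  also have "\<dots> \<le> (3 * B\<^sup>2 + 6 * B + 7) * (a + b)"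
  proof -
    have n: "0 \<le> B\<^sup>2 * a" "0 \<le> B\<^sup>2 * b" "0 \<le> B * b" using B ab by simp_all
    have "(3 * B\<^sup>2 + 6 * B + 7) * (a + b) = 3 * (B\<^sup>2 * a) + 3 * (B\<^sup>2 * b) + 6 * B * a + 6 * (B * b) + 7 * a + 7 * b"
      by (simp add: algebra_simps)
    moreover have "3 * B * b = 3 * (B * b)" by simp
    ultimately show ?thesis using n ab by linarith
  qed
  finally have Y: "cmod Y \<le> (3 * B\<^sup>2 + 6 * B + 7) * (a + b)" .
  have "cmod (X * \<eta> + Y * d) \<le> cmod X * a + cmod Y * b"
    unfolding a_def b_def by (rule order_trans[OF norm_triangle_ineq]) (simp add: norm_mult)
  also have "\<dots> \<le> (3 * B\<^sup>2 + 6 * B + 7) * a + (3 * B\<^sup>2 + 6 * B + 7) * (a + b) * b"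
    using X Y ab by (intro add_mono mult_right_mono) auto
  also have "\<dots> = (3 * B\<^sup>2 + 6 * B + 7) * (a + (a + b) * b)" by (simp add: algebra_simps)
  finally show ?thesis unfolding e a_def b_def .
qed

lemma cubic_terms:
  fixes z d :: complex
  shows "1 / 2 * of_real a * z ^ 3 - of_real (a / 2 * (p * (p * p))) - of_real (3 * a / 2 * (p * p)) * d
    = of_real (a / 2) * (z ^ 3 - of_real (p ^ 3) - 3 * of_real (p\<^sup>2) * d)"
  by (simp add: field_simps power2_eq_square power3_eq_cube)

text \<open>
  The spatial error may be multiplied by the largest value of the weight. If \<open>N \<surd>\<tau> \<le> 1\<close>, this changes the
  constant only. Otherwise \<open>h \<le> 2\<pi> \<surd>\<tau>\<close>, and powers of \<open>h\<close> are converted into powers of \<open>\<tau>\<close>.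
\<close>

lemma weight_tradeoff:
  assumes N: "N > 0" and \<tau>: "0 < \<tau>" "\<tau> \<le> 1" and h: "mesh N \<le> 1" and r: "r \<ge> 6"
  shows "(1 + real N * sqrt \<tau>) * mesh N ^ r \<le> (2 + (2 * pi) ^ 6) * (mesh N ^ r + \<tau>\<^sup>2)"
proof -
  define h where "h = mesh N"
  have h0: "0 < h" "h \<le> 1" using mesh_pos[OF N] h by (simp_all add: h_def)
  have Nh: "real N * h = 2 * pi" using mesh_mult[OF N] by (simp add: h_def)
  have nn: "0 \<le> h ^ r" "0 \<le> \<tau>\<^sup>2" "0 \<le> (2 * pi) ^ 6 * h ^ r" using h0 by simp_all
  have key: "real N * sqrt \<tau> * h ^ r \<le> h ^ r + (2 * pi) ^ 6 * \<tau>\<^sup>2"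
  proof (cases "real N * sqrt \<tau> \<le> 1")
    case True
    then have "real N * sqrt \<tau> * h ^ r \<le> 1 * h ^ r" using h0 by (intro mult_right_mono) auto
    moreover have "0 \<le> (2 * pi) ^ 6 * \<tau>\<^sup>2" by simp
    ultimately show ?thesis by linarith
  next
    case False
    then have "h * 1 \<le> h * (real N * sqrt \<tau>)" using h0 by (intro mult_left_mono) auto
    also have "h * (real N * sqrt \<tau>) = (real N * h) * sqrt \<tau>" by simp
    finally have hs: "h \<le> 2 * pi * sqrt \<tau>" unfolding Nh by simp
    have "real N * sqrt \<tau> * h ^ r \<le> real N * sqrt \<tau> * h ^ 6"
      using h0 r \<tau> by (intro mult_left_mono power_decreasing) auto
    also have "\<dots> = (real N * h) * sqrt \<tau> * h ^ 5" by (simp add: eval_nat_numeral)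
    also have "\<dots> = 2 * pi * sqrt \<tau> * h ^ 5" unfolding Nh ..
    also have "\<dots> \<le> 2 * pi * sqrt \<tau> * (2 * pi * sqrt \<tau>) ^ 5"
      using hs h0 \<tau> by (intro mult_left_mono power_mono) auto
    also have "\<dots> = (2 * pi) ^ 6 * (sqrt \<tau>) ^ 6" by (simp add: power_mult_distrib eval_nat_numeral)
    also have "(sqrt \<tau>) ^ 6 = \<tau> ^ 3"
    proof -
      have "(sqrt \<tau>) ^ 6 = ((sqrt \<tau>)\<^sup>2) ^ 3" by (simp flip: power_mult)
      then show ?thesis using \<tau> by simp
    qed
    also have "\<tau> ^ 3 \<le> \<tau>\<^sup>2" using \<tau> by (intro power_decreasing) auto
    finally have "real N * sqrt \<tau> * h ^ r \<le> (2 * pi) ^ 6 * \<tau>\<^sup>2" by (simp add: mult_left_mono)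
    then show ?thesis using nn by linarith
  qed
  have "(1 + real N * sqrt \<tau>) * h ^ r = h ^ r + real N * sqrt \<tau> * h ^ r" by (simp add: distrib_right)
  also have "\<dots> \<le> 2 * h ^ r + (2 * pi) ^ 6 * \<tau>\<^sup>2" using key by simp
  also have "\<dots> \<le> (2 + (2 * pi) ^ 6) * (h ^ r + \<tau>\<^sup>2)"
    using nn by (simp add: algebra_simps)
  finally show ?thesis by (simp add: h_def)
qed

text \<open>
  \<open>B\<close> bounds what depends on the curvature, and \<open>R\<close> the derivative of order \<open>r + 3\<close> of the solution, which
  enters the size of the error only. The estimates are used with two values of \<open>r\<close> and \<open>R\<close>.
\<close>

locale scheme_run = flow T "2 * pi / L" B \<theta> D
  for T L B :: real and \<theta> :: "real \<Rightarrow> real \<Rightarrow> real" and D :: "real \<Rightarrow> nat \<Rightarrow> real \<Rightarrow> real" +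
  fixes \<tau> R :: real and N r :: nat and u :: "nat \<Rightarrow> int \<Rightarrow> complex"
  assumes L: "L > 0" and N: "even N" "N > 0" and \<tau>: "0 < \<tau>" "\<tau> \<le> 1" and h: "mesh N \<le> 1"
    and hB: "65 * B * mesh N \<le> 1" and r: "r \<ge> 6"
    and sobr: "\<And>t M. t \<in> {0..T} \<Longrightarrow> even M \<Longrightarrow> M > 0 \<Longrightarrow>
      nrm M (\<lambda>m. of_int m ^ (r + 3) * dft M (samp M (D t 0)) m) \<le> R"
    and u: "cnadb_solution L N \<tau> (\<lambda>\<alpha>. \<theta> \<alpha> 0) u"
    and cfl: "3 * (\<tau> * real N * (65 * (Cb0 + Lb))) + 64 * (65 * (Cb0 + Lb)) / ((2 * pi / L) ^ 3 * (real N)\<^sup>2) \<le> 1"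
begin

abbreviation "c \<equiv> 2 * pi / L"

definition Cb where "Cb = 65 * (Cb0 + Lb)"

sublocale lf: leapfrog L \<tau> Cb N
  using L \<tau> N cfl const_nonneg by unfold_locales (simp_all add: Cb_def)

lemma c_eq: "lf.c = c" by (simp add: lf.c_def)

text \<open>
  \<open>e\<close> is the error in Fourier space and \<open>f\<close> the weighted error. The weight reaches as far as the implicit
  treatment of the dispersion can absorb it, and it turns a derivative of \<open>e\<close> into a factor \<open>\<kappa>\<close> for \<open>f\<close>
  (\<open>w_freq\<close>). The time is clipped at \<open>T\<close> so that the coefficients \<open>bb j\<close> of the advection speed have
  their properties for all \<open>j\<close>.
\<close>

definition w :: "int \<Rightarrow> real" where "w m = 1 + \<bar>of_int m\<bar> * sqrt \<tau>"
definition e :: "nat \<Rightarrow> int \<Rightarrow> complex" where "e j m = dft N (u j) m - v N (real j * \<tau>) m"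
definition f :: "nat \<Rightarrow> int \<Rightarrow> complex" where "f j m = of_real (w m) * e j m"
definition \<kappa> :: real where "\<kappa> = min (real N) (1 / sqrt \<tau>)"
definition Cw where "Cw = 2 + 2 / c ^ 3"
definition Kn where "Kn = c ^ 3 / 2 * (3 * B\<^sup>2 + 6 * B + 7)"
definition clip :: "nat \<Rightarrow> real" where "clip j = min (real j * \<tau>) T"
definition bb :: "nat \<Rightarrow> int \<Rightarrow> complex" where "bb j = dft N (samp N (bq (clip j)))"

lemma cpos: "c > 0" using L by simp

lemma w_ge: "1 \<le> w m" using \<tau> by (simp add: w_def)

lemma w_le: "w m \<le> 1 + \<bar>of_int m\<bar>"
proof -
  have "sqrt \<tau> \<le> 1" using \<tau> by simp
  then show ?thesis unfolding w_def using mult_left_mono[of "sqrt \<tau>" 1 "\<bar>of_int m\<bar>"] by simp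
qed

lemma w_le_N: "m \<in> grid N \<Longrightarrow> w m \<le> 1 + real N * sqrt \<tau>"
  using grid_bound[OF N(1), of m] mult_right_mono[of "\<bar>of_int m\<bar>" "real N" "sqrt \<tau>"] \<tau> by (simp add: w_def)

lemma w_freq: "m \<in> grid N \<Longrightarrow> \<bar>of_int m\<bar> \<le> \<kappa> * w m"
proof -
  assume m: "m \<in> grid N"
  have s: "0 < sqrt \<tau>" using \<tau> by simp
  have 1: "\<bar>of_int m\<bar> \<le> real N * w m"
    using grid_bound[OF N(1) m] mult_left_mono[OF w_ge[of m], of "real N"] by simp
  have "\<bar>of_int m\<bar> = 1 / sqrt \<tau> * (\<bar>of_int m\<bar> * sqrt \<tau>)" using s by simp
  also have "\<dots> \<le> 1 / sqrt \<tau> * w m" using s by (intro mult_left_mono) (auto simp: w_def)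
  finally show ?thesis using 1 by (auto simp: \<kappa>_def min_def)
qed

lemma \<kappa>_ge: "1 \<le> \<kappa>" "\<kappa> \<le> real N"
  using N \<tau> by (simp_all add: \<kappa>_def)

text \<open>
  With \<open>y = \<bar>m\<bar> \<surd>\<tau>\<close> the phase is at least \<open>c\<^sup>3 y\<^sup>3\<close>, because \<open>\<tau> \<le> 1\<close>; so the damping outweighs \<open>w = 1 + y\<close> for
  \<open>y > 1\<close>.
\<close>

lemma norm_w_z2: "w m * cmod (zeta2 L \<tau> m) \<le> Cw"
proof -
  define y where "y = \<bar>of_int m\<bar> * sqrt \<tau>"
  have y0: "0 \<le> y" using \<tau> by (simp add: y_def)
  show ?thesis
  proof (cases "y \<le> 1")
    case True
    have "w m * cmod (zeta2 L \<tau> m) \<le> 2 * 1"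
      using True y0 lf.norm_z2_le[of m] by (intro mult_mono) (auto simp: w_def y_def)
    moreover have "0 \<le> 2 / c ^ 3" using cpos by simp
    ultimately show ?thesis unfolding Cw_def by linarith
  next
    case False
    have "y ^ 3 = \<bar>of_int m\<bar> ^ 3 * (\<tau> * sqrt \<tau>)"
    proof -
      have "sqrt \<tau> ^ 3 = \<tau> * sqrt \<tau>" using \<tau> by (simp add: power3_eq_cube)
      then show ?thesis by (simp only: y_def power_mult_distrib)
    qed
    also have "\<dots> \<le> \<bar>of_int m\<bar> ^ 3 * (\<tau> * 1)" using \<tau> by (intro mult_left_mono) auto
    finally have "c ^ 3 * y ^ 3 \<le> \<bar>gam L \<tau> m\<bar>"
      using cpos lf.gm_abs[of m] by (simp add: c_eq mult_ac mult_left_mono)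
    then have "c ^ 3 * y ^ 3 * cmod (zeta2 L \<tau> m) \<le> \<bar>gam L \<tau> m\<bar> * cmod (zeta2 L \<tau> m)" by (rule mult_right_mono) simp
    moreover have "\<bar>gam L \<tau> m\<bar> * cmod (zeta2 L \<tau> m) \<le> 1" by (rule lf.norm_z2_gm)
    ultimately have a: "y ^ 3 * cmod (zeta2 L \<tau> m) \<le> 1 / c ^ 3"
    proof -
      have "y ^ 3 * z \<le> 1 / a" if "a * y ^ 3 * z \<le> 1" "0 < a" for a z :: real
        using that by (simp add: field_simps)
      moreover have "0 < c ^ 3" using cpos by simp
      ultimately show ?thesis using \<open>c ^ 3 * y ^ 3 * cmod (zeta2 L \<tau> m) \<le> \<bar>gam L \<tau> m\<bar> * cmod (zeta2 L \<tau> m)\<close>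
          \<open>\<bar>gam L \<tau> m\<bar> * cmod (zeta2 L \<tau> m) \<le> 1\<close> by (meson order_trans)
    qed
    have "w m \<le> 2 * y ^ 3"
    proof -
      have "y \<le> y ^ 3" using self_le_power[of y 3] False by simp
      then show ?thesis using False by (simp add: w_def flip: y_def)
    qed
    then have "w m * cmod (zeta2 L \<tau> m) \<le> 2 * y ^ 3 * cmod (zeta2 L \<tau> m)" by (rule mult_right_mono) simp
    also have "\<dots> \<le> 2 * (1 / c ^ 3)" using a by simp
    finally show ?thesis by (simp add: Cw_def)
  qed
qed

lemma B0: "0 \<le> Kn" "0 \<le> Cw" using cpos B by (simp_all add: Kn_def Cw_def)

lemma R0: "t \<in> {0..T} \<Longrightarrow> 0 \<le> R"
  by (rule order_trans[OF nrm_nonneg sobr[OF _ N]])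

lemma two_over_N: "(2 / real N) ^ k \<le> mesh N ^ k"
proof -
  have "2 / real N \<le> mesh N" unfolding mesh_def using pi_ge_two by (intro divide_right_mono) auto
  then show ?thesis by (intro power_mono) auto
qed

lemma ep_bound:
  assumes t: "t \<in> {0..T}"
  shows "nrm N (ep N t) \<le> 4 * c ^ 3 * R * mesh N ^ r"
proof -
  have R: "0 \<le> R" by (rule R0[OF t])
  have "nrm N (\<lambda>m. dft N (samp N (D t 3)) m - spec N 3 (D t 0) m) \<le> 4 * (2 / real N) ^ r * R"
    by (rule spectral_accuracy[where d = 3 and s = "r + 3" and B = B])
       (use t N per der bd sobr[OF t] r in auto)
  also have "\<dots> \<le> 4 * mesh N ^ r * R" using R two_over_N by (intro mult_right_mono mult_left_mono) auto
  finally have "c ^ 3 * nrm N (\<lambda>m. dft N (samp N (D t 3)) m - spec N 3 (D t 0) m) \<le> c ^ 3 * (4 * mesh N ^ r * R)"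
    using cpos by (intro mult_left_mono) auto
  moreover have "nrm N (ep N t) = c ^ 3 * nrm N (\<lambda>m. dft N (samp N (D t 3)) m - spec N 3 (D t 0) m)"
    unfolding ep_def nrm_cmult using cpos by (simp only: norm_of_real) simp
  ultimately show ?thesis by (simp add: mult_ac)
qed

text \<open>
  The spectral derivative of the numerical solution is the sum of the exact derivative, its spectral defect
  \<open>\<eta>\<close> and the spectral derivative \<open>dd\<close> of the error (\<open>spectral_deriv_split\<close>).
\<close>

definition \<eta> :: "real \<Rightarrow> int \<Rightarrow> complex" where
  "\<eta> t k = idft N (spec N 1 (D t 0)) k - samp N (D t 1) k"

lemma \<eta>_bounds:
  assumes t: "t \<in> {0..T}"
  shows "nrm N (dft N (\<eta> t)) \<le> 4 * R * mesh N ^ r"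
    "k \<in> grid N \<Longrightarrow> cmod (\<eta> t k) \<le> 65 * B * mesh N"
proof -
  have R: "0 \<le> R" by (rule R0[OF t])
  have "nrm N (dft N (\<eta> t)) = nrm N (\<lambda>m. dft N (samp N (D t 1)) m - spec N 1 (D t 0) m)"
  proof -
    have "nrm N (dft N (\<eta> t)) = nrm N (\<lambda>m. - (dft N (samp N (D t 1)) m - spec N 1 (D t 0) m))"
      unfolding \<eta>_def by (rule nrm_cong) (simp add: dft_diff dft_idft[OF N])
    then show ?thesis unfolding nrm_uminus .
  qed
  also have "\<dots> \<le> 4 * (2 / real N) ^ (r + 2) * R"
    by (rule spectral_accuracy[where d = 1 and s = "r + 3" and B = B])
       (use t N per der bd sobr[OF t] r in auto)
  also have "\<dots> \<le> 4 * mesh N ^ r * R"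
  proof (intro mult_right_mono mult_left_mono)
    have "(2 / real N) ^ (r + 2) \<le> mesh N ^ (r + 2)" by (rule two_over_N)
    also have "\<dots> \<le> mesh N ^ r" using h mesh_pos[OF N(2)] by (intro power_decreasing) auto
    finally show "(2 / real N) ^ (r + 2) \<le> mesh N ^ r" .
  qed (use R in auto)
  finally show "nrm N (dft N (\<eta> t)) \<le> 4 * R * mesh N ^ r" by (simp add: mult_ac)
  assume k: "k \<in> grid N"
  have "cmod (samp N (D t 1) k - idft N (spec N 1 (D t 0)) k) \<le> (4 * real 1 * 2 ^ (1 + 3) + real 1) * B * mesh N"
    by (rule spec_sup_error[OF N]) (use t per der bd k in auto)
  then show "cmod (\<eta> t k) \<le> 65 * B * mesh N" by (simp add: \<eta>_def norm_minus_commute)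
qed

lemma bb_props:
  assumes T: "0 \<le> T"
  shows "bb j (l + int N) = bb j l" "bb j (- l) = cnj (bb j l)" "wsum N (bb j) \<le> Cb"
    "wsum N (\<lambda>l. bb (Suc j) l - bb j l) \<le> Cb * \<tau>"
proof -
  have cl: "clip i \<in> {0..T}" for i using T \<tau> by (auto simp: clip_def)
  show "bb j (l + int N) = bb j l" unfolding bb_def by (rule dft_periodic[OF N(2)])
  show "bb j (- l) = cnj (bb j l)" unfolding bb_def by (rule dft_cnj_real) (simp add: samp_def)
  have "wsum N (bb j) \<le> 65 * Cb0" unfolding bb_def by (rule wsum_smooth[OF N per_bq[OF cl] smooth_bq[OF cl]])
  then show "wsum N (bb j) \<le> Cb" using const_nonneg by (simp add: Cb_def)
  have "\<bar>clip (Suc j) - clip j\<bar> \<le> \<tau>" using \<tau> by (simp add: clip_def min_def algebra_simps)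
  then have "Lb * \<bar>clip (Suc j) - clip j\<bar> \<le> Lb * \<tau>" using const_nonneg by (intro mult_left_mono) auto
  moreover have "wsum N (\<lambda>l. bb (Suc j) l - bb j l) \<le> 65 * (Lb * \<bar>clip (Suc j) - clip j\<bar>)"
    unfolding bb_def dft_samp_diff[OF N]
    by (rule wsum_smooth[OF N per_diff[OF N per_bq[OF cl] per_bq[OF cl]] smooth_bq_lipschitz[OF cl cl]])
  ultimately show "wsum N (\<lambda>l. bb (Suc j) l - bb j l) \<le> Cb * \<tau>"
  proof -
    assume a: "Lb * \<bar>clip (Suc j) - clip j\<bar> \<le> Lb * \<tau>"
      "wsum N (\<lambda>l. bb (Suc j) l - bb j l) \<le> 65 * (Lb * \<bar>clip (Suc j) - clip j\<bar>)"
    have "0 \<le> Cb0 * \<tau>" using const_nonneg \<tau> by simp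
    moreover have "Cb * \<tau> = 65 * (Cb0 * \<tau>) + 65 * (Lb * \<tau>)" by (simp add: Cb_def algebra_simps)
    ultimately show ?thesis using a by linarith
  qed
qed

definition dd :: "nat \<Rightarrow> int \<Rightarrow> complex" where
  "dd j = idft N (\<lambda>n. \<i> * of_int n * e j n)"

text \<open>
  The nonlinear term of the numerical solution minus that of the exact solution minus its linearization.
\<close>

definition rem :: "nat \<Rightarrow> int \<Rightarrow> complex" where
  "rem j m = dft N (nonlinear_term L N (u j)) m - nh N (real j * \<tau>) m - app N (lf.adv (bb j)) (e j) m"

lemma dd_bounds:
  shows "nrm N (dft N (dd j)) \<le> \<kappa> * nrm N (f j)"
    "k \<in> grid N \<Longrightarrow> cmod (dd j k) \<le> \<kappa> * sqrt (real N) * nrm N (f j)"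
proof -
  have k0: "0 \<le> \<kappa>" using \<kappa>_ge by linarith
  have pt: "cmod (\<i> * of_int n * e j n) \<le> \<kappa> * cmod (f j n)" if n: "n \<in> grid N" for n
  proof -
    have "cmod (\<i> * of_int n * e j n) = \<bar>of_int n\<bar> * cmod (e j n)" by (simp add: norm_mult)
    also have "\<dots> \<le> \<kappa> * w n * cmod (e j n)" by (intro mult_right_mono w_freq n) simp
    also have "\<dots> = \<kappa> * cmod (f j n)" using w_ge[of n] by (simp add: f_def norm_mult)
    finally show ?thesis .
  qed
  have "nrm N (dft N (dd j)) = nrm N (\<lambda>n. \<i> * of_int n * e j n)"
    by (rule nrm_cong) (simp add: dd_def dft_idft[OF N])
  also have "\<dots> \<le> \<kappa> * nrm N (f j)" by (rule nrm_mono[OF pt k0])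
  finally show "nrm N (dft N (dd j)) \<le> \<kappa> * nrm N (f j)" .
  assume "k \<in> grid N"
  have "cmod (dd j k) \<le> (\<Sum>n\<in>grid N. cmod (\<i> * of_int n * e j n))"
    unfolding dd_def idft_wave by (rule order_trans[OF norm_sum]) (simp add: norm_mult)
  also have "\<dots> \<le> (\<Sum>n\<in>grid N. \<kappa> * cmod (f j n))" by (intro sum_mono pt)
  also have "\<dots> = \<kappa> * (\<Sum>n\<in>grid N. cmod (f j n))" by (simp add: sum_distrib_left)
  also have "\<dots> \<le> \<kappa> * (sqrt (real N) * nrm N (f j))" by (intro mult_left_mono sum_norm_le_nrm N k0)
  finally show "cmod (dd j k) \<le> \<kappa> * sqrt (real N) * nrm N (f j)" by (simp add: mult_ac)
qed

lemma spectral_deriv_split: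
  assumes t: "real j * \<tau> \<in> {0..T}" and k: "k \<in> grid N"
  shows "spectral_deriv N (u j) k = of_real (D (real j * \<tau>) 1 (gridpt N k)) + \<eta> (real j * \<tau>) k + dd j k"
proof -
  have "\<i> * of_int m * dft N (u j) m = spec N 1 (D (real j * \<tau>) 0) m + \<i> * of_int m * e j m" for m
    unfolding e_def spec_def v_eq[OF t] by (simp add: right_diff_distrib)
  then have "spectral_deriv N (u j) k = idft N (spec N 1 (D (real j * \<tau>) 0)) k + dd j k"
    by (simp add: spectral_deriv_def dd_def idft_wave distrib_right sum.distrib)
  then show ?thesis by (simp add: \<eta>_def samp_def)
qed

text \<open>
  Up to the spectral defect \<open>\<eta>\<close>, the remainder is a product with the derivative of the error as one
  factor. The derivative costs \<open>\<kappa>\<close>; the other factor is taken in the maximum norm, which by the smallness assumption is of size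
  \<open>h + 1 / \<kappa>\<close>.
\<close>

lemma rem_bound:
  assumes t: "real j * \<tau> \<in> {0..T}" and small: "\<kappa>\<^sup>2 * sqrt (real N) * nrm N (f j) \<le> 1"
  shows "nrm N (rem j) \<le> 4 * Kn * R * mesh N ^ r + Kn * (130 * pi * B + 1) * nrm N (f j)"
proof -
  define t where "t = real j * \<tau>"
  have t: "t \<in> {0..T}" using assms by (simp add: t_def)
  have cl: "clip j = t" using t by (simp add: clip_def t_def)
  define X where "X = nrm N (f j)"
  have X0: "0 \<le> X" by (simp add: X_def)
  have small1: "\<kappa> * sqrt (real N) * X \<le> 1"
  proof -
    have "\<kappa> * (sqrt (real N) * X) \<le> \<kappa>\<^sup>2 * (sqrt (real N) * X)"
      using \<kappa>_ge X0 self_le_power[of \<kappa> 2] by (intro mult_right_mono) auto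
    then show ?thesis using small by (simp add: X_def mult_ac)
  qed
  define \<sigma> where "\<sigma> = 65 * B * mesh N + \<kappa> * sqrt (real N) * X"
  have \<sigma>0: "0 \<le> \<sigma>" unfolding \<sigma>_def using B mesh_pos[OF N(2)] \<kappa>_ge X0 by (intro add_nonneg_nonneg mult_nonneg_nonneg) auto
  define q where "q k = nonlinear_term L N (u j) k - samp N (nl t) k - samp N (bq t) k * dd j k" for k
  have rem: "rem j m = dft N q m" for m
  proof -
    have "app N (lf.adv (bb j)) (e j) m = (\<Sum>n\<in>grid N. dft N (samp N (bq t)) (m - n) * dft N (dd j) n)"
      unfolding app_def by (intro sum.cong refl) (simp add: lf.adv_def bb_def cl dd_def dft_idft[OF N])
    also have "\<dots> = dft N (\<lambda>k. samp N (bq t) k * dd j k) m" by (rule dft_mult[OF N, symmetric])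
    finally have a: "app N (lf.adv (bb j)) (e j) m = dft N (\<lambda>k. samp N (bq t) k * dd j k) m" .
    show ?thesis unfolding rem_def a q_def[abs_def] dft_diff nh_def t_def ..
  qed
  have pt: "cmod (q k) \<le> cmod (of_real Kn * \<eta> t k) + cmod (of_real (Kn * \<sigma>) * dd j k)" if k: "k \<in> grid N" for k
  proof -
    define p where "p = D t 1 (gridpt N k)"
    have p: "\<bar>p\<bar> \<le> B" unfolding p_def by (rule bd) (use t in auto)
    have he: "cmod (\<eta> t k) \<le> 65 * B * mesh N" by (rule \<eta>_bounds(2)[OF t k])
    have hd: "cmod (dd j k) \<le> \<kappa> * sqrt (real N) * X" unfolding X_def by (rule dd_bounds(2)[OF k])
    have "q k = of_real (c ^ 3 / 2) * ((of_real p + \<eta> t k + dd j k) ^ 3 - of_real (p ^ 3) - 3 * of_real (p\<^sup>2) * dd j k)"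
      unfolding q_def nonlinear_term_def samp_def nl_def bq_def spectral_deriv_split[OF assms(1) k]
        t_def[symmetric] p_def[symmetric] by (rule cubic_terms)
    then have "cmod (q k) = c ^ 3 / 2 * cmod ((of_real p + \<eta> t k + dd j k) ^ 3 - of_real (p ^ 3) - 3 * of_real (p\<^sup>2) * dd j k)"
      using cpos by (simp only: norm_mult norm_of_real) simp
    also have "\<dots> \<le> c ^ 3 / 2 * ((3 * B\<^sup>2 + 6 * B + 7) * (cmod (\<eta> t k) + (cmod (\<eta> t k) + cmod (dd j k)) * cmod (dd j k)))"
    proof (rule mult_left_mono[OF cubic_remainder[OF p]])
      show "cmod (\<eta> t k) \<le> 1" using he hB by linarith
      show "cmod (dd j k) \<le> 1" using hd small1 by linarith
      show "0 \<le> c ^ 3 / 2" using cpos by simp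
    qed
    also have "\<dots> = Kn * (cmod (\<eta> t k) + (cmod (\<eta> t k) + cmod (dd j k)) * cmod (dd j k))" by (simp add: Kn_def)
    also have "\<dots> \<le> Kn * (cmod (\<eta> t k) + \<sigma> * cmod (dd j k))"
      using he hd B0 by (intro mult_left_mono add_left_mono mult_right_mono) (auto simp: \<sigma>_def)
    also have "\<dots> = cmod (of_real Kn * \<eta> t k) + cmod (of_real (Kn * \<sigma>) * dd j k)"
      using B0 \<sigma>0 by (simp add: norm_mult distrib_left abs_mult)
    finally show ?thesis .
  qed
  have "nrm N q \<le> nrm N (\<lambda>k. of_real Kn * \<eta> t k) + nrm N (\<lambda>k. of_real (Kn * \<sigma>) * dd j k)"
    by (rule nrm_le_sum2[OF pt])
  also have "\<dots> = Kn * nrm N (\<eta> t) + Kn * \<sigma> * nrm N (dd j)"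
    unfolding nrm_cmult norm_of_real using B0 \<sigma>0 by simp
  finally have "sqrt (real N) * nrm N (dft N q)
      \<le> Kn * (sqrt (real N) * nrm N (dft N (\<eta> t))) + Kn * \<sigma> * (sqrt (real N) * nrm N (dft N (dd j)))"
    by (simp only: nrm_dft[OF N])
  also have "\<dots> = sqrt (real N) * (Kn * nrm N (dft N (\<eta> t)) + Kn * \<sigma> * nrm N (dft N (dd j)))"
    by (simp only: distrib_left mult.assoc mult.left_commute)
  finally have "nrm N (dft N q) \<le> Kn * nrm N (dft N (\<eta> t)) + Kn * \<sigma> * nrm N (dft N (dd j))" using N by simp
  also have "\<dots> \<le> Kn * (4 * R * mesh N ^ r) + Kn * \<sigma> * (\<kappa> * X)"
    using B0 \<sigma>0 unfolding X_def by (intro add_mono mult_left_mono \<eta>_bounds(1)[OF t] dd_bounds(1)) auto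
  also have "Kn * \<sigma> * (\<kappa> * X) = Kn * (\<sigma> * \<kappa>) * X" by simp
  also have "Kn * (\<sigma> * \<kappa>) * X \<le> Kn * (130 * pi * B + 1) * X"
  proof (intro mult_right_mono mult_left_mono)
    have "65 * B * (mesh N * \<kappa>) \<le> 65 * B * (mesh N * real N)"
      using \<kappa>_ge B mesh_pos[OF N(2)] by (intro mult_left_mono) auto
    also have "\<dots> = 130 * pi * B" using mesh_mult[OF N(2)] by (simp add: mult_ac)
    finally have "65 * B * (mesh N * \<kappa>) \<le> 130 * pi * B" .
    moreover have "\<sigma> * \<kappa> = 65 * B * (mesh N * \<kappa>) + \<kappa>\<^sup>2 * sqrt (real N) * X"
      by (simp add: \<sigma>_def power2_eq_square algebra_simps)
    ultimately show "\<sigma> * \<kappa> \<le> 130 * pi * B + 1" using small unfolding X_def by linarith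
  qed (use B0 X0 in auto)
  finally show ?thesis unfolding rem[abs_def] X_def by (simp add: mult_ac)
qed

text \<open>
  Whatever the recursion of the weighted error contains besides the linear leapfrog step.
\<close>

definition g :: "nat \<Rightarrow> int \<Rightarrow> complex" where
  "g j m = (f (Suc j) m - zeta1 L \<tau> m * f (j - 1) m
     - of_real (2 * \<tau>) * (zeta2 L \<tau> m * app N (lf.adv (bb j)) (f j) m)) / of_real (2 * \<tau>)"

definition \<Omega> :: real where "\<Omega> = 1 + real N * sqrt \<tau>"
definition K1 where "K1 = N2 + 2 * c ^ 6 * V6 + 16 * c ^ 3 * Ln"
definition K2 where "K2 = 3 * P1 + 2 * c ^ 6 * B + 32 * c ^ 3 * Cn"
definition C1 where "C1 = Cb + Cw * Kn * (130 * pi * B + 1)"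
definition Ks where "Ks = lf.Ke * (2 + 4 * C1\<^sup>2)"
definition Pc :: real where "Pc = 2 + (2 * pi) ^ 6"
definition ER where "ER = 4 * Cw * Kn * R + Cw * K1 / 2 + 4 * c ^ 3 * R * Cw + 4 * c ^ 3 * R * Pc + K2
    + Pc * (4 * c ^ 3 * R + 4 * Kn * R)"
definition \<epsilon> where "\<epsilon> = 4 * Cw * Kn * R * mesh N ^ r + Cw * K1 / 2 * \<tau>\<^sup>2 + (Cw + \<Omega>) * (4 * c ^ 3 * R * mesh N ^ r)"

lemma \<Omega>: "0 \<le> \<Omega>" "m \<in> grid N \<Longrightarrow> w m \<le> \<Omega>"
  using \<tau> w_le_N[of m] by (simp_all add: \<Omega>_def)

lemma gam_lam: "gam L \<tau> m = \<tau> * lam m"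
  by (simp add: gam_def lam_def)

lemma K_nonneg: "0 \<le> K1" "0 \<le> K2" "0 \<le> C1" "0 \<le> Cb"
  using N2_nonneg V6_nonneg[OF N] const_nonneg cpos B Cn_nonneg B0
  by (auto simp: K1_def K2_def C1_def Cb_def intro!: add_nonneg_nonneg mult_nonneg_nonneg)

lemma f_recursion:
  "f (Suc j) m = zeta1 L \<tau> m * f (j - 1) m + of_real (2 * \<tau>) * (zeta2 L \<tau> m * app N (lf.adv (bb j)) (f j) m)
     + of_real (2 * \<tau>) * g j m"
  using \<tau> by (simp add: g_def)

text \<open>
  The forcing consists of the commutator of the weight with the advection, the nonlinear remainder and the
  truncation error of the exact solution.
\<close>

lemma g_split:
  assumes j: "1 \<le> j" and m: "m \<in> grid N"
  shows "g j m = zeta2 L \<tau> m * app N (\<lambda>m n. lf.adv (bb j) m n * of_real ((w m - w n) / w n)) (f j) m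
    + of_real (w m) * zeta2 L \<tau> m * rem j m
    - (of_real (w m) * zeta2 L \<tau> m * ((1 + \<i> * of_real (\<tau> * lam m)) * v N (real j * \<tau> + \<tau>) m
        - (1 - \<i> * of_real (\<tau> * lam m)) * v N (real j * \<tau> - \<tau>) m - 2 * of_real \<tau> * nh N (real j * \<tau>) m)) / of_real (2 * \<tau>)"
proof -
  define z where "z = zeta2 L \<tau> m"
  define W where "W = complex_of_real (w m)"
  define a where "a = app N (lf.adv (bb j)) (e j) m"
  define p where "p = 1 + \<i> * of_real (\<tau> * lam m)"
  define q where "q = 1 - \<i> * of_real (\<tau> * lam m)"
  have z: "z * p = 1"
    using lf.one_gm_nz(1)[of "gam L \<tau> m"] by (simp add: z_def p_def lf.z2_eq gam_lam)
  have z1: "zeta1 L \<tau> m = z * q"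
    using lf.one_gm_nz(1)[of "gam L \<tau> m"] by (simp add: z_def q_def lf.z2_eq gam_lam zeta1_def)
  have j1: "real (Suc j) * \<tau> = real j * \<tau> + \<tau>" "real (j - 1) * \<tau> = real j * \<tau> - \<tau>"
    using j by (simp_all add: algebra_simps of_nat_diff)
  have wa: "app N (\<lambda>m n. lf.adv (bb j) m n * of_real ((w m - w n) / w n)) (f j) m = W * a - app N (lf.adv (bb j)) (f j) m"
  proof -
    have "lf.adv (bb j) m n * of_real ((w m - w n) / w n) * f j n = W * (lf.adv (bb j) m n * e j n) - lf.adv (bb j) m n * f j n" for n
    proof -
      have "w n \<noteq> 0" using w_ge[of n] by linarith
      then have "complex_of_real ((w m - w n) / w n) * of_real (w n) = W - of_real (w n)"
        by (simp add: W_def)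
      then have "lf.adv (bb j) m n * (of_real ((w m - w n) / w n) * of_real (w n)) * e j n
        = lf.adv (bb j) m n * (W - of_real (w n)) * e j n" by simp
      then show ?thesis by (simp add: f_def algebra_simps)
    qed
    then show ?thesis by (simp add: app_def a_def sum_distrib_left sum_subtractf)
  qed
  have un: "dft N (u (j + 1)) m = zeta1 L \<tau> m * dft N (u (j - 1)) m
      + 2 * of_real \<tau> * z * dft N (nonlinear_term L N (u j)) m"
    using u j m by (simp add: cnadb_solution_def z_def)
  have "f (Suc j) m = W * (z * q * (e (j - 1) m + v N (real j * \<tau> - \<tau>) m)
      + 2 * of_real \<tau> * z * (rem j m + nh N (real j * \<tau>) m + a) - (z * p) * v N (real j * \<tau> + \<tau>) m)"
  proof -
    have "e (Suc j) m = dft N (u (j + 1)) m - v N (real j * \<tau> + \<tau>) m" unfolding e_def j1 by simp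
    moreover have "dft N (u (j - 1)) m = e (j - 1) m + v N (real j * \<tau> - \<tau>) m" unfolding e_def j1 by simp
    moreover have "dft N (nonlinear_term L N (u j)) m = rem j m + nh N (real j * \<tau>) m + a"
      by (simp add: rem_def a_def)
    ultimately show ?thesis unfolding f_def[of "Suc j"] z un z1 W_def by simp
  qed
  then have "f (Suc j) m - zeta1 L \<tau> m * f (j - 1) m - of_real (2 * \<tau>) * (z * app N (lf.adv (bb j)) (f j) m)
    = of_real (2 * \<tau>) * (z * (W * a - app N (lf.adv (bb j)) (f j) m) + W * z * rem j m)
      - W * z * (p * v N (real j * \<tau> + \<tau>) m - q * v N (real j * \<tau> - \<tau>) m - 2 * of_real \<tau> * nh N (real j * \<tau>) m)"
    unfolding z1 by (simp add: f_def W_def algebra_simps)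
  then show ?thesis unfolding g_def wa z_def[symmetric] W_def[symmetric] p_def[symmetric] q_def[symmetric]
    using \<tau> by (simp add: diff_divide_distrib)
qed

text \<open>
  The difference \<open>w m - w n\<close> is at most \<open>\<surd>\<tau>\<close> times the aliased difference of the wave numbers, and the
  factor \<open>\<bar>n\<bar> \<surd>\<tau>\<close> left by the derivative is compensated by the weight \<open>w n\<close>.
\<close>

lemma commutator_bound:
  assumes T: "0 \<le> T"
  shows "nrm N (app N (\<lambda>m n. lf.adv (bb j) m n * of_real ((w m - w n) / w n)) x) \<le> Cb * nrm N x"
proof -
  have "nrm N (app N (\<lambda>m n. lf.adv (bb j) m n * of_real ((w m - w n) / w n)) x) \<le> 1 * wsum N (bb j) * nrm N x"
  proof (rule schur_wsum[where d = "bb j", OF N bb_props(1)[OF T]])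
    fix m n assume mn: "m \<in> grid N" "n \<in> grid N"
    have wn: "0 < w n" using w_ge[of n] by linarith
    have s: "0 < sqrt \<tau>" using \<tau> by simp
    have "real_of_int \<bar>\<bar>m\<bar> - \<bar>n\<bar>\<bar> \<le> real_of_int \<bar>rep N (m - n)\<bar>"
      unfolding of_int_le_iff by (rule abs_diff_le_rep[OF N mn])
    then have d: "\<bar>w m - w n\<bar> \<le> \<bar>of_int (rep N (m - n))\<bar> * sqrt \<tau>"
      using s by (simp add: w_def abs_mult flip: left_diff_distrib)
    have nw: "\<bar>of_int n\<bar> * sqrt \<tau> \<le> w n" by (simp add: w_def)
    have "\<bar>of_int n\<bar> * \<bar>(w m - w n) / w n\<bar> = \<bar>of_int n\<bar> * \<bar>w m - w n\<bar> / w n" using wn by simp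
    also have "\<dots> \<le> \<bar>of_int n\<bar> * (\<bar>of_int (rep N (m - n))\<bar> * sqrt \<tau>) / w n"
      using wn d by (intro divide_right_mono mult_left_mono) auto
    also have "\<dots> = \<bar>of_int (rep N (m - n))\<bar> * (\<bar>of_int n\<bar> * sqrt \<tau> / w n)" by simp
    also have "\<dots> \<le> \<bar>of_int (rep N (m - n))\<bar> * 1" using nw wn by (intro mult_left_mono) auto
    finally have "\<bar>of_int n\<bar> * \<bar>(w m - w n) / w n\<bar> * cmod (bb j (m - n)) \<le> (1 + \<bar>real_of_int (rep N (m - n))\<bar>) * cmod (bb j (m - n))"
      by (intro mult_right_mono) auto
    moreover have "cmod (lf.adv (bb j) m n * of_real ((w m - w n) / w n)) = \<bar>of_int n\<bar> * \<bar>(w m - w n) / w n\<bar> * cmod (bb j (m - n))"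
      unfolding lf.adv_def norm_mult norm_of_real by simp
    ultimately show "cmod (lf.adv (bb j) m n * of_real ((w m - w n) / w n)) \<le> 1 * ((1 + \<bar>real_of_int (rep N (m - n))\<bar>) * cmod (bb j (m - n)))"
      by simp
  qed simp
  also have "\<dots> \<le> 1 * Cb * nrm N x" using bb_props(3)[OF T, of j] by (intro mult_right_mono) auto
  finally show ?thesis by simp
qed

lemma g_bound:
  assumes j: "1 \<le> j" "real (Suc j) * \<tau> \<le> T" and small: "\<kappa>\<^sup>2 * sqrt (real N) * nrm N (f j) \<le> 1"
  shows "nrm N (g j) \<le> C1 * nrm N (f j) + \<epsilon>"
proof -
  define t where "t = real j * \<tau>"
  have tt: "0 \<le> t - \<tau>" "t + \<tau> \<le> T" using j \<tau> by (simp_all add: t_def algebra_simps)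
  then have t: "t \<in> {0..T}" and T: "0 \<le> T" using \<tau> by auto
  define H where "H = mesh N ^ r"
  define G1 where "G1 m = zeta2 L \<tau> m * app N (\<lambda>m n. lf.adv (bb j) m n * of_real ((w m - w n) / w n)) (f j) m" for m
  define G2 where "G2 m = of_real (w m) * zeta2 L \<tau> m * rem j m" for m
  define Z where "Z m = of_real (w m) * zeta2 L \<tau> m * ((1 + \<i> * of_real (\<tau> * lam m)) * v N (t + \<tau>) m
        - (1 - \<i> * of_real (\<tau> * lam m)) * v N (t - \<tau>) m - 2 * of_real \<tau> * nh N t m)" for m
  have mu: "cmod (of_real (w m) * zeta2 L \<tau> m) = w m * cmod (zeta2 L \<tau> m)" for m
    using w_ge[of m] by (simp add: norm_mult)
  have "nrm N (g j) = nrm N (\<lambda>m. G1 m + G2 m - of_real (1 / (2 * \<tau>)) * Z m)"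
    by (rule nrm_cong) (simp add: g_split[OF j(1)] G1_def G2_def Z_def t_def)
  also have "\<dots> \<le> nrm N G1 + nrm N G2 + 1 / (2 * \<tau>) * nrm N Z"
    using nrm_triangle_minus[of N "\<lambda>m. G1 m + G2 m" "\<lambda>m. of_real (1 / (2 * \<tau>)) * Z m"] nrm_triangle[of N G1 G2] \<tau>
    unfolding nrm_cmult norm_of_real by simp
  also have "nrm N G1 \<le> Cb * nrm N (f j)"
  proof -
    have "nrm N G1 \<le> 1 * nrm N (app N (\<lambda>m n. lf.adv (bb j) m n * of_real ((w m - w n) / w n)) (f j))"
    proof (rule nrm_mono)
      fix m
      show "cmod (G1 m) \<le> 1 * cmod (app N (\<lambda>m n. lf.adv (bb j) m n * of_real ((w m - w n) / w n)) (f j) m)"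
        unfolding G1_def norm_mult[of "zeta2 L \<tau> m"] by (rule mult_right_mono[OF lf.norm_z2_le norm_ge_zero])
    qed simp
    then show ?thesis using commutator_bound[OF T, of j "f j"] by simp
  qed
  also have "nrm N G2 \<le> Cw * (4 * Kn * R * H + Kn * (130 * pi * B + 1) * nrm N (f j))"
  proof -
    have "nrm N G2 \<le> Cw * nrm N (rem j)"
      unfolding G2_def
    proof (rule nrm_mono)
      fix m
      show "cmod (of_real (w m) * zeta2 L \<tau> m * rem j m) \<le> Cw * cmod (rem j m)"
        unfolding norm_mult[of "of_real (w m) * zeta2 L \<tau> m"] mu by (intro mult_right_mono norm_w_z2) simp
    qed (rule B0)
    also have "\<dots> \<le> Cw * (4 * Kn * R * H + Kn * (130 * pi * B + 1) * nrm N (f j))"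
      using rem_bound[of j] t small B0 unfolding H_def t_def by (intro mult_left_mono) auto
    finally show ?thesis .
  qed
  also have "nrm N Z \<le> (Cw * K1 * \<tau>\<^sup>2 + 2 * (Cw + \<Omega>) * (4 * c ^ 3 * R * H)) * \<tau>"
    unfolding Z_def K1_def H_def
  proof (rule truncation[OF N])
    fix m assume m: "m \<in> grid N"
    show "cmod (of_real (w m) * zeta2 L \<tau> m) \<le> Cw" unfolding mu by (rule norm_w_z2)
    have "w m * (\<bar>gam L \<tau> m\<bar> * cmod (zeta2 L \<tau> m)) \<le> \<Omega> * 1"
      using \<Omega>(2)[OF m] w_ge[of m] \<Omega>(1) lf.norm_z2_gm[of m] by (intro mult_mono) auto
    then show "cmod (of_real (w m) * zeta2 L \<tau> m) * (\<tau> * \<bar>lam m\<bar>) \<le> \<Omega>"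
      unfolding mu gam_lam abs_mult using \<tau> by (simp add: mult_ac)
  qed (use tt \<tau> ep_bound B0 \<Omega>(1) in auto)
  finally have "nrm N (g j) \<le> Cb * nrm N (f j) + Cw * (4 * Kn * R * H + Kn * (130 * pi * B + 1) * nrm N (f j))
      + 1 / (2 * \<tau>) * ((Cw * K1 * \<tau>\<^sup>2 + 2 * (Cw + \<Omega>) * (4 * c ^ 3 * R * H)) * \<tau>)"
    using \<tau> by (simp add: divide_right_mono)
  also have "1 / (2 * \<tau>) * ((Cw * K1 * \<tau>\<^sup>2 + 2 * (Cw + \<Omega>) * (4 * c ^ 3 * R * H)) * \<tau>)
      = Cw * K1 / 2 * \<tau>\<^sup>2 + (Cw + \<Omega>) * (4 * c ^ 3 * R * H)"
  proof -
    have gen: "1 / (2 * \<tau>) * ((a * b * s + 2 * y * z) * \<tau>) = a * b / 2 * s + y * z" for a b s y z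
      using \<tau> by (simp add: field_simps)
    show ?thesis by (rule gen)
  qed
  finally show ?thesis by (simp add: C1_def \<epsilon>_def H_def algebra_simps)
qed

lemma e_0: "e 0 m = 0"
proof -
  have "dft N (u 0) m = dft N (samp N (\<lambda>x. \<theta> x 0)) m"
    using u by (intro dft_cong) (simp add: cnadb_solution_def samp_def)
  then show ?thesis by (simp add: e_def v_def)
qed

lemma f_0: "nrm N (f 0) = 0"
  by (simp add: f_def e_0 nrm_def L2_set_def)

lemma first_step:
  assumes T: "\<tau> \<le> T"
  shows "nrm N (f 1) \<le> K2 * \<tau>\<^sup>2 + \<tau> * \<Omega> * (4 * c ^ 3 * R * mesh N ^ r + 4 * Kn * R * mesh N ^ r)"
proof -
  have T0: "real 0 * \<tau> \<in> {0..T}" using T \<tau> by simp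
  have rem0: "rem 0 m = dft N (nonlinear_term L N (u 0)) m - nh N 0 m" for m
    by (simp add: rem_def app_def e_0)
  have rb: "nrm N (rem 0) \<le> 4 * Kn * R * mesh N ^ r" using rem_bound[OF T0] f_0 by simp
  have "nrm N (f 1) = nrm N (\<lambda>m. of_real (w m) * (dft N (u 1) m - v N \<tau> m))"
    by (rule nrm_cong) (simp add: f_def e_def)
  also have "\<dots> \<le> K2 * \<tau>\<^sup>2 + \<tau> * \<Omega> * (4 * c ^ 3 * R * mesh N ^ r + nrm N (\<lambda>m. dft N (nonlinear_term L N (u 0)) m - nh N 0 m))"
    unfolding K2_def
  proof (rule initial_step[OF N])
    fix m assume m: "m \<in> grid N"
    show "0 \<le> w m \<and> w m \<le> 1 + \<bar>real_of_int m\<bar> \<and> w m \<le> \<Omega>" using w_ge[of m] w_le[of m] \<Omega>(2)[OF m] by simp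
    have "dft N (u 0) m = v N 0 m" using e_0[of m] by (simp add: e_def)
    moreover have "exp (- \<i> * of_real (gam L \<tau> m)) = cis (- (\<tau> * lam m))" by (simp add: cis_conv_exp gam_lam)
    ultimately show "dft N (u 1) m = v N 0 m * (1 / 2) * (cis (- (\<tau> * lam m)) + (1 - \<i> * of_real (\<tau> * lam m)))
      + dft N (nonlinear_term L N (u 0)) m * (of_real \<tau> / 2) * (1 + cis (- (\<tau> * lam m)))"
      using u m unfolding cnadb_solution_def gam_lam[symmetric] by metis
  qed (use \<tau> T ep_bound \<Omega>(1) in auto)
  also have "\<dots> \<le> K2 * \<tau>\<^sup>2 + \<tau> * \<Omega> * (4 * c ^ 3 * R * mesh N ^ r + 4 * Kn * R * mesh N ^ r)"
    using rb \<tau> \<Omega>(1) unfolding rem0[abs_def] by (intro add_left_mono mult_left_mono) auto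
  finally show "nrm N (f 1) \<le> K2 * \<tau>\<^sup>2 + \<tau> * \<Omega> * (4 * c ^ 3 * R * mesh N ^ r + 4 * Kn * R * mesh N ^ r)" .
qed

lemma total_error:
  assumes T: "\<tau> \<le> T"
  shows "nrm N (f 0) + nrm N (f 1) + \<epsilon> \<le> ER * (mesh N ^ r + \<tau>\<^sup>2)"
proof -
  define H where "H = mesh N ^ r"
  define X where "X = H + \<tau>\<^sup>2"
  have H0: "0 \<le> H" using mesh_pos[OF N(2)] by (simp add: H_def)
  have R: "0 \<le> R" using R0[of 0] T \<tau> by simp
  have X: "H \<le> X" "\<tau>\<^sup>2 \<le> X" "0 \<le> X" using H0 by (simp_all add: X_def)
  have OH: "\<Omega> * H \<le> Pc * X"
    unfolding \<Omega>_def Pc_def H_def X_def by (rule weight_tradeoff[OF N(2) \<tau> h r])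
  have cc: "0 \<le> 4 * c ^ 3 * R" "0 \<le> 4 * Kn * R" "0 \<le> 4 * Cw * Kn * R" "0 \<le> Cw * K1 / 2" "0 \<le> 4 * c ^ 3 * R * Cw"
    using cpos R B0 K_nonneg by simp_all
  have 1: "nrm N (f 1) \<le> K2 * X + Pc * (4 * c ^ 3 * R + 4 * Kn * R) * X"
  proof -
    have "nrm N (f 1) \<le> K2 * \<tau>\<^sup>2 + \<tau> * ((\<Omega> * H) * (4 * c ^ 3 * R + 4 * Kn * R))"
      using first_step[OF T] by (simp add: H_def algebra_simps)
    also have "\<dots> \<le> K2 * X + (Pc * X) * (4 * c ^ 3 * R + 4 * Kn * R)"
    proof (rule add_mono)
      show "K2 * \<tau>\<^sup>2 \<le> K2 * X" using X(2) K_nonneg(2) by (rule mult_left_mono)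
      have G: "0 \<le> 4 * c ^ 3 * R + 4 * Kn * R" using cc(1,2) by (rule add_nonneg_nonneg)
      have "0 \<le> (\<Omega> * H) * (4 * c ^ 3 * R + 4 * Kn * R)"
        by (rule mult_nonneg_nonneg[OF mult_nonneg_nonneg[OF \<Omega>(1) H0] G])
      from mult_right_mono[OF \<tau>(2) this]
      have "\<tau> * ((\<Omega> * H) * (4 * c ^ 3 * R + 4 * Kn * R)) \<le> (\<Omega> * H) * (4 * c ^ 3 * R + 4 * Kn * R)"
        unfolding mult_1_left .
      also have "\<dots> \<le> (Pc * X) * (4 * c ^ 3 * R + 4 * Kn * R)" by (rule mult_right_mono[OF OH G])
      finally show "\<tau> * ((\<Omega> * H) * (4 * c ^ 3 * R + 4 * Kn * R)) \<le> (Pc * X) * (4 * c ^ 3 * R + 4 * Kn * R)" .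
    qed
    finally show ?thesis by (simp only: mult.assoc mult.commute[of X])
  qed
  have 2: "\<epsilon> \<le> 4 * Cw * Kn * R * X + Cw * K1 / 2 * X + 4 * c ^ 3 * R * Cw * X + 4 * c ^ 3 * R * Pc * X"
  proof -
    have "\<epsilon> = 4 * Cw * Kn * R * H + Cw * K1 / 2 * \<tau>\<^sup>2 + 4 * c ^ 3 * R * Cw * H + 4 * c ^ 3 * R * (\<Omega> * H)"
      unfolding \<epsilon>_def H_def[symmetric] by (simp add: algebra_simps)
    also have "\<dots> \<le> 4 * Cw * Kn * R * X + Cw * K1 / 2 * X + 4 * c ^ 3 * R * Cw * X + 4 * c ^ 3 * R * (Pc * X)"
      by (rule add_mono[OF add_mono[OF add_mono[OF mult_left_mono[OF X(1) cc(3)] mult_left_mono[OF X(2) cc(4)]]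
            mult_left_mono[OF X(1) cc(5)]] mult_left_mono[OF OH cc(1)]])
    finally show ?thesis by (simp only: mult.assoc)
  qed
  have "nrm N (f 0) + nrm N (f 1) + \<epsilon> \<le> 0 + (K2 * X + Pc * (4 * c ^ 3 * R + 4 * Kn * R) * X)
     + (4 * Cw * Kn * R * X + Cw * K1 / 2 * X + 4 * c ^ 3 * R * Cw * X + 4 * c ^ 3 * R * Pc * X)"
    by (intro add_mono 1 2) (simp add: f_0)
  also have "\<dots> = ER * X" unfolding ER_def distrib_right by simp
  finally show ?thesis by (simp add: X_def H_def)
qed

lemma ER_nonneg: "0 \<le> T \<Longrightarrow> 0 \<le> ER"
proof -
  assume "0 \<le> T"
  then have "0 \<le> R" using R0[of 0] by simp
  then show ?thesis unfolding ER_def Pc_def using B0 K_nonneg cpos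
    by (intro add_nonneg_nonneg mult_nonneg_nonneg divide_nonneg_nonneg) auto
qed

text \<open>
  The hypothesis on the earlier steps is what bounds the nonlinear remainder. Step \<open>J\<close> itself is not
  included, which makes the estimate fit for an induction.
\<close>

lemma error_bound:
  assumes J: "real J * \<tau> \<le> T" and T: "0 \<le> T"
    and small: "\<And>i. 1 \<le> i \<Longrightarrow> i < J \<Longrightarrow> \<kappa>\<^sup>2 * sqrt (real N) * nrm N (f i) \<le> 1"
    and \<tau>s: "\<tau> * Ks \<le> 1 / 2"
  shows "nrm N (f J) \<le> 2 * exp (2 * Ks * T) * (ER * (mesh N ^ r + \<tau>\<^sup>2))"
proof (cases "J = 0")
  case True
  then show ?thesis using f_0 ER_nonneg[OF T] mesh_pos[OF N(2)] by simp
next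
  case False
  then have "1 * \<tau> \<le> real J * \<tau>" using \<tau> by (intro mult_right_mono) auto
  then have \<tau>T: "\<tau> \<le> T" using J by simp
  have "0 \<le> R" using R0[of 0] T by simp
  then have e0: "0 \<le> \<epsilon>" unfolding \<epsilon>_def using B0 K_nonneg cpos \<Omega>(1) mesh_pos[OF N(2)]
    by (intro add_nonneg_nonneg mult_nonneg_nonneg divide_nonneg_nonneg) auto
  have "nrm N (f J) \<le> 2 * exp (2 * (lf.Ke * (2 + 4 * C1\<^sup>2)) * T) * (nrm N (f 0) + nrm N (f 1) + \<epsilon>)"
  proof (rule lf.stability[where bb = bb and g = g and J = J])
    fix j assume j: "1 \<le> j" "j < J"
    have "real (Suc j) * \<tau> \<le> real J * \<tau>" using j \<tau> by (intro mult_right_mono) auto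
    then show "nrm N (g j) \<le> C1 * nrm N (f j) + \<epsilon>" using j J small[OF j] by (intro g_bound) auto
  qed (use bb_props[OF T] f_recursion K_nonneg e0 \<tau>s J in \<open>auto simp: Ks_def\<close>)
  also have "\<dots> \<le> 2 * exp (2 * Ks * T) * (ER * (mesh N ^ r + \<tau>\<^sup>2))"
    unfolding Ks_def by (rule mult_left_mono[OF total_error[OF \<tau>T]]) simp
  finally show ?thesis .
qed

lemma l2_error:
  assumes t: "real j * \<tau> \<in> {0..T}"
  shows "l2_norm N (\<lambda>m. u j m - of_real (\<theta> (gridpt N m) (real j * \<tau>))) \<le> sqrt (2 * pi) * nrm N (f j)"
proof -
  have "nrm N (dft N (\<lambda>m. u j m - of_real (\<theta> (gridpt N m) (real j * \<tau>)))) = nrm N (e j)"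
    by (rule nrm_cong) (simp add: dft_diff e_def v_def samp_def[abs_def])
  also have "\<dots> \<le> 1 * nrm N (f j)"
  proof (rule nrm_mono)
    fix m
    have "1 * cmod (e j m) \<le> w m * cmod (e j m)" by (intro mult_right_mono w_ge) simp
    then show "cmod (e j m) \<le> 1 * cmod (f j m)" using w_ge[of m] by (simp add: f_def norm_mult)
  qed simp
  finally show ?thesis unfolding l2_norm_nrm[OF N] by (simp add: mult_left_mono)
qed

end

section \<open>The continuation argument\<close>

context scheme_run
begin

text \<open>
  From \<open>\<kappa> \<le> N\<close> the spatial part is at most of order \<open>N\<^sup>2 h\<^sup>6\<close>, and from \<open>\<kappa> \<le> 1 / \<surd>\<tau>\<close> the temporal
  part is at most \<open>\<tau> \<le> h\<close>. A factor \<open>h\<close> is available against \<open>\<surd>N\<close>.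
\<close>

lemma smallness:
  assumes Q: "0 \<le> Q" and hQ: "mesh N * (3362 * pi * (Q\<^sup>2 + 1)) \<le> 1" and \<tau>h: "\<tau> \<le> mesh N"
  shows "\<kappa>\<^sup>2 * sqrt (real N) * (Q * (mesh N ^ r + \<tau>\<^sup>2)) \<le> 1"
proof -
  define x where "x = mesh N"
  have x: "0 < x" "x \<le> 1" using mesh_pos[OF N(2)] h by (simp_all add: x_def)
  have Nx: "real N * x = 2 * pi" using mesh_mult[OF N(2)] by (simp add: x_def)
  have k0: "0 \<le> \<kappa>" using \<kappa>_ge by linarith
  have 1: "\<kappa>\<^sup>2 * x ^ r \<le> 40 * x"
  proof -
    have "x ^ r \<le> x ^ 6" using x r by (intro power_decreasing) auto
    then have "\<kappa>\<^sup>2 * x ^ r \<le> (real N)\<^sup>2 * x ^ 6"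
      using \<kappa>_ge k0 x by (intro mult_mono power_mono) auto
    also have "\<dots> = (real N * x)\<^sup>2 * x ^ 4" by (simp add: power_mult_distrib flip: power_add)
    also have "\<dots> \<le> 40 * x ^ 4"
    proof (rule mult_right_mono)
      have "pi\<^sup>2 \<le> (3.15)\<^sup>2" using pi_approx(2) pi_gt_zero by (intro power_mono) auto
      then show "(real N * x)\<^sup>2 \<le> 40" unfolding Nx by (simp add: power_mult_distrib power2_eq_square)
    qed (use x in simp)
    also have "\<dots> \<le> 40 * x ^ 1" using x by (intro mult_left_mono power_decreasing) auto
    finally show ?thesis by simp
  qed
  have 2: "\<kappa>\<^sup>2 * \<tau>\<^sup>2 \<le> x"
  proof -
    have "\<kappa>\<^sup>2 \<le> (1 / sqrt \<tau>)\<^sup>2" using k0 by (intro power_mono) (auto simp: \<kappa>_def)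
    also have "\<dots> = 1 / \<tau>" using \<tau> by (simp add: power_divide)
    finally have "\<kappa>\<^sup>2 * \<tau>\<^sup>2 \<le> 1 / \<tau> * \<tau>\<^sup>2" by (rule mult_right_mono) simp
    also have "\<dots> = \<tau>" using \<tau> by (simp add: power2_eq_square)
    finally show ?thesis using \<tau>h by (simp add: x_def)
  qed
  define y where "y = sqrt (real N) * (Q * (41 * x))"
  have "\<kappa>\<^sup>2 * (x ^ r + \<tau>\<^sup>2) \<le> 41 * x" using 1 2 by (simp add: distrib_left)
  then have "sqrt (real N) * (Q * (\<kappa>\<^sup>2 * (x ^ r + \<tau>\<^sup>2))) \<le> y"
    unfolding y_def using Q by (intro mult_left_mono) auto
  moreover have "y \<le> 1"
  proof (rule power2_le_imp_le)
    have "y\<^sup>2 = Q\<^sup>2 * (real N * x) * (1681 * x)" by (simp add: y_def power_mult_distrib power2_eq_square)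
    also have "\<dots> = x * (3362 * pi * Q\<^sup>2)" unfolding Nx by simp
    also have "\<dots> \<le> x * (3362 * pi * (Q\<^sup>2 + 1))" using x by (intro mult_left_mono) auto
    also have "\<dots> \<le> 1\<^sup>2" using hQ by (simp add: x_def)
    finally show "y\<^sup>2 \<le> 1\<^sup>2" .
  qed simp
  moreover have "\<kappa>\<^sup>2 * sqrt (real N) * (Q * (x ^ r + \<tau>\<^sup>2)) = sqrt (real N) * (Q * (\<kappa>\<^sup>2 * (x ^ r + \<tau>\<^sup>2)))"
    by simp
  ultimately show ?thesis unfolding x_def by linarith
qed

text \<open>
  As long as the error was small, it obeys the error estimate, and then it is small at the next step too.
\<close>

lemma bootstrap:
  assumes Q: "Q = 2 * exp (2 * Ks * T) * ER" "0 \<le> Q" and hQ: "mesh N * (3362 * pi * (Q\<^sup>2 + 1)) \<le> 1"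
    and \<tau>h: "\<tau> \<le> mesh N" and \<tau>s: "\<tau> * Ks \<le> 1 / 2" and T: "0 \<le> T"
  shows "real j * \<tau> \<le> T \<Longrightarrow> \<kappa>\<^sup>2 * sqrt (real N) * nrm N (f j) \<le> 1"
proof (induction j rule: less_induct)
  case (less j)
  have "nrm N (f j) \<le> 2 * exp (2 * Ks * T) * (ER * (mesh N ^ r + \<tau>\<^sup>2))"
  proof (rule error_bound[OF less.prems T _ \<tau>s])
    fix i assume i: "1 \<le> i" "i < j"
    have "real i * \<tau> \<le> real j * \<tau>" using i \<tau> by (intro mult_right_mono) auto
    then show "\<kappa>\<^sup>2 * sqrt (real N) * nrm N (f i) \<le> 1" using less i by simp
  qed
  then have "nrm N (f j) \<le> Q * (mesh N ^ r + \<tau>\<^sup>2)" by (simp add: Q(1) mult.assoc)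
  then have "\<kappa>\<^sup>2 * sqrt (real N) * nrm N (f j) \<le> \<kappa>\<^sup>2 * sqrt (real N) * (Q * (mesh N ^ r + \<tau>\<^sup>2))"
    by (intro mult_left_mono) auto
  also have "\<dots> \<le> 1" by (rule smallness[OF Q(2) hQ \<tau>h])
  finally show ?case .
qed

end

section \<open>Constants that depend on the curvature only\<close>

lemma regular_chain:
  assumes reg: "regular_solution T L q \<theta>" and q: "q \<ge> 1"
  obtains M E where "\<And>t. t \<in> {0..T} \<Longrightarrow> chain q M (E t)" "\<And>t. t \<in> {0..T} \<Longrightarrow> E t 0 = (\<lambda>x. \<theta> x t)"
proof -
  obtain M where M: "\<And>t. t \<in> {0..T} \<Longrightarrow> \<exists>D. Cq_derivatives q (\<lambda>\<alpha>. \<theta> \<alpha> t) D \<and>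
        (\<forall>i\<le>q. integral {0..2 * pi} (\<lambda>\<alpha>. (D i \<alpha>)\<^sup>2) \<le> M)"
    using reg unfolding regular_solution_def by blast
  have "\<exists>E. chain q M E \<and> E 0 = (\<lambda>x. \<theta> x t)" if t: "t \<in> {0..T}" for t
  proof -
    obtain D where D: "Cq_derivatives q (\<lambda>\<alpha>. \<theta> \<alpha> t) D"
      "\<And>i. i \<le> q \<Longrightarrow> integral {0..2 * pi} (\<lambda>\<alpha>. (D i \<alpha>)\<^sup>2) \<le> M" using M[OF t] by blast
    show ?thesis using Cq_chain[OF D(1) q D(2)] by blast
  qed
  then obtain E where "\<And>t. t \<in> {0..T} \<Longrightarrow> chain q M (E t) \<and> E t 0 = (\<lambda>x. \<theta> x t)" by metis
  then show ?thesis using that by blast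
qed

lemma chain_deriv:
  assumes "chain q M E" "i < q"
  shows "(deriv ^^ i) (E 0) = E i"
  using assms(2)
proof (induction i)
  case (Suc i)
  then have "(deriv ^^ Suc i) (E 0) = deriv (E i)" by simp
  also have "\<dots> = E (Suc i)"
    by (rule ext) (use chain_DERIV[OF assms(1) Suc.prems] in \<open>blast intro: DERIV_imp_deriv\<close>)
  finally show ?case .
qed simp

text \<open>
  Two solutions with the same curvature differ by a rotation, a constant at each time, which the weights
  \<open>m\<^sup>9\<close> do not see. Bounds obtained for one of them hold for all.
\<close>

lemma flow_same_curvature:
  assumes L: "L > 0" and ch: "\<And>t. t \<in> {0..T} \<Longrightarrow> chain q M (E t)" "q \<ge> 9"
    and ch': "\<And>t. t \<in> {0..T} \<Longrightarrow> chain q' M' (E' t)" "q' \<ge> 9"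
    and E0: "\<And>t. t \<in> {0..T} \<Longrightarrow> E t 0 = (\<lambda>x. \<theta> x t)" and E0': "\<And>t. t \<in> {0..T} \<Longrightarrow> E' t 0 = (\<lambda>x. \<theta>' x t)"
    and reg': "regular_solution T L q' \<theta>'"
    and k: "\<And>t x. t \<in> {0..T} \<Longrightarrow> curvature L \<theta> x t = curvature L \<theta>' x t"
  shows "flow T (2 * pi / L) (512 * sqrt (2 * pi * \<bar>M\<bar>)) \<theta>' E'"
proof
  define B where "B = 512 * sqrt (2 * pi * \<bar>M\<bar>)"
  have sq: "0 \<le> sqrt (2 * pi * \<bar>M\<bar>)" by simp
  have sM: "sqrt M \<le> sqrt (2 * pi * \<bar>M\<bar>)"
    using pi_ge_two mult_right_mono[of 1 "2 * pi" "\<bar>M\<bar>"] by (intro real_sqrt_le_mono) auto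
  have scale: "c * sqrt M \<le> 512 * sqrt (2 * pi * \<bar>M\<bar>)" if "0 \<le> c" "c \<le> 512" for c
    using mult_left_mono[OF sM that(1)] mult_right_mono[OF that(2) sq] by (rule order_trans)
  show "0 < 2 * pi / L" using L by simp
  show "0 \<le> 512 * sqrt (2 * pi * \<bar>M\<bar>)" by simp
  show "E' t 0 = (\<lambda>x. \<theta>' x t)" if "t \<in> {0..T}" for t by (rule E0'[OF that])
  show "per2pi (E' t i)" if "t \<in> {0..T}" "i \<le> 8" for t i
    using ch'(1)[OF that(1)] ch'(2) that(2) by (simp add: chain_def)
  show "(E' t i has_real_derivative E' t (Suc i) x) (at x)" if "t \<in> {0..T}" "i \<le> 7" for t i x
    by (rule chain_DERIV[OF ch'(1)[OF that(1)]]) (use that ch' in auto)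
  have E1: "E' t 1 = E t 1" if t: "t \<in> {0..T}" for t
  proof
    fix x
    have "deriv (\<lambda>x. \<theta> x t) = E t 1" "deriv (\<lambda>x. \<theta>' x t) = E' t 1"
      using chain_deriv[OF ch(1)[OF t], of 1] chain_deriv[OF ch'(1)[OF t], of 1] ch(2) ch'(2)
      by (simp_all add: E0[OF t] E0'[OF t])
    then show "E' t 1 x = E t 1 x" using k[OF t, of x] L by (simp add: curvature_def)
  qed
  have Ei: "E' t i = E t i" if t: "t \<in> {0..T}" and i: "1 \<le> i" "i \<le> 8" for t i
    using i
  proof (induction i rule: dec_induct)
    case (step i)
    have "(E' t i has_real_derivative E' t (Suc i) x) (at x)" "(E t i has_real_derivative E t (Suc i) x) (at x)" for x
      by (rule chain_DERIV[OF ch'(1)[OF t]] chain_DERIV[OF ch(1)[OF t]], use step ch ch' in simp)+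
    moreover have "E' t i = E t i" using step by simp
    ultimately show ?case by (intro ext) (metis DERIV_unique)
  qed (rule E1[OF t])
  show "\<bar>E' t i x\<bar> \<le> 512 * sqrt (2 * pi * \<bar>M\<bar>)" if t: "t \<in> {0..T}" and i: "1 \<le> i" "i \<le> 8" for t i x
  proof -
    have "\<bar>E t i x\<bar> \<le> sqrt (2 * pi * M)" by (rule chain_sup[OF ch(1)[OF t] i(1)]) (use i ch in simp)
    also have "\<dots> \<le> sqrt (2 * pi * \<bar>M\<bar>)" by (intro real_sqrt_le_mono mult_left_mono) auto
    finally show ?thesis using Ei[OF t i] sq by simp
  qed
  show "nrm N (\<lambda>m. of_int m ^ 6 * dft N (samp N (E' t 3)) m) \<le> 512 * sqrt (2 * pi * \<bar>M\<bar>)"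
    if t: "t \<in> {0..T}" and N: "even N" "0 < N" for t N
  proof -
    have "nrm N (\<lambda>m. of_int m ^ 6 * dft N (samp N (E t 3)) m) \<le> 2 ^ 6 * sqrt M"
      by (rule chain_dft[OF ch(1)[OF t] N]) (use ch in auto)
    also have "\<dots> \<le> 512 * sqrt (2 * pi * \<bar>M\<bar>)"
      by (rule scale) simp_all
    finally show ?thesis using Ei[OF t, of 3] by simp
  qed
  show "nrm N (\<lambda>m. of_int m ^ 9 * dft N (samp N (E' t 0)) m) \<le> 512 * sqrt (2 * pi * \<bar>M\<bar>)"
    if t: "t \<in> {0..T}" and N: "even N" "0 < N" for t N
  proof -
    have "((\<lambda>x. E' t 0 x - E t 0 x) has_real_derivative E' t 1 x - E t 1 x) (at x)" for x
      using chain_DERIV[OF ch'(1)[OF t], of 0] chain_DERIV[OF ch(1)[OF t], of 0] ch ch'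
      by (intro DERIV_diff) auto
    then have "((\<lambda>x. E' t 0 x - E t 0 x) has_real_derivative 0) (at x)" for x using E1[OF t] by simp
    then have const: "E' t 0 x - E t 0 x = E' t 0 0 - E t 0 0" for x
      using DERIV_isconst_all[of "\<lambda>x. E' t 0 x - E t 0 x" x 0] by blast
    define a where "a = complex_of_real (E' t 0 0 - E t 0 0)"
    have s: "samp N (E' t 0) = (\<lambda>k. samp N (E t 0) k + a)"
    proof
      fix k
      have "E' t 0 (gridpt N k) = E t 0 (gridpt N k) + (E' t 0 0 - E t 0 0)" using const[of "gridpt N k"] by linarith
      then show "samp N (E' t 0) k = samp N (E t 0) k + a" by (simp only: samp_def a_def of_real_add)
    qed
    have "of_int m ^ 9 * dft N (samp N (E' t 0)) m = of_int m ^ 9 * dft N (samp N (E t 0)) m" if m: "m \<in> grid N" for m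
    proof (cases "m = 0")
      case False
      have "0 \<in> grid N" using N by (auto simp: grid_def)
      then have "\<not> int N dvd - m" using grid_dvd_eq[OF N(1) m, of 0] False by auto
      then have "dft N (\<lambda>k. a) m = 0"
        using sum_wave[OF N, of "- m"] by (simp add: dft_wave flip: sum_distrib_left)
      then show ?thesis unfolding s dft_add by simp
    qed simp
    then have "nrm N (\<lambda>m. of_int m ^ 9 * dft N (samp N (E' t 0)) m) = nrm N (\<lambda>m. of_int m ^ 9 * dft N (samp N (E t 0)) m)"
      by (rule nrm_cong)
    also have "\<dots> \<le> 2 ^ 9 * sqrt M"
      by (rule chain_dft[OF ch(1)[OF t] N]) (use ch in auto)
    also have "\<dots> \<le> 512 * sqrt (2 * pi * \<bar>M\<bar>)"
      by (rule scale) simp_all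
    finally show ?thesis .
  qed
  show "((\<lambda>\<tau>. \<theta>' x \<tau>) has_real_derivative (2 * pi / L) ^ 3 * (E' t 3 x + E' t 1 x ^ 3 / 2)) (at t within {0..T})"
    if t: "t \<in> {0..T}" for t x
  proof -
    have "deriv (\<lambda>x. \<theta>' x t) = E' t 1" "(deriv ^^ 3) (\<lambda>x. \<theta>' x t) = E' t 3"
      using chain_deriv[OF ch'(1)[OF t], of 1] chain_deriv[OF ch'(1)[OF t], of 3] ch'(2)
      by (simp_all add: E0'[OF t])
    moreover have "((\<lambda>\<tau>. \<theta>' x \<tau>) has_real_derivative
           (2 * pi / L) ^ 3 * ((deriv ^^ 3) (\<lambda>x. \<theta>' x t) x + (deriv (\<lambda>x. \<theta>' x t) x) ^ 3 / 2)) (at t within {0..T})"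
      using reg' t unfolding regular_solution_def by blast
    ultimately show ?thesis by simp
  qed
qed

text \<open>
  Apart from the restriction on \<open>\<tau> / h\<close>, which fixes \<open>C0\<close>, all requirements follow from bounds of the form
  \<open>h a \<le> 1\<close>, and \<open>h0\<close> is the inverse of the sum of all \<open>a\<close>.
\<close>

lemma step_restrictions:
  fixes Cb Ks Q B c :: real
  assumes nn: "0 \<le> Cb" "0 \<le> Ks" "0 \<le> B" "0 < c"
  obtains h0 C0 where "h0 > 0" "C0 > 0"
    "\<And>N \<tau>. N > 0 \<Longrightarrow> 0 < \<tau> \<Longrightarrow> mesh N \<le> h0 \<Longrightarrow> \<tau> / mesh N \<le> C0 \<Longrightarrow>
      mesh N \<le> 1 \<and> \<tau> \<le> mesh N \<and> 65 * B * mesh N \<le> 1 \<and> \<tau> * Ks \<le> 1 / 2 \<and>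
      mesh N * (3362 * pi * (Q\<^sup>2 + 1)) \<le> 1 \<and>
      3 * (\<tau> * real N * Cb) + 64 * Cb / (c ^ 3 * (real N)\<^sup>2) \<le> 1"
proof -
  define K where "K = 1 + 65 * B + 2 * Ks + 3362 * pi * (Q\<^sup>2 + 1) + 128 * Cb / c ^ 3"
  define C0 where "C0 = 1 / (1 + 12 * pi * Cb)"
  have parts: "0 \<le> 65 * B" "0 \<le> 2 * Ks" "0 \<le> 3362 * pi * (Q\<^sup>2 + 1)" "0 \<le> 128 * Cb / c ^ 3" "0 \<le> 12 * pi * Cb"
    using nn by (simp_all add: add_nonneg_nonneg)
  have K: "K > 0" unfolding K_def using parts by linarith
  have "0 < 1 / (1 + d) \<and> 1 / (1 + d) \<le> 1 \<and> 1 / (1 + d) * d \<le> 1" if "0 \<le> d" for d :: real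
    using that by simp
  from this[OF parts(5)] have C0: "C0 > 0" "C0 \<le> 1" "C0 * (12 * pi * Cb) \<le> 1" unfolding C0_def by blast+
  have main: "mesh N \<le> 1 \<and> \<tau> \<le> mesh N \<and> 65 * B * mesh N \<le> 1 \<and> \<tau> * Ks \<le> 1 / 2 \<and>
      mesh N * (3362 * pi * (Q\<^sup>2 + 1)) \<le> 1 \<and>
      3 * (\<tau> * real N * Cb) + 64 * Cb / (c ^ 3 * (real N)\<^sup>2) \<le> 1"
    if N: "N > 0" and \<tau>: "0 < \<tau>" and hN: "mesh N \<le> 1 / K" and cf: "\<tau> / mesh N \<le> C0" for N \<tau>
  proof -
    define x where "x = mesh N"
    have x: "x > 0" using mesh_pos[OF N] by (simp add: x_def)
    have Nx: "real N * x = 2 * pi" using mesh_mult[OF N] by (simp add: x_def)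
    have xK: "x * K \<le> 1" using hN K by (simp add: x_def field_simps)
    have sub: "x * y \<le> 1" if "y \<le> K" for y
      using mult_left_mono[OF that, of x] x xK by linarith
    have \<tau>C: "\<tau> \<le> C0 * x" using cf x by (simp add: x_def field_simps)
    have x1: "x \<le> 1" using sub[of 1] parts by (simp add: K_def)
    have \<tau>x: "\<tau> \<le> x" using order_trans[OF \<tau>C mult_right_mono[OF C0(2) less_imp_le[OF x]]] by simp
    have b: "65 * B * x \<le> 1" using sub[of "65 * B"] parts by (simp add: K_def mult_ac)
    have ks: "\<tau> * Ks \<le> 1 / 2"
    proof -
      have "\<tau> * Ks \<le> x * Ks" using \<tau>x nn by (intro mult_right_mono) auto
      also have "x * (2 * Ks) \<le> 1" using parts by (intro sub) (simp add: K_def)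
      then have "x * Ks \<le> 1 / 2" by simp
      finally show ?thesis .
    qed
    have qq: "x * (3362 * pi * (Q\<^sup>2 + 1)) \<le> 1" using parts by (intro sub) (simp add: K_def)
    have c1: "3 * (\<tau> * real N * Cb) \<le> 1 / 2"
    proof -
      have "\<tau> * real N \<le> C0 * x * real N" using \<tau>C by (intro mult_right_mono) auto
      also have "\<dots> = C0 * (2 * pi)" using Nx by (simp add: mult_ac)
      finally have "\<tau> * real N * Cb \<le> C0 * (2 * pi) * Cb" using nn by (intro mult_right_mono) auto
      also have "\<dots> = C0 * (12 * pi * Cb) / 6" by simp
      also have "\<dots> \<le> 1 / 6" by (rule divide_right_mono[OF C0(3)]) simp
      finally show ?thesis by simp
    qed
    have c2: "64 * Cb / (c ^ 3 * (real N)\<^sup>2) \<le> 1 / 2"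
    proof -
      have "1 / (real N)\<^sup>2 \<le> x"
      proof -
        have "1 / real N \<le> x" using Nx N pi_ge_two by (simp add: field_simps)
        then have "(1 / real N)\<^sup>2 \<le> x\<^sup>2" by (intro power_mono) auto
        also have "x\<^sup>2 \<le> x" using x x1 by (simp add: power2_eq_square mult_left_le)
        finally show ?thesis by (simp add: power_divide)
      qed
      then have "64 * Cb / c ^ 3 * (1 / (real N)\<^sup>2) \<le> 64 * Cb / c ^ 3 * x"
        using nn by (intro mult_left_mono) auto
      also have "x * (128 * Cb / c ^ 3) \<le> 1" using parts by (intro sub) (simp add: K_def)
      then have "64 * Cb / c ^ 3 * x \<le> 1 / 2" by (simp add: mult_ac)
      finally show ?thesis by simp
    qed
    show ?thesis using x1 \<tau>x b ks qq c1 c2 unfolding x_def by simp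
  qed
  show ?thesis by (rule that[of "1 / K" C0, OF _ _ main]) (use K C0 in auto)
qed

theorem corollary1:
  fixes T L :: real and k :: "real \<Rightarrow> real \<Rightarrow> real"
  assumes "T > 0" and "L > 0"
  shows "\<exists>h0>0. \<exists>C0>0. \<forall>(r::nat) (\<theta> :: real \<Rightarrow> real \<Rightarrow> real).
    r \<ge> 6 \<longrightarrow> regular_solution T L (r + 3) \<theta> \<longrightarrow>
    (\<forall>t\<in>{0..T}. \<forall>\<alpha>. k \<alpha> t = curvature L \<theta> \<alpha> t) \<longrightarrow>
    (\<exists>C. \<forall>(p::nat) (N::nat) (dt::real) u.
       p \<ge> 1 \<longrightarrow> N = 2 ^ p \<longrightarrow> dt > 0 \<longrightarrow>
       mesh N \<le> h0 \<longrightarrow> dt / mesh N \<le> C0 \<longrightarrow>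
       cnadb_solution L N dt (\<lambda>\<alpha>. \<theta> \<alpha> 0) u \<longrightarrow>
       (\<forall>j::nat. real j * dt \<le> T \<longrightarrow>
          l2_norm N (\<lambda>m. u j m - of_real (\<theta> (gridpt N m) (real j * dt)))
            \<le> C * (mesh N ^ r + dt\<^sup>2)))"
proof (cases "\<exists>(r::nat) \<theta>. r \<ge> 6 \<and> regular_solution T L (r + 3) \<theta> \<and> (\<forall>t\<in>{0..T}. \<forall>\<alpha>. k \<alpha> t = curvature L \<theta> \<alpha> t)")
  case False
  \<comment> \<open>without a regular solution of this curvature any constants will do\<close>
  then show ?thesis by (intro exI[of _ 1] conjI allI impI) (use False in \<open>blast | simp\<close>)+
next
  case True
  then obtain r0 :: nat and \<theta>0 where r0: "r0 \<ge> 6" and reg0: "regular_solution T L (r0 + 3) \<theta>0"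
    and k0: "\<And>t \<alpha>. t \<in> {0..T} \<Longrightarrow> k \<alpha> t = curvature L \<theta>0 \<alpha> t" by blast
  obtain M E where E: "\<And>t. t \<in> {0..T} \<Longrightarrow> chain (r0 + 3) M (E t)" "\<And>t. t \<in> {0..T} \<Longrightarrow> E t 0 = (\<lambda>x. \<theta>0 x t)"
    using regular_chain[OF reg0] by auto
  \<comment> \<open>The constants are read off from one solution \<open>\<theta>0\<close> with the given curvature and serve for all of
    them, whatever their order \<open>r\<close> of regularity. The factor 512 is the constant of
    \<open>chain_dft\<close> for nine derivatives.\<close>
  define B where "B = 512 * sqrt (2 * pi * \<bar>M\<bar>)"
  have B: "0 \<le> B" by (simp add: B_def)
  have flow0: "flow T (2 * pi / L) B \<theta>0 E"
    unfolding B_def by (rule flow_same_curvature[OF assms(2) E(1) _ E(1) _ E(2) E(2) reg0]) (use r0 in auto)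
  define Cb where "Cb = 65 * (flow.Cb0 (2 * pi / L) B + flow.Lb (2 * pi / L) B)"
  have Cb: "0 \<le> Cb" using flow.const_nonneg[OF flow0] by (simp add: Cb_def)
  define Ks where "Ks = scheme_run.Ks L B"
  define Q where "Q = 2 * exp (2 * Ks * T) * scheme_run.ER L B B"
  have cL: "0 < 2 * pi / L" using assms(2) by simp
  obtain h0 C0 where h0: "h0 > 0" "C0 > 0" and res: "\<And>N \<tau>. N > 0 \<Longrightarrow> 0 < \<tau> \<Longrightarrow> mesh N \<le> h0 \<Longrightarrow> \<tau> / mesh N \<le> C0 \<Longrightarrow>
      mesh N \<le> 1 \<and> \<tau> \<le> mesh N \<and> 65 * B * mesh N \<le> 1 \<and> \<tau> * \<bar>Ks\<bar> \<le> 1 / 2 \<and>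
      mesh N * (3362 * pi * (Q\<^sup>2 + 1)) \<le> 1 \<and>
      3 * (\<tau> * real N * Cb) + 64 * Cb / ((2 * pi / L) ^ 3 * (real N)\<^sup>2) \<le> 1"
    using step_restrictions[of Cb "\<bar>Ks\<bar>" B "2 * pi / L" Q] Cb B cL by auto
  show ?thesis
  proof (rule exI[of _ h0], rule conjI[OF h0(1)], rule exI[of _ C0], rule conjI[OF h0(2)], intro allI impI)
    fix r :: nat and \<theta> :: "real \<Rightarrow> real \<Rightarrow> real"
    assume r: "r \<ge> 6" and reg: "regular_solution T L (r + 3) \<theta>"
      and k: "\<forall>t\<in>{0..T}. \<forall>\<alpha>. k \<alpha> t = curvature L \<theta> \<alpha> t"
    obtain M' E' where E': "\<And>t. t \<in> {0..T} \<Longrightarrow> chain (r + 3) M' (E' t)" "\<And>t. t \<in> {0..T} \<Longrightarrow> E' t 0 = (\<lambda>x. \<theta> x t)"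
      using regular_chain[OF reg] by auto
    have kk: "curvature L \<theta>0 x t = curvature L \<theta> x t" if "t \<in> {0..T}" for t x
      using k0[OF that, of x] k that by simp
    have flow1: "flow T (2 * pi / L) B \<theta> E'"
      unfolding B_def by (rule flow_same_curvature[OF assms(2) E(1) _ E'(1) _ E(2) E'(2) reg kk]) (use r r0 in auto)
    define R where "R = 2 ^ (r + 3) * sqrt M'"
    define C where "C = sqrt (2 * pi) * (2 * exp (2 * Ks * T) * scheme_run.ER L B R)"
    show "\<exists>C. \<forall>(p::nat) (N::nat) (dt::real) u.
       p \<ge> 1 \<longrightarrow> N = 2 ^ p \<longrightarrow> dt > 0 \<longrightarrow>
       mesh N \<le> h0 \<longrightarrow> dt / mesh N \<le> C0 \<longrightarrow>
       cnadb_solution L N dt (\<lambda>\<alpha>. \<theta> \<alpha> 0) u \<longrightarrow>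
       (\<forall>j::nat. real j * dt \<le> T \<longrightarrow>
          l2_norm N (\<lambda>m. u j m - of_real (\<theta> (gridpt N m) (real j * dt)))
            \<le> C * (mesh N ^ r + dt\<^sup>2))"
    proof (rule exI[of _ C], intro allI impI)
      fix p N :: nat and dt :: real and u :: "nat \<Rightarrow> int \<Rightarrow> complex" and j :: nat
      assume p: "1 \<le> p" "N = 2 ^ p" and dt: "0 < dt" and hN: "mesh N \<le> h0" and cf: "dt / mesh N \<le> C0"
        and u: "cnadb_solution L N dt (\<lambda>\<alpha>. \<theta> \<alpha> 0) u" and j: "real j * dt \<le> T"
      have N: "even N" "N > 0" using p by simp_all
      note rs = res[OF N(2) dt hN cf]
      have run: "scheme_run T L B \<theta> E' dt R' N r' u"
        if "r' \<ge> 6" "\<And>t M. t \<in> {0..T} \<Longrightarrow> even M \<Longrightarrow> M > 0 \<Longrightarrow>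
          nrm M (\<lambda>m. of_int m ^ (r' + 3) * dft M (samp M (E' t 0)) m) \<le> R'" for r' R'
        by (intro scheme_run.intro flow1 scheme_run_axioms.intro assms(2) N dt u that)
           (use rs in \<open>auto simp: Cb_def\<close>)
      have run6: "scheme_run T L B \<theta> E' dt B N 6 u"
        by (rule run) (use flow.sob[OF flow1] in auto)
      have runr: "scheme_run T L B \<theta> E' dt R N r u"
      proof (rule run[OF r])
        fix t M assume t: "t \<in> {0..T}" and M: "even M" "0 < (M :: nat)"
        show "nrm M (\<lambda>m. of_int m ^ (r + 3) * dft M (samp M (E' t 0)) m) \<le> R"
          unfolding R_def by (rule chain_dft[OF E'(1)[OF t] M]) auto
      qed
      have T0: "0 \<le> T" using assms(1) by simp
      have Q0: "0 \<le> Q" unfolding Q_def using scheme_run.ER_nonneg[OF run6 T0] by simp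
      have dK: "dt * Ks \<le> 1 / 2"
      proof -
        have "dt * Ks \<le> dt * \<bar>Ks\<bar>" using dt by (intro mult_left_mono) auto
        then show ?thesis using rs by linarith
      qed
      \<comment> \<open>The estimate with exponent 6, whose constants depend on the curvature only, keeps the numerical
        solution in the regime where the estimate with exponent \<open>r\<close> applies.\<close>
      have small: "(scheme_run.\<kappa> dt N)\<^sup>2 * sqrt (real N) * nrm N (scheme_run.f \<theta> dt N u i) \<le> 1"
        if "real i * dt \<le> T" for i
        by (rule scheme_run.bootstrap[OF run6 _ Q0 _ _ _ T0 that]) (use rs dK in \<open>auto simp: Q_def Ks_def\<close>)
      have "nrm N (scheme_run.f \<theta> dt N u j) \<le> 2 * exp (2 * scheme_run.Ks L B * T) * (scheme_run.ER L B R * (mesh N ^ r + dt\<^sup>2))"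
      proof (rule scheme_run.error_bound[OF runr j T0])
        fix i assume i: "1 \<le> i" "i < j"
        have "real i * dt \<le> real j * dt" using i dt by (intro mult_right_mono) auto
        then show "(scheme_run.\<kappa> dt N)\<^sup>2 * sqrt (real N) * nrm N (scheme_run.f \<theta> dt N u i) \<le> 1"
          using j by (intro small) simp
      qed (use dK in \<open>simp add: Ks_def\<close>)
      then have "sqrt (2 * pi) * nrm N (scheme_run.f \<theta> dt N u j)
          \<le> sqrt (2 * pi) * (2 * exp (2 * scheme_run.Ks L B * T) * (scheme_run.ER L B R * (mesh N ^ r + dt\<^sup>2)))"
        by (intro mult_left_mono) auto
      also have "\<dots> = C * (mesh N ^ r + dt\<^sup>2)" by (simp add: C_def Ks_def)
      finally have "sqrt (2 * pi) * nrm N (scheme_run.f \<theta> dt N u j) \<le> C * (mesh N ^ r + dt\<^sup>2)" .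
      moreover have "real j * dt \<in> {0..T}" using j dt by simp
      ultimately show "l2_norm N (\<lambda>m. u j m - of_real (\<theta> (gridpt N m) (real j * dt))) \<le> C * (mesh N ^ r + dt\<^sup>2)"
        using scheme_run.l2_error[OF runr] by (meson order_trans)
    qed
  qed
qed

end
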